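(* Let $H$ and $K$ be arbitrary Hilbert spaces. Then the left contractive module $L\mathbin{\dot\otimes}H$ and the right contractive module $L^{c}\mathbin{\dot\otimes}H$ are ESR-injective, whereas the contractive bimodule $\mathcal B(L\mathbin{\dot\otimes}H,L\mathbin{\dot\otimes}K)$ is ER-injective.
   Context: All spaces are complex; normed spaces need not be complete. $L$ is a fixed separable infinite-dimensional Hilbert space, $\mathcal B=\mathcal B(L)$ is the algebra of all bounded operators on $L$ with operator norm. "Left module", "right module", "bimodule" mean unital (bi)modules over $\mathcal B$; morphisms are $\mathcal B$-(bi)module morphisms. Module multiplications are denoted by a dot. A projection is a self-adjoint idempotent in $\mathcal B$. "Isometric" means norm-preserving (not necessarily surjective). A left (right) module that is a normed space is contractive if $\|a\cdot u\|\le\|a\|\|u\|$ (resp. $\|u\cdot a\|\le\|a\|\|u\|$) always; a bimodule is contractive if both hold. A left (right) support of $u$ is a projection $P$ with $P\cdot u=u$ (resp. $u\cdot P=u$); in a bimodule, a support of $u$ is a projection that is both a left and a right support. A left (right) semi-Ruan module is a contractive left (right) module such that $\|u+v\|\le(\|u\|^2+\|v\|^2)^{1/2}$ whenever $u,v$ have orthogonal left (right) supports (i.e. admit such supports $P,Q$ respectively with $PQ=0$). A Ruan bimodule is a contractive bimodule such that $\|u+v\|=\max\{\|u\|,\|v\|\}$ whenever $u,v$ have orthogonal supports. A contractive left module $X$ is ESR-injective if for every isometric morphism $\alpha:Y\to Z$ of left semi-Ruan modules and every bounded left module morphism $\Phi:Y\to X$ there is a bounded left module morphism $\Psi:Z\to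 X$ with $\Psi\alpha=\Phi$ and $\|\Psi\|=\|\Phi\|$. ESR-injectivity of a contractive right module is defined symmetrically with right (semi-Ruan) modules. A contractive bimodule $X$ is ER-injective if the same holds with isometric morphisms of Ruan bimodules and bounded bimodule morphisms. $L^c$ is the complex conjugate Hilbert space of $L$; operators on $L$ are also linear operators on $L^c$. $\dot\otimes$ is the Hilbert (completed) tensor product of Hilbert spaces and operators. $L\mathbin{\dot\otimes}H$ is a left module via $a\cdot\zeta=(a\mathbin{\dot\otimes}\mathbf 1_H)\zeta$; $L^c\mathbin{\dot\otimes}H$ is a right module via $\zeta\cdot a=(a^*\mathbin{\dot\otimes}\mathbf 1_H)\zeta$. The space $\mathcal B(L\mathbin{\dot\otimes}H,L\mathbin{\dot\otimes}K)$ of bounded operators, with operator norm, is a bimodule via $a\cdot\tilde b:=(a\mathbin{\dot\otimes}\mathbf 1_K)\tilde b$ and $\tilde b\cdot a:=\tilde b(a\mathbin{\dot\otimes}\mathbf 1_H)$. *)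

theory Defs
  imports "HOL-Analysis.Analysis"
begin

section \<open>Complex normed spaces and Hilbert spaces\<close>

class complex_vector = real_vector +
  fixes scaleC :: "complex \<Rightarrow> 'a \<Rightarrow> 'a"  (infixr "*\<^sub>C" 75)
  assumes scaleC_add_right: "c *\<^sub>C (x + y) = c *\<^sub>C x + c *\<^sub>C y"
    and scaleC_add_left: "(c + d) *\<^sub>C x = c *\<^sub>C x + d *\<^sub>C x"
    and scaleC_scaleC: "c *\<^sub>C d *\<^sub>C x = (c * d) *\<^sub>C x"
    and scaleC_one: "1 *\<^sub>C x = x"
    and scaleR_scaleC: "r *\<^sub>R x = complex_of_real r *\<^sub>C x"

global_interpretation complex_vector: vector_space "scaleC :: complex \<Rightarrow> 'a \<Rightarrow> 'a::complex_vector"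
  by unfold_locales (simp_all add: scaleC_add_right scaleC_add_left scaleC_scaleC scaleC_one)

abbreviation cspan :: "'a::complex_vector set \<Rightarrow> 'a set"
  where "cspan \<equiv> module.span scaleC"

class complex_normed_vector = complex_vector + real_normed_vector +
  assumes norm_scaleC: "norm (c *\<^sub>C x) = cmod c * norm x"

text \<open>The complex inner product is conjugate-linear in the first argument. Since its real part
  is the inner product of the library, positivity of \<open>cinner\<close> and \<open>norm x = sqrt (cinner x x)\<close>
  are inherited from \<^class>\<open>real_inner\<close>.\<close>

class complex_inner = complex_vector + real_inner +
  fixes cinner :: "'a \<Rightarrow> 'a \<Rightarrow> complex"
  assumes cinner_commute: "cinner x y = cnj (cinner y x)"
    and cinner_add_left: "cinner (x + y) z = cinner x z + cinner y z"
    and cinner_scaleC_left: "cinner (c *\<^sub>C x) y = cnj c * cinner x y"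
    and Re_cinner: "Re (cinner x y) = inner x y"
begin

lemma cinner_add_right: "cinner x (y + z) = cinner x y + cinner x z"
  by (subst (1 2 3) cinner_commute) (simp add: cinner_add_left)

lemma cinner_scaleC_right: "cinner x (c *\<^sub>C y) = c * cinner x y"
  by (subst (1 2) cinner_commute) (simp add: cinner_scaleC_left)

lemma Im_cinner_self: "Im (cinner x x) = 0"
  using arg_cong[OF cinner_commute[of x x], of Im] by simp

lemma cinner_self: "cinner x x = complex_of_real ((norm x)\<^sup>2)"
  by (simp add: complex_eq_iff Im_cinner_self Re_cinner power2_norm_eq_inner)

subclass complex_normed_vector
proof
  fix c x
  have "complex_of_real ((norm (c *\<^sub>C x))\<^sup>2) = cnj c * c * complex_of_real ((norm x)\<^sup>2)"
    unfolding cinner_self[symmetric] by (simp add: cinner_scaleC_left cinner_scaleC_right)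
  also have "cnj c * c = complex_of_real ((cmod c)\<^sup>2)"
    by (metis complex_norm_square mult.commute)
  finally have "(norm (c *\<^sub>C x))\<^sup>2 = (cmod c * norm x)\<^sup>2"
    by (metis of_real_eq_iff of_real_mult power_mult_distrib)
  then show "norm (c *\<^sub>C x) = cmod c * norm x"
    by (simp add: power2_eq_iff_nonneg)
qed

end

class chilbert_space = complex_inner + complete_space

instantiation complex :: chilbert_space
begin
definition scaleC_complex :: "complex \<Rightarrow> complex \<Rightarrow> complex" where "scaleC_complex = (*)"
definition cinner_complex :: "complex \<Rightarrow> complex \<Rightarrow> complex" where "cinner_complex x y = cnj x * y"
instance
  by standard
    (simp_all add: scaleC_complex_def cinner_complex_def algebra_simps inner_complex_def scaleR_conv_of_real)
end

section \<open>Bounded complex-linear operators\<close>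

definition bounded_clinear :: "('a::complex_normed_vector \<Rightarrow> 'b::complex_normed_vector) \<Rightarrow> bool"
  where "bounded_clinear f \<longleftrightarrow> bounded_linear f \<and> (\<forall>c x. f (c *\<^sub>C x) = c *\<^sub>C f x)"

typedef (overloaded) ('a, 'b) cblinfun ("(_ \<Rightarrow>\<^sub>C\<^sub>L /_)" [22, 21] 21) =
  "{f :: 'a::complex_normed_vector \<Rightarrow> 'b::complex_normed_vector. bounded_clinear f}"
  morphisms cblinfun_apply cBlinfun
  by (rule exI[of _ "\<lambda>_. 0"]) (simp add: bounded_clinear_def)

setup_lifting type_definition_cblinfun

notation cblinfun_apply (infixr "*\<^sub>V" 70)

instantiation cblinfun :: (complex_normed_vector, complex_normed_vector) complex_normed_vector
begin

lift_definition norm_cblinfun :: "('a \<Rightarrow>\<^sub>C\<^sub>L 'b) \<Rightarrow> real" is onorm .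

lift_definition zero_cblinfun :: "'a \<Rightarrow>\<^sub>C\<^sub>L 'b" is "\<lambda>_. 0"
  by (simp add: bounded_clinear_def)

lift_definition uminus_cblinfun :: "('a \<Rightarrow>\<^sub>C\<^sub>L 'b) \<Rightarrow> 'a \<Rightarrow>\<^sub>C\<^sub>L 'b" is "\<lambda>f x. - f x"
  by (simp add: bounded_clinear_def bounded_linear_minus)

lift_definition plus_cblinfun :: "('a \<Rightarrow>\<^sub>C\<^sub>L 'b) \<Rightarrow> ('a \<Rightarrow>\<^sub>C\<^sub>L 'b) \<Rightarrow> 'a \<Rightarrow>\<^sub>C\<^sub>L 'b"
  is "\<lambda>f g x. f x + g x"
  by (simp add: bounded_clinear_def bounded_linear_add scaleC_add_right)

lift_definition minus_cblinfun :: "('a \<Rightarrow>\<^sub>C\<^sub>L 'b) \<Rightarrow> ('a \<Rightarrow>\<^sub>C\<^sub>L 'b) \<Rightarrow> 'a \<Rightarrow>\<^sub>C\<^sub>L 'b"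
  is "\<lambda>f g x. f x - g x"
  by (simp add: bounded_clinear_def bounded_linear_sub complex_vector.scale_right_diff_distrib)

lift_definition scaleC_cblinfun :: "complex \<Rightarrow> ('a \<Rightarrow>\<^sub>C\<^sub>L 'b) \<Rightarrow> 'a \<Rightarrow>\<^sub>C\<^sub>L 'b"
  is "\<lambda>c f x. c *\<^sub>C f x"
proof -
  fix c :: complex and f :: "'a \<Rightarrow> 'b" assume f: "bounded_clinear f"
  then interpret bounded_linear f by (simp add: bounded_clinear_def)
  obtain K where K: "\<And>x. norm (f x) \<le> norm x * K" using bounded by blast
  have "bounded_linear (\<lambda>x. c *\<^sub>C f x)"
  proof (rule bounded_linear_intro)
    fix x y r
    show "c *\<^sub>C f (x + y) = c *\<^sub>C f x + c *\<^sub>C f y" by (simp add: add scaleC_add_right)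
    show "c *\<^sub>C f (r *\<^sub>R x) = r *\<^sub>R c *\<^sub>C f x"
      unfolding scaleR by (simp add: scaleR_scaleC scaleC_scaleC mult.commute)
    show "norm (c *\<^sub>C f x) \<le> norm x * (cmod c * K)"
      using mult_left_mono[OF K[of x], of "cmod c"] by (simp add: norm_scaleC mult_ac)
  qed
  with f show "bounded_clinear (\<lambda>x. c *\<^sub>C f x)"
    by (simp add: bounded_clinear_def scaleC_scaleC mult.commute)
qed

definition scaleR_cblinfun :: "real \<Rightarrow> ('a \<Rightarrow>\<^sub>C\<^sub>L 'b) \<Rightarrow> 'a \<Rightarrow>\<^sub>C\<^sub>L 'b"
  where "scaleR_cblinfun r f = complex_of_real r *\<^sub>C f"

definition dist_cblinfun :: "('a \<Rightarrow>\<^sub>C\<^sub>L 'b) \<Rightarrow> ('a \<Rightarrow>\<^sub>C\<^sub>L 'b) \<Rightarrow> real"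
  where "dist_cblinfun f g = norm (f - g)"

definition uniformity_cblinfun :: "(('a \<Rightarrow>\<^sub>C\<^sub>L 'b) \<times> ('a \<Rightarrow>\<^sub>C\<^sub>L 'b)) filter"
  where "uniformity_cblinfun = (INF e\<in>{0 <..}. principal {(x, y). dist x y < e})"

definition open_cblinfun :: "('a \<Rightarrow>\<^sub>C\<^sub>L 'b) set \<Rightarrow> bool"
  where "open_cblinfun S = (\<forall>x\<in>S. \<forall>\<^sub>F (x', y) in uniformity. x' = x \<longrightarrow> y \<in> S)"

definition sgn_cblinfun :: "('a \<Rightarrow>\<^sub>C\<^sub>L 'b) \<Rightarrow> 'a \<Rightarrow>\<^sub>C\<^sub>L 'b"
  where "sgn_cblinfun f = inverse (norm f) *\<^sub>R f"

instance
proof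
  fix f g h :: "'a \<Rightarrow>\<^sub>C\<^sub>L 'b" and c d :: complex and r s :: real
  show "f + g + h = f + (g + h)" "f + g = g + f" "0 + f = f" "- f + f = 0" "f - g = f + - g"
    by (transfer, simp add: algebra_simps)+
  have C: "c *\<^sub>C (f + g) = c *\<^sub>C f + c *\<^sub>C g" "(c + d) *\<^sub>C f = c *\<^sub>C f + d *\<^sub>C f"
    "c *\<^sub>C d *\<^sub>C f = (c * d) *\<^sub>C f" "1 *\<^sub>C f = f" for c d and f g :: "'a \<Rightarrow>\<^sub>C\<^sub>L 'b"
    by (transfer, simp add: scaleC_add_right scaleC_add_left scaleC_scaleC scaleC_one)+
  show "c *\<^sub>C (f + g) = c *\<^sub>C f + c *\<^sub>C g" "(c + d) *\<^sub>C f = c *\<^sub>C f + d *\<^sub>C f"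
    "c *\<^sub>C d *\<^sub>C f = (c * d) *\<^sub>C f" "1 *\<^sub>C f = f"
    by (simp_all add: C)
  show "r *\<^sub>R f = complex_of_real r *\<^sub>C f" by (fact scaleR_cblinfun_def)
  show "r *\<^sub>R (f + g) = r *\<^sub>R f + r *\<^sub>R g" "(r + s) *\<^sub>R f = r *\<^sub>R f + s *\<^sub>R f"
    "r *\<^sub>R s *\<^sub>R f = (r * s) *\<^sub>R f" "1 *\<^sub>R f = f"
    by (simp_all add: scaleR_cblinfun_def C)
  show "dist f g = norm (f - g)" by (fact dist_cblinfun_def)
  show "sgn f = inverse (norm f) *\<^sub>R f" by (fact sgn_cblinfun_def)
  show "(uniformity :: (('a \<Rightarrow>\<^sub>C\<^sub>L 'b) \<times> ('a \<Rightarrow>\<^sub>C\<^sub>L 'b)) filter) =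
    (INF e\<in>{0 <..}. principal {(x, y). dist x y < e})" by (fact uniformity_cblinfun_def)
  show "open U = (\<forall>x\<in>U. \<forall>\<^sub>F (x', y) in uniformity. x' = x \<longrightarrow> y \<in> U)" for U :: "('a \<Rightarrow>\<^sub>C\<^sub>L 'b) set"
    by (fact open_cblinfun_def)
  show "norm f = 0 \<longleftrightarrow> f = 0"
    by transfer (auto simp: bounded_clinear_def onorm_eq_0)
  show "norm (f + g) \<le> norm f + norm g"
    by transfer (simp add: bounded_clinear_def onorm_triangle)
  have N: "norm (c *\<^sub>C f) = cmod c * norm f" for c and f :: "'a \<Rightarrow>\<^sub>C\<^sub>L 'b"
  proof (transfer, unfold bounded_clinear_def, elim conjE)
    fix c and f :: "'a \<Rightarrow> 'b" assume f: "bounded_linear f"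
    have "onorm (\<lambda>x. c *\<^sub>C f x) = onorm (\<lambda>x. cmod c *\<^sub>R f x)"
      by (simp add: onorm_def norm_scaleC)
    then show "onorm (\<lambda>x. c *\<^sub>C f x) = cmod c * onorm f"
      using onorm_scaleR[OF f, of "cmod c"] by simp
  qed
  show "norm (c *\<^sub>C f) = cmod c * norm f" by (fact N)
  show "norm (r *\<^sub>R f) = \<bar>r\<bar> * norm f"
    by (simp add: scaleR_cblinfun_def N)
qed

end

lift_definition cblinfun_id :: "'a::complex_normed_vector \<Rightarrow>\<^sub>C\<^sub>L 'a" is "\<lambda>x. x"
  by (simp add: bounded_clinear_def)

lift_definition cblinfun_compose ::
  "('b::complex_normed_vector \<Rightarrow>\<^sub>C\<^sub>L 'c::complex_normed_vector) \<Rightarrow> ('a::complex_normed_vector \<Rightarrow>\<^sub>C\<^sub>L 'b)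
    \<Rightarrow> 'a \<Rightarrow>\<^sub>C\<^sub>L 'c"  (infixl "o\<^sub>C\<^sub>L" 67)
  is "\<lambda>f g x. f (g x)"
  by (simp add: bounded_clinear_def bounded_linear_compose)

lemma cblinfun_eqI: "(\<And>x. f *\<^sub>V x = g *\<^sub>V x) \<Longrightarrow> f = g"
  by transfer auto

lemma bounded_clinear_cblinfun_apply: "bounded_clinear (cblinfun_apply f)"
  using cblinfun_apply by blast

lemma bounded_linear_cblinfun_apply: "bounded_linear (cblinfun_apply f)"
  using bounded_clinear_cblinfun_apply by (auto simp: bounded_clinear_def)

lemma cblinfun_scaleC_right: "f *\<^sub>V (c *\<^sub>C x) = c *\<^sub>C (f *\<^sub>V x)"
  using bounded_clinear_cblinfun_apply by (auto simp: bounded_clinear_def)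

lemma norm_cblinfun_apply_le: "norm (f *\<^sub>V x) \<le> norm f * norm x"
  by transfer (simp add: bounded_clinear_def onorm)

text \<open>Existence and uniqueness of the adjoint is \<open>cadjoint_cinner\<close>, \<open>cadjoint_unique\<close> below.\<close>

definition cadjoint :: "('a::chilbert_space \<Rightarrow>\<^sub>C\<^sub>L 'b::chilbert_space) \<Rightarrow> 'b \<Rightarrow>\<^sub>C\<^sub>L 'a"
  where "cadjoint a = (THE b. \<forall>x y. cinner (b *\<^sub>V y) x = cinner y (a *\<^sub>V x))"

definition projection :: "('a::chilbert_space \<Rightarrow>\<^sub>C\<^sub>L 'a) \<Rightarrow> bool"
  where "projection P \<longleftrightarrow> cadjoint P = P \<and> P o\<^sub>C\<^sub>L P = P"

lemma riesz_real:
  fixes f :: "'a::{real_inner, complete_space} \<Rightarrow> real"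
  assumes "bounded_linear f"
  shows "\<exists>v. \<forall>x. f x = inner v x"
proof -
  interpret bounded_linear f by fact
  obtain K where K: "\<And>x. norm (f x) \<le> norm x * K" using bounded by blast
  define J where "J x = inner x x - 2 * f x" for x
  have lower: "J x \<ge> - K\<^sup>2" for x
  proof -
    have "2 * f x \<le> 2 * (norm x * K)" using K[of x] by simp
    also have "\<dots> \<le> (norm x)\<^sup>2 + K\<^sup>2" using sum_squares_bound[of "norm x" K] by simp
    finally show ?thesis by (simp add: J_def power2_norm_eq_inner)
  qed
  define m where "m = Inf (range J)"
  have bdd: "bdd_below (range J)" using lower by (auto intro!: bdd_belowI)
  have m_le: "m \<le> J x" for x unfolding m_def by (rule cInf_lower[OF _ bdd]) simp
  have "\<exists>x. J x < m + inverse (real (Suc n))" for n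
  proof (rule ccontr)
    assume "\<not> ?thesis"
    then have "m + inverse (real (Suc n)) \<le> m"
      unfolding m_def by (intro cInf_greatest) (auto simp: not_less)
    then show False by (simp add: field_simps)
  qed
  then obtain X where X: "\<And>n. J (X n) < m + inverse (real (Suc n))" by metis
  have par: "(norm (x - y))\<^sup>2 \<le> 2 * (J x - m) + 2 * (J y - m)" for x y
  proof -
    have "(norm (x - y))\<^sup>2 = 2 * J x + 2 * J y - 4 * J ((1/2) *\<^sub>R (x + y))"
      by (simp add: J_def power2_norm_eq_inner inner_simps scaleR add inner_commute algebra_simps)
    then show ?thesis using m_le[of "(1/2) *\<^sub>R (x + y)"] by simp
  qed
  have "Cauchy X"
  proof (rule metric_CauchyI)
    fix e :: real assume "e > 0"
    then obtain N where N: "inverse (real (Suc N)) < e\<^sup>2 / 4"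
      using reals_Archimedean[of "e\<^sup>2 / 4"] by auto
    show "\<exists>M. \<forall>m\<ge>M. \<forall>n\<ge>M. dist (X m) (X n) < e"
    proof (intro exI allI impI)
      fix p q assume "N \<le> p" "N \<le> q"
      then have "inverse (real (Suc p)) \<le> inverse (real (Suc N))"
        "inverse (real (Suc q)) \<le> inverse (real (Suc N))" by (auto intro!: le_imp_inverse_le)
      then have "J (X p) - m < e\<^sup>2 / 4" "J (X q) - m < e\<^sup>2 / 4"
        using X[of p] X[of q] N by linarith+
      then have "(norm (X p - X q))\<^sup>2 < e\<^sup>2"
        using par[of "X p" "X q"] by simp
      then show "dist (X p) (X q) < e"
        using \<open>e > 0\<close> by (metis dist_norm less_imp_le power_less_imp_less_base)
    qed
  qed
  then obtain v where v: "X \<longlonglongrightarrow> v" using Cauchy_convergent unfolding convergent_def by blast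
  have "(\<lambda>n. J (X n)) \<longlonglongrightarrow> J v"
    unfolding J_def by (intro tendsto_intros tendsto[OF v] v)
  moreover have "(\<lambda>n. J (X n)) \<longlonglongrightarrow> m"
  proof (rule tendsto_sandwich[where f = "\<lambda>_. m" and h = "\<lambda>n. m + inverse (real (Suc n))"])
    show "(\<lambda>n. m + inverse (real (Suc n))) \<longlonglongrightarrow> m"
      using tendsto_add[OF tendsto_const LIMSEQ_inverse_real_of_nat, of m] by simp
  qed (use m_le X in \<open>auto intro!: always_eventually less_imp_le\<close>)
  ultimately have Jv: "J v = m" using LIMSEQ_unique by blast
  have "f y = inner v y" for y
  proof -
    define d where "d = inner v y - f y"
    have ineq: "0 \<le> 2 * t * d + t\<^sup>2 * inner y y" for t
    proof -
      have "J (v + t *\<^sub>R y) = J v + 2 * t * d + t\<^sup>2 * inner y y"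
        by (simp add: J_def d_def inner_simps scaleR add inner_commute algebra_simps power2_eq_square)
      then show ?thesis using m_le[of "v + t *\<^sub>R y"] Jv by simp
    qed
    have "d = 0"
    proof (rule ccontr)
      assume "d \<noteq> 0"
      define s where "s = inner y y + 1"
      have s: "s > 0" unfolding s_def by (simp add: add_nonneg_pos)
      have "0 \<le> 2 * (- d / s) * d + (- d / s)\<^sup>2 * inner y y" by (rule ineq)
      also have "\<dots> \<le> 2 * (- d / s) * d + (- d / s)\<^sup>2 * s"
        by (intro add_left_mono mult_left_mono) (auto simp: s_def)
      also have "\<dots> = - (d\<^sup>2 / s)" using s by (simp add: field_simps power2_eq_square)
      also have "\<dots> < 0" using s \<open>d \<noteq> 0\<close> by simp
      finally show False by simp
    qed
    then show ?thesis by (simp add: d_def)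
  qed
  then show ?thesis by blast
qed

lemma inner_eq_imp_cinner_eq:
  fixes u :: "'a::complex_inner" and v :: "'b::complex_inner" and g :: "'c::complex_vector \<Rightarrow> 'a"
  assumes "\<And>x. inner u (g x) = inner v (h x)"
    and "\<And>c x. g (c *\<^sub>C x) = c *\<^sub>C g x" and "\<And>c x. h (c *\<^sub>C x) = c *\<^sub>C h x"
  shows "cinner u (g x) = cinner v (h x)"
proof (rule complex_eqI)
  show "Re (cinner u (g x)) = Re (cinner v (h x))" using assms(1) by (simp add: Re_cinner)
  have "Re (cinner u (\<i> *\<^sub>C g x)) = Re (cinner v (\<i> *\<^sub>C h x))"
    using assms(1)[of "\<i> *\<^sub>C x"] by (simp add: Re_cinner assms)
  then show "Im (cinner u (g x)) = Im (cinner v (h x))" by (simp add: cinner_scaleC_right)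
qed

lemma cinner_right_eqI:
  fixes u v :: "'a::complex_inner"
  assumes "\<And>x. cinner u x = cinner v x"
  shows "u = v"
proof -
  have "inner u x = inner v x" for x by (metis Re_cinner assms)
  then show ?thesis by (metis inner_diff_left inner_eq_zero_iff right_minus_eq)
qed

lemma cadjoint_exists:
  fixes a :: "'a::chilbert_space \<Rightarrow>\<^sub>C\<^sub>L 'b::chilbert_space"
  shows "\<exists>b :: 'b \<Rightarrow>\<^sub>C\<^sub>L 'a. \<forall>x y. cinner (b *\<^sub>V y) x = cinner y (a *\<^sub>V x)"
proof -
  interpret a: bounded_linear "cblinfun_apply a" by (rule bounded_linear_cblinfun_apply)
  have "\<exists>v. \<forall>x. inner y (a *\<^sub>V x) = inner v x" for y
    by (rule riesz_real) (intro bounded_linear_inner_right_comp a.bounded_linear_axioms)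
  then obtain b where "\<And>y x. inner y (a *\<^sub>V x) = inner (b y) x" by metis
  then have b: "cinner (b y) x = cinner y (a *\<^sub>V x)" for x y
    using inner_eq_imp_cinner_eq[of "b y" "\<lambda>x. x" y "cblinfun_apply a"]
    by (simp add: cblinfun_scaleC_right)
  have add: "b (y + z) = b y + b z" for y z
    by (rule cinner_right_eqI) (simp add: b cinner_add_left)
  have scale: "b (c *\<^sub>C y) = c *\<^sub>C b y" for c y
    by (rule cinner_right_eqI) (simp add: b cinner_scaleC_left)
  have bound: "norm (b y) \<le> norm y * norm a" for y
  proof (cases "b y = 0")
    case False
    have "(norm (b y))\<^sup>2 = inner y (a *\<^sub>V b y)"
      by (metis Re_cinner b power2_norm_eq_inner)
    also have "\<dots> \<le> norm y * (norm a * norm (b y))"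
      by (meson order_trans norm_cauchy_schwarz norm_cblinfun_apply_le mult_left_mono norm_ge_zero)
    finally show ?thesis using False by (simp add: power2_eq_square)
  qed simp
  have "bounded_clinear b"
    unfolding bounded_clinear_def
    by (auto intro!: bounded_linear_intro[of _ "norm a"] simp: add scale scaleR_scaleC bound)
  then show ?thesis by (intro exI[of _ "cBlinfun b"]) (simp add: cBlinfun_inverse b)
qed

lemma cadjoint_unique:
  assumes "\<And>x y. cinner (b *\<^sub>V y) x = cinner y (a *\<^sub>V x)"
  shows "cadjoint a = b"
  unfolding cadjoint_def
proof (rule the_equality)
  fix b' assume "\<forall>x y. cinner (b' *\<^sub>V y) x = cinner y (a *\<^sub>V x)"
  then show "b' = b" by (auto intro!: cblinfun_eqI[OF cinner_right_eqI] simp: assms)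
qed (simp add: assms)

lemma cadjoint_cinner: "cinner (cadjoint a *\<^sub>V y) x = cinner y (a *\<^sub>V x)"
proof -
  obtain b where b: "\<And>x y. cinner (b *\<^sub>V y) x = cinner y (a *\<^sub>V x)"
    using cadjoint_exists[of a] by blast
  then show ?thesis using cadjoint_unique[of b a] by simp
qed

section \<open>The complex conjugate Hilbert space\<close>

typedef (overloaded) 'a conj_space = "UNIV :: 'a set"
  morphisms from_conj to_conj ..

setup_lifting type_definition_conj_space

instantiation conj_space :: (complex_inner) complex_inner
begin

lift_definition zero_conj_space :: "'a conj_space" is 0 .
lift_definition plus_conj_space :: "'a conj_space \<Rightarrow> 'a conj_space \<Rightarrow> 'a conj_space" is "(+)" .
lift_definition minus_conj_space :: "'a conj_space \<Rightarrow> 'a conj_space \<Rightarrow> 'a conj_space" is "(-)" .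
lift_definition uminus_conj_space :: "'a conj_space \<Rightarrow> 'a conj_space" is uminus .
lift_definition scaleR_conj_space :: "real \<Rightarrow> 'a conj_space \<Rightarrow> 'a conj_space" is scaleR .
lift_definition scaleC_conj_space :: "complex \<Rightarrow> 'a conj_space \<Rightarrow> 'a conj_space"
  is "\<lambda>c x. cnj c *\<^sub>C x" .
lift_definition norm_conj_space :: "'a conj_space \<Rightarrow> real" is norm .
lift_definition inner_conj_space :: "'a conj_space \<Rightarrow> 'a conj_space \<Rightarrow> real" is inner .
lift_definition cinner_conj_space :: "'a conj_space \<Rightarrow> 'a conj_space \<Rightarrow> complex"
  is "\<lambda>x y. cinner y x" .
lift_definition sgn_conj_space :: "'a conj_space \<Rightarrow> 'a conj_space" is sgn .
lift_definition dist_conj_space :: "'a conj_space \<Rightarrow> 'a conj_space \<Rightarrow> real" is dist .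

definition uniformity_conj_space :: "('a conj_space \<times> 'a conj_space) filter"
  where "uniformity_conj_space = (INF e\<in>{0 <..}. principal {(x, y). dist x y < e})"

definition open_conj_space :: "'a conj_space set \<Rightarrow> bool"
  where "open_conj_space S = (\<forall>x\<in>S. \<forall>\<^sub>F (x', y) in uniformity. x' = x \<longrightarrow> y \<in> S)"

instance
proof
  fix x y z :: "'a conj_space" and c d :: complex and r s :: real
  show "x + y + z = x + (y + z)" "x + y = y + x" "0 + x = x" "- x + x = 0" "x - y = x + - y"
    by (transfer, simp add: algebra_simps)+
  show "c *\<^sub>C (x + y) = c *\<^sub>C x + c *\<^sub>C y" "(c + d) *\<^sub>C x = c *\<^sub>C x + d *\<^sub>C x"
    "c *\<^sub>C d *\<^sub>C x = (c * d) *\<^sub>C x" "1 *\<^sub>C x = x"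
    by (transfer, simp add: scaleC_add_right scaleC_add_left scaleC_scaleC scaleC_one)+
  show "r *\<^sub>R x = complex_of_real r *\<^sub>C x"
    by (transfer, simp add: scaleR_scaleC)
  show "r *\<^sub>R (x + y) = r *\<^sub>R x + r *\<^sub>R y" "(r + s) *\<^sub>R x = r *\<^sub>R x + s *\<^sub>R x"
    "r *\<^sub>R s *\<^sub>R x = (r * s) *\<^sub>R x" "1 *\<^sub>R x = x"
    by (transfer, simp add: algebra_simps)+
  show "dist x y = norm (x - y)" by (transfer, simp add: dist_norm)
  show "sgn x = inverse (norm x) *\<^sub>R x" by (transfer, simp add: sgn_div_norm)
  show "(uniformity :: ('a conj_space \<times> 'a conj_space) filter) =
    (INF e\<in>{0 <..}. principal {(x, y). dist x y < e})" by (fact uniformity_conj_space_def)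
  show "open U = (\<forall>x\<in>U. \<forall>\<^sub>F (x', y) in uniformity. x' = x \<longrightarrow> y \<in> U)" for U :: "'a conj_space set"
    by (fact open_conj_space_def)
  show "inner x y = inner y x" by (transfer, simp add: inner_commute)
  show "inner (x + y) z = inner x z + inner y z" "inner (r *\<^sub>R x) y = r * inner x y"
    by (transfer, simp add: inner_simps)+
  show "0 \<le> inner x x" "inner x x = 0 \<longleftrightarrow> x = 0" by (transfer, simp)+
  show "norm x = sqrt (inner x x)" by (transfer, simp add: norm_eq_sqrt_inner)
  show "cinner x y = cnj (cinner y x)" by (transfer, rule cinner_commute)
  show "cinner (x + y) z = cinner x z + cinner y z" by (transfer, simp add: cinner_add_right)
  show "cinner (c *\<^sub>C x) y = cnj c * cinner x y" by (transfer, simp add: cinner_scaleC_right)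
  show "Re (cinner x y) = inner x y" by (transfer, simp add: Re_cinner inner_commute)
qed

end

instance conj_space :: (chilbert_space) chilbert_space
proof
  fix X :: "nat \<Rightarrow> 'a conj_space" assume "Cauchy X"
  then have "Cauchy (\<lambda>n. from_conj (X n))"
    unfolding Cauchy_def by (simp add: dist_conj_space.rep_eq)
  then have "convergent (\<lambda>n. from_conj (X n))" by (rule Cauchy_convergent)
  then obtain l where "(\<lambda>n. from_conj (X n)) \<longlonglongrightarrow> l"
    unfolding convergent_def ..
  then have "X \<longlonglongrightarrow> to_conj l"
    unfolding tendsto_iff dist_conj_space.rep_eq by (simp add: to_conj_inverse)
  then show "convergent X" by (rule convergentI)
qed

lift_definition conj_op :: "('a::complex_inner \<Rightarrow>\<^sub>C\<^sub>L 'a) \<Rightarrow> 'a conj_space \<Rightarrow>\<^sub>C\<^sub>L 'a conj_space"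
  is "\<lambda>a x. to_conj (a (from_conj x))"
proof -
  fix a :: "'a \<Rightarrow> 'a" assume a: "bounded_clinear a"
  then interpret bounded_linear a by (simp add: bounded_clinear_def)
  obtain K where K: "\<And>x. norm (a x) \<le> norm x * K" using bounded by blast
  have scaleC: "a (c *\<^sub>C x) = c *\<^sub>C a x" for c x using a by (simp add: bounded_clinear_def)
  have "bounded_linear (\<lambda>x. to_conj (a (from_conj x)))"
  proof (rule bounded_linear_intro)
    fix x y r
    show "to_conj (a (from_conj (x + y))) = to_conj (a (from_conj x)) + to_conj (a (from_conj y))"
      by (simp only: plus_conj_space.rep_eq plus_conj_space.abs_eq add)
    show "to_conj (a (from_conj (r *\<^sub>R x))) = r *\<^sub>R to_conj (a (from_conj x))"
      by (simp only: scaleR_conj_space.rep_eq scaleR_conj_space.abs_eq scaleR)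
    show "norm (to_conj (a (from_conj x))) \<le> norm x * K"
      unfolding norm_conj_space.rep_eq to_conj_inverse[OF UNIV_I] by (rule K)
  qed
  moreover have "to_conj (a (from_conj (c *\<^sub>C x))) = c *\<^sub>C to_conj (a (from_conj x))" for c x
    by (simp only: scaleC_conj_space.rep_eq scaleC_conj_space.abs_eq scaleC)
  ultimately show "bounded_clinear (\<lambda>x. to_conj (a (from_conj x)))"
    by (simp add: bounded_clinear_def)
qed

section \<open>Hilbert tensor products\<close>

text \<open>The Hilbert tensor product is the completion of the algebraic tensor product for the inner
  product determined on elementary tensors, and is unique up to a unitary isomorphism.
  \<open>hilbert_tensor t\<close> says that the target type, with elementary tensors \<open>t x y\<close>, is such
  a completion.\<close>

definition hilbert_tensor :: "('a::chilbert_space \<Rightarrow> 'b::chilbert_space \<Rightarrow> 't::chilbert_space) \<Rightarrow> bool"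
  where "hilbert_tensor t \<longleftrightarrow>
    (\<forall>x x' y. t (x + x') y = t x y + t x' y) \<and> (\<forall>x y y'. t x (y + y') = t x y + t x y') \<and>
    (\<forall>c x y. t (c *\<^sub>C x) y = c *\<^sub>C t x y) \<and> (\<forall>c x y. t x (c *\<^sub>C y) = c *\<^sub>C t x y) \<and>
    (\<forall>x x' y y'. cinner (t x y) (t x' y') = cinner x x' * cinner y y') \<and>
    closure (cspan {t x y | x y. True}) = UNIV"

lemma hilbert_tensor_complex: "hilbert_tensor (\<lambda>(x::'a::chilbert_space) (c::complex). c *\<^sub>C x)"
proof -
  have "x \<in> {c *\<^sub>C x | x (c::complex). True}" for x :: 'a
    by (metis (mono_tags, lifting) mem_Collect_eq scaleC_one)
  then have "{c *\<^sub>C x | (x::'a) (c::complex). True} = UNIV" by blast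
  then show ?thesis
    by (simp add: hilbert_tensor_def scaleC_add_right scaleC_add_left scaleC_scaleC scaleC_complex_def
        cinner_complex_def cinner_scaleC_left cinner_scaleC_right mult_ac)
qed

text \<open>\<open>ampliation t a\<close> is the operator \<open>a \<otimes> 1\<close>; see \<open>ampliation_apply\<close> and
  \<open>ampliation_unique\<close> below.\<close>

definition ampliation ::
  "('a::chilbert_space \<Rightarrow> 'b::chilbert_space \<Rightarrow> 't::chilbert_space) \<Rightarrow> ('a \<Rightarrow>\<^sub>C\<^sub>L 'a) \<Rightarrow> 't \<Rightarrow>\<^sub>C\<^sub>L 't"
  where "ampliation t a = (THE s. \<forall>x y. s *\<^sub>V t x y = t (a *\<^sub>V x) y)"

lemma orthonormal_expansion:
  fixes F :: "'a::complex_inner set"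
  assumes "finite F"
  shows "\<exists>E. finite E \<and> (\<forall>e\<in>E. \<forall>e'\<in>E. cinner e e' = (if e = e' then 1 else 0)) \<and>
    (\<forall>y\<in>F. y = (\<Sum>e\<in>E. cinner e y *\<^sub>C e))"
  using assms
proof (induction F)
  case empty
  show ?case by (intro exI[of _ "{}"]) simp
next
  case (insert y F)
  then obtain E where E: "finite E" "\<forall>e\<in>E. \<forall>e'\<in>E. cinner e e' = (if e = e' then 1 else 0)"
    "\<forall>y\<in>F. y = (\<Sum>e\<in>E. cinner e y *\<^sub>C e)" by blast
  have sum_right: "cinner z (sum f E) = (\<Sum>e\<in>E. cinner z (f e))" for z :: 'a and f
    using \<open>finite E\<close> by (induction E) (simp_all add: cinner_add_right cinner_scaleC_right[of _ 0, simplified])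
  define r where "r = y - (\<Sum>e\<in>E. cinner e y *\<^sub>C e)"
  have y: "y = r + (\<Sum>e\<in>E. cinner e y *\<^sub>C e)" by (simp add: r_def)
  have ortho: "cinner e r = 0" if "e \<in> E" for e
  proof -
    have "cinner e (\<Sum>e'\<in>E. cinner e' y *\<^sub>C e') = (\<Sum>e'\<in>E. if e = e' then cinner e' y else 0)"
      unfolding sum_right using E(2) that by (intro sum.cong) (auto simp: cinner_scaleC_right)
    also have "\<dots> = cinner e y" using that \<open>finite E\<close> by simp
    finally have "cinner e y = cinner e r + cinner e y"
      by (metis cinner_add_right y)
    then show ?thesis by simp
  qed
  show ?case
  proof (cases "r = 0")
    case True
    then show ?thesis using E y by (intro exI[of _ E]) auto
  next
    case False
    define f where "f = complex_of_real (inverse (norm r)) *\<^sub>C r"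
    have r: "r = complex_of_real (norm r) *\<^sub>C f"
      using False by (simp add: f_def scaleC_scaleC scaleC_one flip: of_real_mult)
    have "norm f = 1" using False by (simp add: f_def norm_scaleC norm_inverse)
    then have ff: "cinner f f = 1" by (simp add: cinner_self)
    have ef: "cinner e f = 0" "cinner f e = 0" if "e \<in> E" for e
      using ortho[OF that] cinner_commute[of f e] by (simp_all add: f_def cinner_scaleC_right)
    have "f \<notin> E" using ef ff by force
    have "cinner f y = cinner f r"
      by (subst y) (simp add: cinner_add_right sum_right cinner_scaleC_right ef)
    also have "\<dots> = cinner f (complex_of_real (norm r) *\<^sub>C f)" using r by simp
    also have "\<dots> = complex_of_real (norm r)" by (simp add: cinner_scaleC_right ff)
    finally have fy: "cinner f y *\<^sub>C f = r" using r by simp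
    have "cinner f z = 0" if "z \<in> F" for z
      by (subst E(3)[rule_format, OF that]) (simp add: sum_right cinner_scaleC_right ef)
    then have "\<forall>z\<in>insert y F. z = (\<Sum>e\<in>insert f E. cinner e z *\<^sub>C e)"
      using E(1,3) \<open>f \<notin> E\<close> fy y by simp
    moreover have "\<forall>e\<in>insert f E. \<forall>e'\<in>insert f E. cinner e e' = (if e = e' then 1 else 0)"
      using E(2) ef ff \<open>f \<notin> E\<close> by auto
    ultimately show ?thesis using E(1) by (intro exI[of _ "insert f E"]) blast
  qed
qed

lemma hilbert_tensor_sum_bound:
  fixes t :: "'a::chilbert_space \<Rightarrow> 'b::chilbert_space \<Rightarrow> 't::chilbert_space"
  assumes t: "hilbert_tensor t"
  shows "norm (\<Sum>(x, y)\<leftarrow>ps. t (a *\<^sub>V x) y) \<le> norm a * norm (\<Sum>(x, y)\<leftarrow>ps. t x y)"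
proof -
  interpret a: bounded_linear "cblinfun_apply a" by (rule bounded_linear_cblinfun_apply)
  have t_add: "t (x + x') y = t x y + t x' y" "t x (y + y') = t x y + t x y'"
    and t_scale: "t (c *\<^sub>C x) y = c *\<^sub>C t x y" "t x (c *\<^sub>C y) = c *\<^sub>C t x y"
    and t_cinner: "cinner (t x y) (t x' y') = cinner x x' * cinner y y'" for x x' y y' c
    using t by (auto simp: hilbert_tensor_def)
  have t_zero: "t 0 y = 0" "t x 0 = 0" for x y
    using t_scale(1)[of 0 x y] t_scale(2)[of x 0 y] by simp_all
  obtain E where E: "finite E" "\<forall>e\<in>E. \<forall>e'\<in>E. cinner e e' = (if e = e' then 1 else 0)"
    "\<forall>y\<in>snd ` set ps. y = (\<Sum>e\<in>E. cinner e y *\<^sub>C e)"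
    using orthonormal_expansion[of "snd ` set ps"] by auto
  define z where "z e = (\<Sum>(x, y)\<leftarrow>ps. cinner e y *\<^sub>C x)" for e
  have t_sum: "t x (sum f E) = (\<Sum>e\<in>E. t x (f e))" for x f
    using \<open>finite E\<close> by (induction E) (simp_all add: t_add t_zero)
  have expand: "(\<Sum>(x, y)\<leftarrow>qs. t (g x) y) = (\<Sum>e\<in>E. t (g (\<Sum>(x, y)\<leftarrow>qs. cinner e y *\<^sub>C x)) e)"
    if "set qs \<subseteq> set ps" and g: "\<And>x y. g (x + y) = g x + g y" "\<And>c x. g (c *\<^sub>C x) = c *\<^sub>C g x"
    for g qs
    using that(1)
  proof (induction qs)
    case Nil
    have "g 0 = 0" using g(2)[of 0 0] by simp
    then show ?case by (simp add: t_zero)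
  next
    case (Cons p qs)
    obtain x y where p: "p = (x, y)" by (cases p)
    have "y = (\<Sum>e\<in>E. cinner e y *\<^sub>C e)" using Cons.prems E(3) p by force
    then have "t (g x) y = t (g x) (\<Sum>e\<in>E. cinner e y *\<^sub>C e)" by simp
    also have "\<dots> = (\<Sum>e\<in>E. t (g (cinner e y *\<^sub>C x)) e)"
      by (simp add: t_sum g t_scale)
    finally show ?case using Cons by (simp add: p g t_add sum.distrib)
  qed
  have norm_sum: "(norm (\<Sum>e\<in>E. t (w e) e))\<^sup>2 = (\<Sum>e\<in>E. (norm (w e))\<^sup>2)" for w
  proof -
    have "inner (t (w e) e) (t (w e') e') = (if e = e' then (norm (w e))\<^sup>2 else 0)"
      if "e \<in> E" "e' \<in> E" for e e'
      using that E(2) by (auto simp: t_cinner cinner_self simp flip: Re_cinner)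
    then show ?thesis
      using E(1) by (simp add: power2_norm_eq_inner[of "sum _ _"] inner_sum_left inner_sum_right)
  qed
  have lhs: "(\<Sum>(x, y)\<leftarrow>ps. t (a *\<^sub>V x) y) = (\<Sum>e\<in>E. t (a *\<^sub>V z e) e)"
    unfolding z_def by (rule expand) (simp_all add: a.add cblinfun_scaleC_right)
  have rhs: "(\<Sum>(x, y)\<leftarrow>ps. t x y) = (\<Sum>e\<in>E. t (z e) e)"
    unfolding z_def by (rule expand[where g = "\<lambda>x. x"]) simp_all
  have "(norm (\<Sum>(x, y)\<leftarrow>ps. t (a *\<^sub>V x) y))\<^sup>2 = (\<Sum>e\<in>E. (norm (a *\<^sub>V z e))\<^sup>2)"
    unfolding lhs norm_sum ..
  also have "\<dots> \<le> (\<Sum>e\<in>E. (norm a * norm (z e))\<^sup>2)"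
    by (intro sum_mono power_mono norm_cblinfun_apply_le) simp
  also have "\<dots> = (norm a * norm (\<Sum>(x, y)\<leftarrow>ps. t x y))\<^sup>2"
    unfolding rhs power_mult_distrib norm_sum sum_distrib_left ..
  finally show ?thesis by (rule power2_le_imp_le) simp
qed

lemma ampliation_exists:
  fixes t :: "'a::chilbert_space \<Rightarrow> 'b::chilbert_space \<Rightarrow> 't::chilbert_space"
  assumes t: "hilbert_tensor t"
  shows "\<exists>s. \<forall>x y. s *\<^sub>V t x y = t (a *\<^sub>V x) y"
proof -
  interpret a: bounded_linear "cblinfun_apply a" by (rule bounded_linear_cblinfun_apply)
  define f where "f ps = (\<Sum>(x, y)\<leftarrow>ps. t x y)" for ps
  define g where "g ps = (\<Sum>(x, y)\<leftarrow>ps. t (a *\<^sub>V x) y)" for ps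
  have t_scale: "t (c *\<^sub>C x) y = c *\<^sub>C t x y" for c x y
    using t by (auto simp: hilbert_tensor_def)
  have append: "f (ps @ qs) = f ps + f qs" "g (ps @ qs) = g ps + g qs" for ps qs
    by (simp_all add: f_def g_def)
  have scale: "f (map (apfst (scaleC c)) ps) = c *\<^sub>C f ps" "g (map (apfst (scaleC c)) ps) = c *\<^sub>C g ps"
    for c ps
    by (induction ps) (auto simp: f_def g_def t_scale scaleC_add_right cblinfun_scaleC_right)
  have bound: "norm (g ps) \<le> norm a * norm (f ps)" for ps
    unfolding f_def g_def by (rule hilbert_tensor_sum_bound[OF t])
  have diff: "norm (g ps - g qs) \<le> norm a * norm (f ps - f qs)" for ps qs
    using bound[of "ps @ map (apfst (scaleC (- 1))) qs"]
    by (simp add: append scale complex_vector.scale_minus_left scaleC_one)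
  have "cspan {t x y | x y. True} \<subseteq> range f"
  proof (rule complex_vector.span_minimal)
    have "t x y = f [(x, y)]" for x y by (simp add: f_def)
    then show "{t x y | x y. True} \<subseteq> range f" by blast
    have "0 \<in> range f" by (rule range_eqI[of _ _ "[]"]) (simp add: f_def)
    moreover have "u + v \<in> range f" if "u \<in> range f" "v \<in> range f" for u v
      using that by (auto simp flip: append(1))
    moreover have "c *\<^sub>C u \<in> range f" if "u \<in> range f" for c u
      using that by (auto simp flip: scale(1))
    ultimately show "complex_vector.subspace (range f)"
      by (rule complex_vector.subspaceI)
  qed
  then have "closure (cspan {t x y | x y. True}) \<subseteq> closure (range f)" by (rule closure_mono)
  then have dense: "u \<in> closure (range f)" for u
    using t by (auto simp: hilbert_tensor_def)
  have "\<exists>v. \<exists>P. (\<lambda>n. f (P n)) \<longlonglongrightarrow> u \<and> (\<lambda>n. g (P n)) \<longlonglongrightarrow> v" for u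
  proof -
    obtain X where X: "\<And>n. X n \<in> range f" "X \<longlonglongrightarrow> u"
      using dense[of u] unfolding closure_sequential by blast
    have "\<forall>n. \<exists>p. X n = f p" using X(1) by blast
    then obtain P where "\<forall>n. X n = f (P n)" by (rule choice[THEN exE])
    then have P: "X = (\<lambda>n. f (P n))" by blast
    have "Cauchy (\<lambda>n. g (P n))"
    proof (rule metric_CauchyI)
      fix e :: real assume "e > 0"
      have "Cauchy X" using X(2) LIMSEQ_imp_Cauchy by blast
      moreover have "e / (norm a + 1) > 0" using \<open>e > 0\<close> by (simp add: add_nonneg_pos)
      ultimately obtain M where M: "\<And>m n. m \<ge> M \<Longrightarrow> n \<ge> M \<Longrightarrow> dist (X m) (X n) < e / (norm a + 1)"
        using metric_CauchyD by blast
      show "\<exists>M. \<forall>m\<ge>M. \<forall>n\<ge>M. dist (g (P m)) (g (P n)) < e"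
      proof (intro exI allI impI)
        fix m n assume "M \<le> m" "M \<le> n"
        have "dist (g (P m)) (g (P n)) \<le> norm a * dist (X m) (X n)"
          unfolding dist_norm P by (rule diff)
        also have "\<dots> \<le> (norm a + 1) * dist (X m) (X n)" by (intro mult_right_mono) auto
        also have "\<dots> < e"
          using M[OF \<open>M \<le> m\<close> \<open>M \<le> n\<close>] by (simp add: pos_less_divide_eq add_nonneg_pos mult.commute)
        finally show "dist (g (P m)) (g (P n)) < e" .
      qed
    qed
    then obtain v where "(\<lambda>n. g (P n)) \<longlonglongrightarrow> v"
      using Cauchy_convergent unfolding convergent_def by blast
    then show ?thesis using X(2) unfolding P by blast
  qed
  then obtain s P where s: "\<And>u. (\<lambda>n. f (P u n)) \<longlonglongrightarrow> u" "\<And>u. (\<lambda>n. g (P u n)) \<longlonglongrightarrow> s u"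
    by metis
  have unique: "s u = v" if "(\<lambda>n. f (Q n)) \<longlonglongrightarrow> u" "(\<lambda>n. g (Q n)) \<longlonglongrightarrow> v" for u v Q
  proof -
    have "(\<lambda>n. norm (g (P u n) - g (Q n))) \<longlonglongrightarrow> norm (s u - v)"
      by (intro tendsto_intros s that)
    moreover have "(\<lambda>n. norm a * norm (f (P u n) - f (Q n))) \<longlonglongrightarrow> norm a * norm (u - u)"
      by (intro tendsto_intros s that)
    ultimately have "norm (s u - v) \<le> norm a * norm (u - u)"
      by (rule LIMSEQ_le) (use diff in blast)
    then show ?thesis by simp
  qed
  have s_t: "s (t x y) = t (a *\<^sub>V x) y" for x y
    by (rule unique[of "\<lambda>_. [(x, y)]"]) (simp_all add: f_def g_def)
  have s_add: "s (u + v) = s u + s v" for u v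
    by (rule unique[of "\<lambda>n. P u n @ P v n"]) (simp_all add: append tendsto_add s)
  have lim_scale: "(\<lambda>n. c *\<^sub>C X n) \<longlonglongrightarrow> c *\<^sub>C l" if "X \<longlonglongrightarrow> l" for c and X :: "nat \<Rightarrow> 't" and l
  proof -
    have "bounded_linear (\<lambda>x :: 't. c *\<^sub>C x)"
      by (rule bounded_linear_intro[of _ "cmod c"])
        (simp_all add: scaleC_add_right scaleR_scaleC scaleC_scaleC norm_scaleC mult.commute)
    then show ?thesis using that by (rule bounded_linear.tendsto)
  qed
  have s_scale: "s (c *\<^sub>C u) = c *\<^sub>C s u" for c u
    by (rule unique[of "\<lambda>n. map (apfst (scaleC c)) (P u n)"]) (simp_all add: scale lim_scale s)
  have s_bound: "norm (s u) \<le> norm u * norm a" for u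
  proof -
    have "(\<lambda>n. norm (g (P u n))) \<longlonglongrightarrow> norm (s u)"
      "(\<lambda>n. norm a * norm (f (P u n))) \<longlonglongrightarrow> norm a * norm u"
      by (intro tendsto_intros s)+
    then have "norm (s u) \<le> norm a * norm u"
      by (rule LIMSEQ_le) (use bound in blast)
    then show ?thesis by (simp add: mult.commute)
  qed
  have "bounded_clinear s"
    unfolding bounded_clinear_def
    by (auto intro!: bounded_linear_intro[of _ "norm a"] simp: s_add s_scale scaleR_scaleC s_bound)
  then show ?thesis by (intro exI[of _ "cBlinfun s"]) (simp add: cBlinfun_inverse s_t)
qed

lemma ampliation_unique:
  fixes t :: "'a::chilbert_space \<Rightarrow> 'b::chilbert_space \<Rightarrow> 't::chilbert_space"
  assumes t: "hilbert_tensor t" and s: "\<And>x y. s *\<^sub>V t x y = t (a *\<^sub>V x) y"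
  shows "ampliation t a = s"
  unfolding ampliation_def
proof (rule the_equality)
  fix s' assume s': "\<forall>x y. s' *\<^sub>V t x y = t (a *\<^sub>V x) y"
  interpret d: bounded_linear "cblinfun_apply (s' - s)" by (rule bounded_linear_cblinfun_apply)
  have "cspan {t x y | x y. True} \<subseteq> {u. (s' - s) *\<^sub>V u = 0}"
    using s s'
    by (intro complex_vector.span_minimal)
      (auto simp: minus_cblinfun.rep_eq complex_vector.subspace_def d.zero d.add cblinfun_scaleC_right
        linear_simps[OF bounded_linear_cblinfun_apply])
  moreover have "closed {u. (s' - s) *\<^sub>V u = 0}"
    by (intro closed_Collect_eq continuous_intros linear_continuous_on d.bounded_linear_axioms)
  ultimately have "closure (cspan {t x y | x y. True}) \<subseteq> {u. (s' - s) *\<^sub>V u = 0}"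
    by (rule closure_minimal)
  then have "(s' - s) *\<^sub>V u = 0" for u using t unfolding hilbert_tensor_def by blast
  then show "s' = s" by (intro cblinfun_eqI) (simp add: minus_cblinfun.rep_eq)
qed (use s in blast)

lemma ampliation_apply:
  assumes "hilbert_tensor t"
  shows "ampliation t a *\<^sub>V t x y = t (a *\<^sub>V x) y"
proof -
  obtain s where s: "\<And>x y. s *\<^sub>V t x y = t (a *\<^sub>V x) y"
    using ampliation_exists[OF assms, of a] by blast
  then show ?thesis using ampliation_unique[OF assms, of s a] by simp
qed

section \<open>Modules over the algebra of bounded operators\<close>

text \<open>A left (right) module is given by its action on a complex vector space.\<close>

definition left_module :: "(('l::chilbert_space \<Rightarrow>\<^sub>C\<^sub>L 'l) \<Rightarrow> 'x::complex_vector \<Rightarrow> 'x) \<Rightarrow> bool"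
  where "left_module m \<longleftrightarrow>
    (\<forall>a b u. m (a + b) u = m a u + m b u) \<and> (\<forall>a u v. m a (u + v) = m a u + m a v) \<and>
    (\<forall>c a u. m (c *\<^sub>C a) u = c *\<^sub>C m a u) \<and> (\<forall>c a u. m a (c *\<^sub>C u) = c *\<^sub>C m a u) \<and>
    (\<forall>a b u. m (a o\<^sub>C\<^sub>L b) u = m a (m b u)) \<and> (\<forall>u. m cblinfun_id u = u)"

definition right_module :: "('x::complex_vector \<Rightarrow> ('l::chilbert_space \<Rightarrow>\<^sub>C\<^sub>L 'l) \<Rightarrow> 'x) \<Rightarrow> bool"
  where "right_module m \<longleftrightarrow>
    (\<forall>u a b. m u (a + b) = m u a + m u b) \<and> (\<forall>u v a. m (u + v) a = m u a + m v a) \<and>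
    (\<forall>c u a. m u (c *\<^sub>C a) = c *\<^sub>C m u a) \<and> (\<forall>c u a. m (c *\<^sub>C u) a = c *\<^sub>C m u a) \<and>
    (\<forall>u a b. m u (a o\<^sub>C\<^sub>L b) = m (m u a) b) \<and> (\<forall>u. m u cblinfun_id = u)"

definition contractive_left_module ::
  "(('l::chilbert_space \<Rightarrow>\<^sub>C\<^sub>L 'l) \<Rightarrow> 'x::complex_normed_vector \<Rightarrow> 'x) \<Rightarrow> bool"
  where "contractive_left_module m \<longleftrightarrow>
    left_module m \<and> (\<forall>a u. norm (m a u) \<le> norm a * norm u)"

definition contractive_right_module ::
  "('x::complex_normed_vector \<Rightarrow> ('l::chilbert_space \<Rightarrow>\<^sub>C\<^sub>L 'l) \<Rightarrow> 'x) \<Rightarrow> bool"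
  where "contractive_right_module m \<longleftrightarrow>
    right_module m \<and> (\<forall>u a. norm (m u a) \<le> norm u * norm a)"

definition contractive_bimodule ::
  "(('l::chilbert_space \<Rightarrow>\<^sub>C\<^sub>L 'l) \<Rightarrow> 'x::complex_normed_vector \<Rightarrow> 'x) \<Rightarrow>
    ('x \<Rightarrow> ('l \<Rightarrow>\<^sub>C\<^sub>L 'l) \<Rightarrow> 'x) \<Rightarrow> bool"
  where "contractive_bimodule ml mr \<longleftrightarrow>
    contractive_left_module ml \<and> contractive_right_module mr \<and>
    (\<forall>a u b. mr (ml a u) b = ml a (mr u b))"

definition left_support ::
  "(('l::chilbert_space \<Rightarrow>\<^sub>C\<^sub>L 'l) \<Rightarrow> 'x \<Rightarrow> 'x) \<Rightarrow> ('l \<Rightarrow>\<^sub>C\<^sub>L 'l) \<Rightarrow> 'x \<Rightarrow> bool"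
  where "left_support m P u \<longleftrightarrow> projection P \<and> m P u = u"

definition right_support ::
  "('x \<Rightarrow> ('l::chilbert_space \<Rightarrow>\<^sub>C\<^sub>L 'l) \<Rightarrow> 'x) \<Rightarrow> ('l \<Rightarrow>\<^sub>C\<^sub>L 'l) \<Rightarrow> 'x \<Rightarrow> bool"
  where "right_support m P u \<longleftrightarrow> projection P \<and> m u P = u"

definition left_semi_ruan ::
  "(('l::chilbert_space \<Rightarrow>\<^sub>C\<^sub>L 'l) \<Rightarrow> 'x::complex_normed_vector \<Rightarrow> 'x) \<Rightarrow> bool"
  where "left_semi_ruan m \<longleftrightarrow> contractive_left_module m \<and>
    (\<forall>u v P Q. left_support m P u \<and> left_support m Q v \<and> P o\<^sub>C\<^sub>L Q = 0 \<longrightarrow>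
      norm (u + v) \<le> sqrt ((norm u)\<^sup>2 + (norm v)\<^sup>2))"

definition right_semi_ruan ::
  "('x::complex_normed_vector \<Rightarrow> ('l::chilbert_space \<Rightarrow>\<^sub>C\<^sub>L 'l) \<Rightarrow> 'x) \<Rightarrow> bool"
  where "right_semi_ruan m \<longleftrightarrow> contractive_right_module m \<and>
    (\<forall>u v P Q. right_support m P u \<and> right_support m Q v \<and> P o\<^sub>C\<^sub>L Q = 0 \<longrightarrow>
      norm (u + v) \<le> sqrt ((norm u)\<^sup>2 + (norm v)\<^sup>2))"

definition ruan_bimodule ::
  "(('l::chilbert_space \<Rightarrow>\<^sub>C\<^sub>L 'l) \<Rightarrow> 'x::complex_normed_vector \<Rightarrow> 'x) \<Rightarrow>
    ('x \<Rightarrow> ('l \<Rightarrow>\<^sub>C\<^sub>L 'l) \<Rightarrow> 'x) \<Rightarrow> bool"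
  where "ruan_bimodule ml mr \<longleftrightarrow> contractive_bimodule ml mr \<and>
    (\<forall>u v P Q. left_support ml P u \<and> right_support mr P u \<and>
      left_support ml Q v \<and> right_support mr Q v \<and> P o\<^sub>C\<^sub>L Q = 0 \<longrightarrow>
      norm (u + v) = max (norm u) (norm v))"

definition left_morphism ::
  "(('l::chilbert_space \<Rightarrow>\<^sub>C\<^sub>L 'l) \<Rightarrow> 'x::complex_normed_vector \<Rightarrow> 'x) \<Rightarrow>
    (('l \<Rightarrow>\<^sub>C\<^sub>L 'l) \<Rightarrow> 'y::complex_normed_vector \<Rightarrow> 'y) \<Rightarrow> ('x \<Rightarrow>\<^sub>C\<^sub>L 'y) \<Rightarrow> bool"
  where "left_morphism m n f \<longleftrightarrow> (\<forall>a u. f *\<^sub>V m a u = n a (f *\<^sub>V u))"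

definition right_morphism ::
  "('x::complex_normed_vector \<Rightarrow> ('l::chilbert_space \<Rightarrow>\<^sub>C\<^sub>L 'l) \<Rightarrow> 'x) \<Rightarrow>
    ('y::complex_normed_vector \<Rightarrow> ('l \<Rightarrow>\<^sub>C\<^sub>L 'l) \<Rightarrow> 'y) \<Rightarrow> ('x \<Rightarrow>\<^sub>C\<^sub>L 'y) \<Rightarrow> bool"
  where "right_morphism m n f \<longleftrightarrow> (\<forall>u a. f *\<^sub>V m u a = n (f *\<^sub>V u) a)"

definition isometric :: "('x::complex_normed_vector \<Rightarrow>\<^sub>C\<^sub>L 'y::complex_normed_vector) \<Rightarrow> bool"
  where "isometric f \<longleftrightarrow> (\<forall>u. norm (f *\<^sub>V u) = norm u)"

section \<open>Injectivity\<close>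

text \<open>The test modules live on the types given by the two type arguments; injectivity against
  test modules of arbitrary size is the statement for arbitrary (free) types there.\<close>

definition esr_injective_left :: "'y::complex_normed_vector itself \<Rightarrow> 'z::complex_normed_vector itself \<Rightarrow>
    (('l::chilbert_space \<Rightarrow>\<^sub>C\<^sub>L 'l) \<Rightarrow> 'x::complex_normed_vector \<Rightarrow> 'x) \<Rightarrow> bool"
  where "esr_injective_left _ _ mX \<longleftrightarrow> contractive_left_module mX \<and>
    (\<forall>mY mZ (\<alpha> :: 'y \<Rightarrow>\<^sub>C\<^sub>L 'z) (\<Phi> :: 'y \<Rightarrow>\<^sub>C\<^sub>L 'x).
      left_semi_ruan mY \<and> left_semi_ruan mZ \<and>
      left_morphism mY mZ \<alpha> \<and> isometric \<alpha> \<and> left_morphism mY mX \<Phi> \<longrightarrow>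
      (\<exists>\<Psi> :: 'z \<Rightarrow>\<^sub>C\<^sub>L 'x. left_morphism mZ mX \<Psi> \<and> \<Psi> o\<^sub>C\<^sub>L \<alpha> = \<Phi> \<and> norm \<Psi> = norm \<Phi>))"

definition esr_injective_right :: "'y::complex_normed_vector itself \<Rightarrow> 'z::complex_normed_vector itself \<Rightarrow>
    ('x::complex_normed_vector \<Rightarrow> ('l::chilbert_space \<Rightarrow>\<^sub>C\<^sub>L 'l) \<Rightarrow> 'x) \<Rightarrow> bool"
  where "esr_injective_right _ _ mX \<longleftrightarrow> contractive_right_module mX \<and>
    (\<forall>mY mZ (\<alpha> :: 'y \<Rightarrow>\<^sub>C\<^sub>L 'z) (\<Phi> :: 'y \<Rightarrow>\<^sub>C\<^sub>L 'x).
      right_semi_ruan mY \<and> right_semi_ruan mZ \<and>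
      right_morphism mY mZ \<alpha> \<and> isometric \<alpha> \<and> right_morphism mY mX \<Phi> \<longrightarrow>
      (\<exists>\<Psi> :: 'z \<Rightarrow>\<^sub>C\<^sub>L 'x. right_morphism mZ mX \<Psi> \<and> \<Psi> o\<^sub>C\<^sub>L \<alpha> = \<Phi> \<and> norm \<Psi> = norm \<Phi>))"

definition er_injective :: "'y::complex_normed_vector itself \<Rightarrow> 'z::complex_normed_vector itself \<Rightarrow>
    (('l::chilbert_space \<Rightarrow>\<^sub>C\<^sub>L 'l) \<Rightarrow> 'x::complex_normed_vector \<Rightarrow> 'x) \<Rightarrow>
    ('x \<Rightarrow> ('l \<Rightarrow>\<^sub>C\<^sub>L 'l) \<Rightarrow> 'x) \<Rightarrow> bool"
  where "er_injective _ _ lX rX \<longleftrightarrow> contractive_bimodule lX rX \<and>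
    (\<forall>lY rY lZ rZ (\<alpha> :: 'y \<Rightarrow>\<^sub>C\<^sub>L 'z) (\<Phi> :: 'y \<Rightarrow>\<^sub>C\<^sub>L 'x).
      ruan_bimodule lY rY \<and> ruan_bimodule lZ rZ \<and>
      left_morphism lY lZ \<alpha> \<and> right_morphism rY rZ \<alpha> \<and> isometric \<alpha> \<and>
      left_morphism lY lX \<Phi> \<and> right_morphism rY rX \<Phi> \<longrightarrow>
      (\<exists>\<Psi> :: 'z \<Rightarrow>\<^sub>C\<^sub>L 'x. left_morphism lZ lX \<Psi> \<and> right_morphism rZ rX \<Psi> \<and>
        \<Psi> o\<^sub>C\<^sub>L \<alpha> = \<Phi> \<and> norm \<Psi> = norm \<Phi>))"

section \<open>The concrete modules\<close>

definition tensor_left_action ::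
  "('l::chilbert_space \<Rightarrow> 'h::chilbert_space \<Rightarrow> 't::chilbert_space) \<Rightarrow> ('l \<Rightarrow>\<^sub>C\<^sub>L 'l) \<Rightarrow> 't \<Rightarrow> 't"
  where "tensor_left_action t a \<zeta> = ampliation t a *\<^sub>V \<zeta>"

definition tensor_right_action ::
  "('l::chilbert_space conj_space \<Rightarrow> 'h::chilbert_space \<Rightarrow> 't::chilbert_space) \<Rightarrow>
    't \<Rightarrow> ('l \<Rightarrow>\<^sub>C\<^sub>L 'l) \<Rightarrow> 't"
  where "tensor_right_action t \<zeta> a = ampliation t (conj_op (cadjoint a)) *\<^sub>V \<zeta>"

definition operator_left_action ::
  "('l::chilbert_space \<Rightarrow> 'k::chilbert_space \<Rightarrow> 'u::chilbert_space) \<Rightarrow> ('l \<Rightarrow>\<^sub>C\<^sub>L 'l) \<Rightarrow>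
    ('t::chilbert_space \<Rightarrow>\<^sub>C\<^sub>L 'u) \<Rightarrow> 't \<Rightarrow>\<^sub>C\<^sub>L 'u"
  where "operator_left_action tK a b = ampliation tK a o\<^sub>C\<^sub>L b"

definition operator_right_action ::
  "('l::chilbert_space \<Rightarrow> 'h::chilbert_space \<Rightarrow> 't::chilbert_space) \<Rightarrow>
    ('t \<Rightarrow>\<^sub>C\<^sub>L 'u::chilbert_space) \<Rightarrow> ('l \<Rightarrow>\<^sub>C\<^sub>L 'l) \<Rightarrow> 't \<Rightarrow>\<^sub>C\<^sub>L 'u"
  where "operator_right_action tH b a = b o\<^sub>C\<^sub>L ampliation tH a"

end

(* A morphism \<Psi> from a bimodule Z to B(L \<otimes> H, L \<otimes> K) is the same as a functional on the balanced
   tensors \<eta>^* \<otimes> z \<otimes> \<xi>, namely <\<eta>, \<Psi>(z) \<xi>>. Because L is infinite-dimensional, two such tensors can be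
   moved to orthogonal supports by partial isometries S and T, and the Ruan axiom then makes
   (|\<eta>|^2 + |\<xi>|^2)/2 with |z| \<le> 1 subadditive. So extending a morphism from a submodule Y is a
   Hahn--Banach problem, and it is solvable provided that the tensors over Y carry the norm induced from Z.
   This holds because a tensor \<eta>^* \<otimes> z \<otimes> \<xi> with \<eta>, \<xi> of finite rank only depends on the compression
   P z Q of z to the L-supports of \<eta> and \<xi>, and P z Q lies in Y as soon as the tensor does. One-sided
   modules are treated in the same way with the cost (|\<eta>|^2 + |z|^2)/2; right modules over B(L) are left
   modules over B(L^c). *)
theory Submission
  imports Defs "HOL-Library.Function_Algebras"
begin

section \<open>A Hahn--Banach theorem for cones\<close>

text \<open>The tensor product over B(L) is never formed. A tensor is replaced by its matrix of
  coefficients, a function with values in the module, and \<open>left_balanced_zero\<close> and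
  \<open>balanced_zero\<close> show that no balanced map sees more than this matrix. The
  Hahn--Banach problem is posed for pairs (tensor, upper bound) instead of a sublinear functional:
  the infimum of the cost over all representations need not be computed, and solvability is the
  single condition that no negative bound is attached to 0. Since S and T put two summands side by
  side, a sum of elementary tensors is again elementary, and one tensor over Z together with one
  over Y is all that a pair has to record. Finite support leaves room in L for S and T and makes
  compressions finite sums; Riesz representation and density then recover the morphism, using
  completeness of the Hilbert spaces only, so that the test modules may be incomplete. The cost is
  half a sum of squares because squares add up under orthogonal sums; rescaling the two factors
  inversely turns it into the product of the norms.\<close>

instantiation "fun" :: (type, real_vector) real_vector
begin

text \<open>Coefficient matrices are functions with values in a module, so the cone theorem has to
  apply to function spaces, also iterated ones.\<close>

definition scaleR_fun :: "real \<Rightarrow> ('a \<Rightarrow> 'b) \<Rightarrow> 'a \<Rightarrow> 'b"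
  where "scaleR_fun r f = (\<lambda>x. r *\<^sub>R f x)"

instance
  by standard (simp_all add: scaleR_fun_def fun_eq_iff algebra_simps)

end

lemma scaleR_fun_apply [simp]: "(r *\<^sub>R f) x = r *\<^sub>R f x"
  by (simp add: scaleR_fun_def)

text \<open>A member \<open>(u, r)\<close> stands for the demand that a linear functional be at most
  \<open>r\<close> at \<open>u\<close>. The last condition says that the demands do not contradict
  each other at 0. Such a cone takes the place of a sublinear functional.\<close>

definition nonneg_cone :: "('a::real_vector \<times> real) set \<Rightarrow> bool"
  where "nonneg_cone C \<longleftrightarrow> 0 \<in> C \<and> (\<forall>p\<in>C. \<forall>q\<in>C. p + q \<in> C) \<and> (\<forall>p\<in>C. \<forall>r>0. r *\<^sub>R p \<in> C) \<and>
    (\<forall>r. (0, r) \<in> C \<longrightarrow> 0 \<le> r)"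

lemma nonneg_coneD:
  assumes "nonneg_cone C"
  shows "(u, r) \<in> C \<Longrightarrow> (v, s) \<in> C \<Longrightarrow> (u + v, r + s) \<in> C"
    and "(u, r) \<in> C \<Longrightarrow> 0 < t \<Longrightarrow> (t *\<^sub>R u, t * r) \<in> C"
    and "(0, r) \<in> C \<Longrightarrow> 0 \<le> r"
  using assms unfolding nonneg_cone_def by (metis add_Pair, metis scaleR_Pair real_scaleR_def, blast)

text \<open>Each defining condition involves at most two members, so unions of chains inherit it and
  Zorn's lemma applies.\<close>

lemma maximal_nonneg_cone:
  assumes "nonneg_cone C"
  obtains M where "nonneg_cone M" "C \<subseteq> M" "\<And>C'. nonneg_cone C' \<Longrightarrow> M \<subseteq> C' \<Longrightarrow> C' = M"
proof -
  let ?A = "{D. nonneg_cone D \<and> C \<subseteq> D}"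
  have "\<Union>\<C> \<in> ?A" if "\<C> \<noteq> {}" and ch: "subset.chain ?A \<C>" for \<C>
  proof -
    have \<C>: "\<And>D. D \<in> \<C> \<Longrightarrow> nonneg_cone D \<and> C \<subseteq> D"
      and cmp: "\<And>D E. D \<in> \<C> \<Longrightarrow> E \<in> \<C> \<Longrightarrow> D \<subseteq> E \<or> E \<subseteq> D"
      using ch unfolding subset_chain_def by blast+
    have add: "p + q \<in> \<Union>\<C>" if "p \<in> \<Union>\<C>" "q \<in> \<Union>\<C>" for p q
    proof -
      from that obtain D E where "p \<in> D" "D \<in> \<C>" "q \<in> E" "E \<in> \<C>" by blast
      with cmp obtain F where "p \<in> F" "q \<in> F" "F \<in> \<C>" by blast
      then show ?thesis using \<C>[of F] unfolding nonneg_cone_def by blast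
    qed
    have scale: "r *\<^sub>R p \<in> \<Union>\<C>" if "p \<in> \<Union>\<C>" "0 < r" for p r
    proof -
      from that(1) obtain D where "p \<in> D" "D \<in> \<C>" by blast
      with \<C>[of D] that(2) show ?thesis unfolding nonneg_cone_def by blast
    qed
    have nonneg: "0 \<le> r" if "(0, r) \<in> \<Union>\<C>" for r
    proof -
      from that obtain D where "(0, r) \<in> D" "D \<in> \<C>" by blast
      with \<C>[of D] show ?thesis unfolding nonneg_cone_def by blast
    qed
    obtain D where "D \<in> \<C>" using \<open>\<C> \<noteq> {}\<close> by blast
    then have "0 \<in> \<Union>\<C>" using \<C>[of D] unfolding nonneg_cone_def by blast
    then have "nonneg_cone (\<Union>\<C>)"
      unfolding nonneg_cone_def using add scale nonneg by simp
    then show ?thesis using that(1) \<C> by blast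
  qed
  then obtain M where "M \<in> ?A" "\<forall>X\<in>?A. M \<subseteq> X \<longrightarrow> X = M"
    using subset_Zorn_nonempty[of ?A] assms by blast
  then show ?thesis using that[of M] by blast
qed

text \<open>In a maximal cone the infimum of the bounds at \<open>u\<close> is the value of the
  functional: the demand that its value at \<open>-u\<close> be at most minus this infimum can be
  adjoined without contradiction, hence is already a member. Symmetry of the domain provides bounds
  at \<open>-u\<close>, which keep the infimum finite. Linearity is claimed on the domain of
  \<open>C\<close> only.\<close>

theorem nonneg_cone_support:
  fixes C :: "('a::real_vector \<times> real) set"
  assumes C: "nonneg_cone C" and sym: "\<And>u. u \<in> fst ` C \<Longrightarrow> - u \<in> fst ` C"
  obtains g where "\<And>u r. (u, r) \<in> C \<Longrightarrow> g u \<le> r"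
    "\<And>u v. u \<in> fst ` C \<Longrightarrow> v \<in> fst ` C \<Longrightarrow> g (u + v) = g u + g v"
    "\<And>t u. u \<in> fst ` C \<Longrightarrow> g (t *\<^sub>R u) = t * g u"
proof -
  obtain M where M: "nonneg_cone M" "C \<subseteq> M"
    and max: "\<And>C'. nonneg_cone C' \<Longrightarrow> M \<subseteq> C' \<Longrightarrow> C' = M"
    using maximal_nonneg_cone[OF C] by blast
  note add = nonneg_coneD(1)[OF M(1)] and scale = nonneg_coneD(2)[OF M(1)]
    and nonneg = nonneg_coneD(3)[OF M(1)]
  define S where "S = fst ` C"
  define g where "g u = Inf {r. (u, r) \<in> M}" for u
  have S_M: "\<exists>r. (u, r) \<in> M" if "u \<in> S" for u using that M(2) by (force simp: S_def)
  have S_neg: "- u \<in> S" if "u \<in> S" for u using that sym by (simp add: S_def)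
  have S_add: "u + v \<in> S" if uv: "u \<in> S" "v \<in> S" for u v
  proof -
    obtain r s where "(u, r) \<in> C" "(v, s) \<in> C" using uv by (force simp: S_def)
    then show ?thesis using nonneg_coneD(1)[OF C] by (force simp: S_def)
  qed
  have S_scale: "t *\<^sub>R u \<in> S" if u: "u \<in> S" and "0 < t" for t u
  proof -
    obtain r where "(u, r) \<in> C" using u by (force simp: S_def)
    then show ?thesis using nonneg_coneD(2)[OF C _ \<open>0 < t\<close>] by (force simp: S_def)
  qed
  \<comment> \<open>A bound \<open>s\<close> at \<open>-u\<close> is a lower bound \<open>-s\<close>
    at \<open>u\<close>, since the two demands add up to one at 0.\<close>
  have opp: "- s \<le> r" if "(u, r) \<in> M" "(- u, s) \<in> M" for u r s
    using nonneg[of "r + s"] add[OF that] by simp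
  have bdd: "bdd_below {r. (u, r) \<in> M}" if u: "u \<in> S" for u
  proof -
    obtain s where "(- u, s) \<in> M" using S_M[OF S_neg[OF u]] by blast
    then show ?thesis using opp by (intro bdd_belowI[of _ "- s"]) auto
  qed
  have g_le: "g u \<le> r" if "(u, r) \<in> M" "u \<in> S" for u r
    unfolding g_def by (rule cInf_lower[OF _ bdd]) (use that in auto)
  have le_g: "s \<le> g u" if "\<And>r. (u, r) \<in> M \<Longrightarrow> s \<le> r" "u \<in> S" for u s
    unfolding g_def by (rule cInf_greatest) (use that S_M in auto)
  have neg_mem: "(- u, - g u) \<in> M" if u: "u \<in> S" for u
  proof -
    \<comment> \<open>Adjoin the ray through \<open>(- u, - g u)\<close>; admitting
      \<open>t = 0\<close> makes \<open>D\<close> contain \<open>M\<close>.\<close>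
    define D where "D = {p + t *\<^sub>R (- u, - g u) | p t. p \<in> M \<and> 0 \<le> t}"
    have "M \<subseteq> D"
    proof
      fix p assume "p \<in> M"
      then show "p \<in> D" unfolding D_def by (intro CollectI exI[of _ p] exI[of _ "0::real"]) (simp add: zero_prod_def)
    qed
    have "nonneg_cone D"
      unfolding nonneg_cone_def
    proof (intro conjI ballI allI impI)
      show "0 \<in> D" using M(1) \<open>M \<subseteq> D\<close> unfolding nonneg_cone_def by blast
    next
      fix p q assume "p \<in> D" "q \<in> D"
      then obtain p' t q' s where "p = p' + t *\<^sub>R (- u, - g u)" "q = q' + s *\<^sub>R (- u, - g u)"
        "p' \<in> M" "q' \<in> M" "0 \<le> t" "0 \<le> s" unfolding D_def by blast
      then have "p + q = (p' + q') + (t + s) *\<^sub>R (- u, - g u)" "p' + q' \<in> M" "0 \<le> t + s"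
        using M(1) unfolding nonneg_cone_def by (simp_all add: algebra_simps)
      then show "p + q \<in> D" unfolding D_def by blast
    next
      fix p and r :: real assume "p \<in> D" "0 < r"
      then obtain p' t where "p = p' + t *\<^sub>R (- u, - g u)" "p' \<in> M" "0 \<le> t"
        unfolding D_def by blast
      then have "r *\<^sub>R p = r *\<^sub>R p' + (r * t) *\<^sub>R (- u, - g u)" "r *\<^sub>R p' \<in> M" "0 \<le> r * t"
        using M(1) \<open>0 < r\<close> unfolding nonneg_cone_def by (simp_all add: algebra_simps)
      then show "r *\<^sub>R p \<in> D" unfolding D_def by blast
    next
      \<comment> \<open>For \<open>t > 0\<close>, division by \<open>t\<close> shows that
        \<open>s / t\<close> is a bound at \<open>u\<close>, hence at least the infimum
        \<open>g u\<close>; this is the claim.\<close>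
      fix r assume "(0, r) \<in> D"
      then obtain v s t where vs: "v = t *\<^sub>R u" "r = s - t * g u" "(v, s) \<in> M" "0 \<le> t"
        unfolding D_def by auto
      show "0 \<le> r"
      proof (cases "t = 0")
        case True then show ?thesis using vs nonneg by auto
      next
        case False
        then have "0 < t" using vs by simp
        then have "(u, inverse t * s) \<in> M" using scale[OF vs(3), of "inverse t"] vs(1) by simp
        then have "g u \<le> inverse t * s" using g_le u by blast
        then show ?thesis using \<open>0 < t\<close> vs(2) by (simp add: field_simps)
      qed
    qed
    then have "D = M" using max \<open>M \<subseteq> D\<close> by blast
    moreover have "(- u, - g u) \<in> D"
      unfolding D_def using M(1)
      by (intro CollectI exI[of _ "0 :: 'a \<times> real"] exI[of _ "1::real"])
        (simp add: nonneg_cone_def)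
    ultimately show ?thesis by blast
  qed
  \<comment> \<open>Opposite members of \<open>M\<close> squeeze the infimum from both sides, so
    additivity and homogeneity of \<open>g\<close> become membership statements.\<close>
  have g_eq: "g u = a" if "(u, a) \<in> M" "(- u, - a) \<in> M" "u \<in> S" for u a
  proof (rule antisym)
    show "g u \<le> a" by (rule g_le[OF that(1,3)])
    show "a \<le> g u" by (rule le_g[OF _ that(3)]) (use opp[OF _ that(2)] in simp)
  qed
  have mem: "(u, g u) \<in> M" if u: "u \<in> S" for u
  proof -
    have "g (- u) \<le> - g u" using g_le[OF neg_mem[OF u] S_neg[OF u]] .
    moreover have "- g u \<le> g (- u)"
    proof (rule le_g[OF _ S_neg[OF u]])
      fix r assume r: "(- u, r) \<in> M"
      have "- r \<le> g u" by (rule le_g[OF _ u]) (rule opp[OF _ r])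
      then show "- g u \<le> r" by simp
    qed
    ultimately show ?thesis using neg_mem[OF S_neg[OF u]] by simp
  qed
  have g_add: "g (u + v) = g u + g v" if "u \<in> S" "v \<in> S" for u v
    using add[OF mem[OF that(1)] mem[OF that(2)]] add[OF neg_mem[OF that(1)] neg_mem[OF that(2)]]
    by (intro g_eq S_add that) simp_all
  have g_pos: "g (t *\<^sub>R u) = t * g u" if "u \<in> S" "0 < t" for t u
    using scale[OF mem[OF that(1)] that(2)] scale[OF neg_mem[OF that(1)] that(2)]
    by (intro g_eq S_scale that) simp_all
  have g_neg: "g (- u) = - g u" if "u \<in> S" for u
    using mem[OF that] neg_mem[OF that] by (intro g_eq S_neg that) simp_all
  have "g (t *\<^sub>R u) = t * g u" if u: "u \<in> S" for t u
  proof (cases t "0::real" rule: linorder_cases)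
    case less
    have "0 < - t" using less by simp
    have "g (t *\<^sub>R u) = g (- ((- t) *\<^sub>R u))" by simp
    also have "\<dots> = - g ((- t) *\<^sub>R u)" by (rule g_neg[OF S_scale[OF u \<open>0 < - t\<close>]])
    also have "\<dots> = t * g u" using g_pos[OF u \<open>0 < - t\<close>] by simp
    finally show ?thesis .
  next
    case equal
    have "g (u + - u) = 0" using g_add[OF u S_neg[OF u]] g_neg[OF u] by simp
    then show ?thesis using equal by simp
  qed (simp add: g_pos u)
  moreover have "g u \<le> r" if "(u, r) \<in> C" for u r
    using that M(2) by (intro g_le) (force simp: S_def)+
  ultimately show ?thesis using that[of g] g_add unfolding S_def by blast
qed

text \<open>Continuity extends a bounded real-linear map from a dense subspace into a complete
  space. This serves real functionals as well as operators between Hilbert spaces.\<close>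

lemma lipschitz_additive_extension:
  fixes f :: "'a::real_normed_vector \<Rightarrow> 'b::{real_normed_vector, complete_space}"
  assumes S: "closure S = UNIV" "\<And>x y. x \<in> S \<Longrightarrow> y \<in> S \<Longrightarrow> x + y \<in> S"
      "\<And>r x. x \<in> S \<Longrightarrow> r *\<^sub>R x \<in> S"
    and add: "\<And>x y. x \<in> S \<Longrightarrow> y \<in> S \<Longrightarrow> f (x + y) = f x + f y"
    and scale: "\<And>r x. x \<in> S \<Longrightarrow> f (r *\<^sub>R x) = r *\<^sub>R f x"
    and bound: "\<And>x. x \<in> S \<Longrightarrow> norm (f x) \<le> K * norm x"
  obtains F where "bounded_linear F" "\<And>x. x \<in> S \<Longrightarrow> F x = f x" "\<And>x. norm (F x) \<le> K * norm x"
proof -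
  have diff: "f (x - y) = f x - f y" if "x \<in> S" "y \<in> S" for x y
    using add[OF that(1) S(3)[OF that(2), of "- 1"]] scale[OF that(2), of "- 1"] by simp
  have mem: "x - y \<in> S" if "x \<in> S" "y \<in> S" for x y
    using S(2)[OF that(1) S(3)[OF that(2), of "- 1"]] by simp
  \<comment> \<open>A Lipschitz constant is nonnegative, which is not assumed of
    \<open>K\<close>.\<close>
  have "(max K 0)-lipschitz_on S f"
  proof (rule lipschitz_onI)
    fix x y assume "x \<in> S" "y \<in> S"
    then have "norm (f (x - y)) \<le> K * norm (x - y)" by (intro bound mem)
    also have "\<dots> \<le> max K 0 * norm (x - y)" by (intro mult_right_mono) auto
    finally show "dist (f x) (f y) \<le> max K 0 * dist x y"
      using \<open>x \<in> S\<close> \<open>y \<in> S\<close> by (simp add: dist_norm diff)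
  qed simp
  from lipschitz_extend_closure[OF this]
  obtain F where F: "(max K 0)-lipschitz_on UNIV F" "\<And>x. x \<in> S \<Longrightarrow> F x = f x"
    using S(1) by metis
  have cont: "continuous_on UNIV F" by (rule lipschitz_on_continuous_on[OF F(1)])
  have cont': "continuous_on UNIV (\<lambda>x. F (h x))" if "continuous_on UNIV h" for h :: "'c::topological_space \<Rightarrow> 'a"
    using continuous_on_compose2[OF cont that] by simp
  have dense: "P x" if "closed {x. P x}" "\<And>x. x \<in> S \<Longrightarrow> P x" for P and x
    using closure_minimal[of S "{x. P x}"] that S(1) by auto
  \<comment> \<open>Density is used in one variable at a time: here \<open>x\<close> becomes
    arbitrary, next \<open>y\<close>.\<close>
  have addS: "F (x + y) = F x + F y" if "y \<in> S" for x y
    by (rule dense[of "\<lambda>x. F (x + y) = F x + F y"])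
      (use that in \<open>auto intro!: closed_Collect_eq continuous_intros cont cont' simp: F(2) S(2) add\<close>)
  have "F (x + y) = F x + F y" for x y
    by (rule dense[of "\<lambda>y. F (x + y) = F x + F y"])
      (auto intro!: closed_Collect_eq continuous_intros cont cont' simp: addS)
  moreover have "F (r *\<^sub>R x) = r *\<^sub>R F x" for r x
    by (rule dense[of "\<lambda>x. F (r *\<^sub>R x) = r *\<^sub>R F x"])
      (auto intro!: closed_Collect_eq continuous_intros cont cont' simp: F(2) S(3) scale)
  moreover have bound': "norm (F x) \<le> K * norm x" for x
    by (rule dense[of "\<lambda>x. norm (F x) \<le> K * norm x"])
      (auto intro!: closed_Collect_le continuous_intros cont cont' simp: F(2) bound)
  ultimately have "bounded_linear F"
    by (intro bounded_linear_intro[of _ K]) (simp_all add: mult.commute)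
  then show ?thesis using that[of F] F(2) bound' by blast
qed

section \<open>Operators on Hilbert spaces\<close>

lemma cinner_zero [simp]: "cinner 0 x = 0" "cinner x 0 = 0"
  using cinner_scaleC_left[of 0 0 x] cinner_scaleC_right[of x 0 0] by simp_all

lemma cinner_diff_right: "cinner x (y - z) = cinner x y - cinner x z"
  using cinner_add_right[of x "y - z" z] by simp

lemma cinner_sum_right: "cinner x (\<Sum>i\<in>I. f i) = (\<Sum>i\<in>I. cinner x (f i))"
  by (induction I rule: infinite_finite_induct) (simp_all add: cinner_add_right)

lemma cblinfun_apply_linear [simp]:
  "f *\<^sub>V (x + y) = f *\<^sub>V x + f *\<^sub>V y" "f *\<^sub>V 0 = 0" "f *\<^sub>V (- x) = - (f *\<^sub>V x)"
  "f *\<^sub>V (x - y) = f *\<^sub>V x - f *\<^sub>V y" "f *\<^sub>V (r *\<^sub>R x) = r *\<^sub>R (f *\<^sub>V x)"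
  "f *\<^sub>V (c *\<^sub>C x) = c *\<^sub>C (f *\<^sub>V x)" "f *\<^sub>V (\<Sum>i\<in>I. g i) = (\<Sum>i\<in>I. f *\<^sub>V g i)"
proof -
  interpret bounded_linear "cblinfun_apply f" by (rule bounded_linear_cblinfun_apply)
  show "f *\<^sub>V (x + y) = f *\<^sub>V x + f *\<^sub>V y" "f *\<^sub>V 0 = 0" "f *\<^sub>V (- x) = - (f *\<^sub>V x)"
    "f *\<^sub>V (x - y) = f *\<^sub>V x - f *\<^sub>V y" "f *\<^sub>V (r *\<^sub>R x) = r *\<^sub>R (f *\<^sub>V x)"
    "f *\<^sub>V (\<Sum>i\<in>I. g i) = (\<Sum>i\<in>I. f *\<^sub>V g i)"
    by (rule add zero neg diff scaleR sum)+
qed (rule cblinfun_scaleC_right)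

lemmas cblinfun_rep [simp] =
  plus_cblinfun.rep_eq zero_cblinfun.rep_eq uminus_cblinfun.rep_eq minus_cblinfun.rep_eq
  scaleC_cblinfun.rep_eq cblinfun_id.rep_eq cblinfun_compose.rep_eq

lemma cblinfun_scaleR_apply [simp]: "(r *\<^sub>R f) *\<^sub>V x = r *\<^sub>R (f *\<^sub>V x)"
  by (simp add: scaleR_scaleC)

lemma cblinfun_sum_apply: "(\<Sum>i\<in>I. f i) *\<^sub>V x = (\<Sum>i\<in>I. f i *\<^sub>V x)"
  by (induction I rule: infinite_finite_induct) simp_all

lemma norm_cblinfun_leI:
  assumes "\<And>x. norm (f *\<^sub>V x) \<le> K * norm x" "0 \<le> K"
  shows "norm f \<le> K"
  using assms by transfer (intro onorm_bound)

lemma bounded_clinearI: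
  assumes "\<And>x y. f (x + y) = f x + f y" "\<And>c x. f (c *\<^sub>C x) = c *\<^sub>C f x"
    "\<And>x. norm (f x) \<le> K * norm x"
  shows "bounded_clinear f"
  unfolding bounded_clinear_def
  using assms by (auto intro!: bounded_linear_intro[of _ K] simp: scaleR_scaleC mult.commute)

lemma cinner_cadjoint: "cinner y (cadjoint a *\<^sub>V x) = cinner (a *\<^sub>V y) x"
  by (metis cadjoint_cinner cinner_commute)

lemma inner_cadjoint: "inner (cadjoint a *\<^sub>V y) x = inner y (a *\<^sub>V x)"
  by (metis Re_cinner cadjoint_cinner)

lemma cadjoint_cadjoint [simp]: "cadjoint (cadjoint a) = a"
  by (rule cadjoint_unique) (simp add: cinner_cadjoint)

lemma cadjoint_compose: "cadjoint (a o\<^sub>C\<^sub>L b) = cadjoint b o\<^sub>C\<^sub>L cadjoint a"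
  by (rule cadjoint_unique) (simp add: cadjoint_cinner)

lemma cadjoint_add: "cadjoint (a + b) = cadjoint a + cadjoint b"
  by (rule cadjoint_unique) (simp add: cadjoint_cinner cinner_add_left cinner_add_right)

lemma cadjoint_zero [simp]: "cadjoint 0 = 0"
  by (rule cadjoint_unique) simp

lemma cadjoint_id [simp]: "cadjoint cblinfun_id = cblinfun_id"
  by (rule cadjoint_unique) simp

lemma cadjoint_scaleC: "cadjoint (c *\<^sub>C a) = cnj c *\<^sub>C cadjoint a"
  by (rule cadjoint_unique) (simp add: cadjoint_cinner cinner_scaleC_left cinner_scaleC_right)

lemma norm_cadjoint_le: "norm (cadjoint a) \<le> norm a"
proof (rule norm_cblinfun_leI)
  fix y
  let ?x = "cadjoint a *\<^sub>V y"
  have "(norm ?x)\<^sup>2 = inner y (a *\<^sub>V ?x)"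
    by (simp only: power2_norm_eq_inner inner_cadjoint)
  also have "\<dots> \<le> norm y * (norm a * norm ?x)"
    by (meson order_trans norm_cauchy_schwarz norm_cblinfun_apply_le mult_left_mono norm_ge_zero)
  finally show "norm ?x \<le> norm a * norm y"
    by (cases "?x = 0") (simp_all add: power2_eq_square mult_ac)
qed simp

lemma norm_projection_apply_le:
  assumes "projection P"
  shows "norm (P *\<^sub>V x) \<le> norm x"
proof -
  have "(norm (P *\<^sub>V x))\<^sup>2 = inner x ((P o\<^sub>C\<^sub>L P) *\<^sub>V x)"
    using assms by (metis cblinfun_compose.rep_eq inner_cadjoint power2_norm_eq_inner projection_def)
  also have "\<dots> \<le> norm x * norm (P *\<^sub>V x)"
    using assms norm_cauchy_schwarz by (simp add: projection_def)
  finally show ?thesis by (cases "P *\<^sub>V x = 0") (simp_all add: power2_eq_square)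
qed

text \<open>The square of the norm of \<open>a x\<close> is the inner product of \<open>x\<close>
  with \<open>a* a x\<close>, so the bound is that of a projection. It serves partial isometries and
  also projections themselves.\<close>

lemma norm_le_one_of_projection:
  assumes "projection (cadjoint a o\<^sub>C\<^sub>L a)"
  shows "norm a \<le> 1"
proof (rule norm_cblinfun_leI)
  fix x
  have "(norm (a *\<^sub>V x))\<^sup>2 = inner x ((cadjoint a o\<^sub>C\<^sub>L a) *\<^sub>V x)"
    by (simp add: power2_norm_eq_inner flip: inner_cadjoint[of "cadjoint a"])
  also have "\<dots> \<le> norm x * norm x"
    using norm_cauchy_schwarz norm_projection_apply_le[OF assms]
    by (meson mult_left_mono norm_ge_zero order_trans)
  finally show "norm (a *\<^sub>V x) \<le> 1 * norm x"
    by (simp add: power2_eq_square[symmetric])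
qed simp

text \<open>The complex Cauchy--Schwarz inequality from the real one: multiplying \<open>x\<close>
  by the number \<open>cinner x y\<close> makes the inner product real and nonnegative.\<close>

lemma norm_cinner_le: "cmod (cinner x y) \<le> norm x * norm y"
proof -
  define w where "w = cinner x y"
  have "(cmod w)\<^sup>2 = Re (cinner (w *\<^sub>C x) y)"
    unfolding cinner_scaleC_left w_def[symmetric] by (simp add: cmod_power2) (simp add: power2_eq_square)
  also have "\<dots> \<le> cmod w * (norm x * norm y)"
    using norm_cauchy_schwarz[of "w *\<^sub>C x" y] by (simp add: Re_cinner norm_scaleC mult.assoc)
  finally show ?thesis
    by (cases "w = 0") (simp_all add: power2_eq_square flip: w_def)
qed

lemma cblinfun_compose_assoc: "a o\<^sub>C\<^sub>L (b o\<^sub>C\<^sub>L c) = a o\<^sub>C\<^sub>L b o\<^sub>C\<^sub>L c"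
  by (rule cblinfun_eqI) simp

lemma cblinfun_compose_zero [simp]: "0 o\<^sub>C\<^sub>L a = 0" "a o\<^sub>C\<^sub>L 0 = 0"
  by (rule cblinfun_eqI; simp)+

lemma norm_compose_le: "norm (a o\<^sub>C\<^sub>L b) \<le> norm a * norm b"
proof (rule norm_cblinfun_leI)
  fix x
  have "norm (a *\<^sub>V b *\<^sub>V x) \<le> norm a * norm (b *\<^sub>V x)" by (rule norm_cblinfun_apply_le)
  also have "\<dots> \<le> norm a * (norm b * norm x)"
    by (intro mult_left_mono norm_cblinfun_apply_le) simp
  finally show "norm ((a o\<^sub>C\<^sub>L b) *\<^sub>V x) \<le> norm a * norm b * norm x" by (simp add: mult.assoc)
qed simp

text \<open>The hypothesis says that \<open>S\<close> is a partial isometry. The range projections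
  of such operators will be the orthogonal supports that the Ruan axioms ask for.\<close>

lemma projection_range:
  assumes "S o\<^sub>C\<^sub>L cadjoint S o\<^sub>C\<^sub>L S = S"
  shows "projection (S o\<^sub>C\<^sub>L cadjoint S)"
  by (simp add: projection_def cadjoint_compose cblinfun_compose_assoc assms)

lemma orthogonal_ranges:
  assumes "cadjoint S o\<^sub>C\<^sub>L T = 0"
  shows "(S o\<^sub>C\<^sub>L cadjoint S) o\<^sub>C\<^sub>L (T o\<^sub>C\<^sub>L cadjoint T) = 0"
proof -
  have "(S o\<^sub>C\<^sub>L cadjoint S) o\<^sub>C\<^sub>L (T o\<^sub>C\<^sub>L cadjoint T) = S o\<^sub>C\<^sub>L (cadjoint S o\<^sub>C\<^sub>L T) o\<^sub>C\<^sub>L cadjoint T"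
    by (simp add: cblinfun_compose_assoc)
  then show ?thesis by (simp add: assms)
qed

section \<open>Rank-one operators |x><y|\<close>

lift_definition rank1 :: "'a::complex_normed_vector \<Rightarrow> 'b::complex_inner \<Rightarrow> 'b \<Rightarrow>\<^sub>C\<^sub>L 'a"
  is "\<lambda>x y z. cinner y z *\<^sub>C x"
proof (rule bounded_clinearI)
  fix x :: 'a and y z :: 'b
  show "norm (cinner y z *\<^sub>C x) \<le> (norm x * norm y) * norm z"
    using mult_left_mono[OF norm_cinner_le[of y z], of "norm x"] by (simp add: norm_scaleC mult_ac)
qed (simp_all add: cinner_add_right cinner_scaleC_right scaleC_add_left scaleC_scaleC)

lemmas rank1_apply [simp] = rank1.rep_eq

lemma cadjoint_rank1 [simp]: "cadjoint (rank1 x y) = rank1 y x"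
  for x :: "'a::chilbert_space" and y :: "'b::chilbert_space"
proof (rule cadjoint_unique)
  fix u v
  show "cinner (rank1 y x *\<^sub>V v) u = cinner v (rank1 x y *\<^sub>V u)"
    using cinner_commute[of v x] by (simp add: cinner_scaleC_left cinner_scaleC_right mult.commute)
qed

lemma compose_rank1: "a o\<^sub>C\<^sub>L rank1 x y = rank1 (a *\<^sub>V x) y"
  by (rule cblinfun_eqI) simp

lemma rank1_compose: "rank1 x y o\<^sub>C\<^sub>L a = rank1 x (cadjoint a *\<^sub>V y)"
  by (rule cblinfun_eqI) (simp add: cadjoint_cinner)

lemma rank1_add_left: "rank1 (x + x') y = rank1 x y + rank1 x' y"
  by (rule cblinfun_eqI) (simp add: scaleC_add_right)

lemma rank1_add_right: "rank1 x (y + y') = rank1 x y + rank1 x y'"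
  by (rule cblinfun_eqI) (simp add: cinner_add_left scaleC_add_left)

lemma rank1_scaleC_left: "rank1 (c *\<^sub>C x) y = c *\<^sub>C rank1 x y"
  by (rule cblinfun_eqI) (simp add: scaleC_scaleC mult.commute)

lemma rank1_scaleC_right: "rank1 x (c *\<^sub>C y) = cnj c *\<^sub>C rank1 x y"
  by (rule cblinfun_eqI) (simp add: scaleC_scaleC cinner_scaleC_left)

section \<open>Finite orthonormal sets\<close>

definition corthonormal :: "'a::complex_inner set \<Rightarrow> bool"
  where "corthonormal E \<longleftrightarrow> (\<forall>e\<in>E. \<forall>e'\<in>E. cinner e e' = (if e = e' then 1 else 0))"

lemma corthonormalD: "corthonormal E \<Longrightarrow> e \<in> E \<Longrightarrow> e' \<in> E \<Longrightarrow> cinner e e' = (if e = e' then 1 else 0)"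
  by (simp add: corthonormal_def)

definition span_projection :: "'a::complex_inner set \<Rightarrow> 'a \<Rightarrow>\<^sub>C\<^sub>L 'a"
  where "span_projection E = (\<Sum>e\<in>E. rank1 e e)"

lemma span_projection_apply: "span_projection E *\<^sub>V x = (\<Sum>e\<in>E. cinner e x *\<^sub>C e)"
  by (simp add: span_projection_def cblinfun_sum_apply)

lemma cinner_span_projection:
  assumes "finite E" "corthonormal E" "e \<in> E"
  shows "cinner e (span_projection E *\<^sub>V x) = cinner e x"
proof -
  have "cinner e (span_projection E *\<^sub>V x) = (\<Sum>e'\<in>E. if e = e' then cinner e x else 0)"
    unfolding span_projection_apply cinner_sum_right using assms(2,3)
    by (intro sum.cong) (auto simp: cinner_scaleC_right corthonormalD)
  then show ?thesis using assms by simp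
qed

lemma corthonormal_independent:
  assumes "finite E" "corthonormal E"
  shows "complex_vector.independent E"
proof (rule complex_vector.independent_if_scalars_zero[OF assms(1)])
  fix f e assume f: "(\<Sum>e\<in>E. f e *\<^sub>C e) = 0" and e: "e \<in> E"
  have "cinner e (\<Sum>e'\<in>E. f e' *\<^sub>C e') = (\<Sum>e'\<in>E. if e = e' then f e else 0)"
    unfolding cinner_sum_right using assms(2) e
    by (intro sum.cong) (auto simp: cinner_scaleC_right corthonormalD)
  then show "f e = 0" using f e assms(1) by simp
qed

lemma corthonormal_insert_normalized:
  fixes r :: "'a::complex_inner"
  assumes "corthonormal E" "r \<noteq> 0" "\<And>e. e \<in> E \<Longrightarrow> cinner e r = 0"
  defines "f \<equiv> complex_of_real (inverse (norm r)) *\<^sub>C r"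
  shows "corthonormal (insert f E)" "f \<notin> E" "cinner f f = 1" "\<And>e. e \<in> E \<Longrightarrow> cinner e f = 0"
proof -
  have "norm f = 1" using assms(2) by (simp add: f_def norm_scaleC norm_inverse)
  then show ff: "cinner f f = 1" by (simp add: cinner_self)
  show ef: "cinner e f = 0" if "e \<in> E" for e
    using assms(3)[OF that] by (simp add: f_def cinner_scaleC_right)
  have fe: "cinner f e = 0" if "e \<in> E" for e
    using ef[OF that] cinner_commute[of f e] by simp
  show "f \<notin> E" using ff ef by force
  then show "corthonormal (insert f E)"
    using assms(1) ff ef fe unfolding corthonormal_def by auto
qed

text \<open>Take an orthonormal subset of \<open>M\<close> of largest size: sizes are bounded
  because orthonormal sets are independent, and a vector of \<open>M\<close> moved by the projection
  would leave a residue in \<open>M\<close> by which the set could grow. That \<open>E\<close> lies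
  inside \<open>M\<close> matters: later \<open>M\<close> consists of slices, and the basis vectors
  have to be slices too.\<close>

lemma orthonormal_basis_exists:
  fixes M :: "'a::complex_inner set"
  assumes X: "finite X" "M \<subseteq> cspan X" and M: "complex_vector.subspace M"
  obtains E where "finite E" "corthonormal E" "E \<subseteq> M" "\<And>m. m \<in> M \<Longrightarrow> span_projection E *\<^sub>V m = m"
proof -
  let ?P = "\<lambda>E. finite E \<and> corthonormal E \<and> E \<subseteq> M"
  have card: "card E \<le> card X" if "?P E" for E
    using complex_vector.independent_span_bound[OF X(1) corthonormal_independent, of E] that X(2)
    by blast
  have "?P {}" by (simp add: corthonormal_def)
  then have "\<exists>E. ?P E \<and> (\<forall>E'. ?P E' \<longrightarrow> card E' \<le> card E)"
    using card by (intro ex_has_greatest_nat[of ?P "{}" card "Suc (card X)"]) (auto simp: less_Suc_eq_le)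
  then obtain E where E: "?P E" and max: "\<And>E'. ?P E' \<Longrightarrow> card E' \<le> card E"
    by auto
  have "span_projection E *\<^sub>V m = m" if m: "m \<in> M" for m
  proof (rule ccontr)
    define r where "r = m - span_projection E *\<^sub>V m"
    assume "\<not> ?thesis"
    then have "r \<noteq> 0" by (simp add: r_def)
    have "cinner e r = 0" if "e \<in> E" for e
      using cinner_span_projection[of E e m] E that by (simp add: r_def cinner_diff_right)
    note f = corthonormal_insert_normalized(1,2)[OF conjunct1[OF conjunct2[OF E]] \<open>r \<noteq> 0\<close> this]
    have "r \<in> M"
      unfolding r_def span_projection_apply using M m E
      by (auto intro!: complex_vector.subspace_diff complex_vector.subspace_sum
          complex_vector.subspace_scale)
    then have "complex_of_real (inverse (norm r)) *\<^sub>C r \<in> M"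
      using M by (simp add: complex_vector.subspace_scale)
    then show False using max[of "insert (complex_of_real (inverse (norm r)) *\<^sub>C r) E"] f E by simp
  qed
  then show ?thesis using that[of E] E by blast
qed

text \<open>Infinite dimension in the form in which it is used: there is always room for one more
  orthogonal unit vector. This form passes to the conjugate space directly, where the inner product
  is merely flipped.\<close>

definition infinite_dimensional :: "'a::complex_inner itself \<Rightarrow> bool"
  where "infinite_dimensional _ \<longleftrightarrow> (\<forall>E :: 'a set. finite E \<longrightarrow> corthonormal E \<longrightarrow>
    (\<exists>f. cinner f f = 1 \<and> (\<forall>e\<in>E. cinner e f = 0)))"

lemma infinite_dimensionalI:
  assumes "\<not> (\<exists>B :: 'a::complex_inner set. finite B \<and> cspan B = UNIV)"
  shows "infinite_dimensional TYPE('a)"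
  unfolding infinite_dimensional_def
proof (intro allI impI)
  fix E :: "'a set" assume E: "finite E" "corthonormal E"
  then obtain x where x: "x \<notin> cspan E" using assms by blast
  define r where "r = x - span_projection E *\<^sub>V x"
  have "span_projection E *\<^sub>V x \<in> cspan E"
    unfolding span_projection_apply
    by (intro complex_vector.span_sum complex_vector.span_scale complex_vector.span_base)
  then have "r \<noteq> 0" using x by (auto simp: r_def)
  moreover have "cinner e r = 0" if "e \<in> E" for e
    using cinner_span_projection[of E e x] E that by (simp add: r_def cinner_diff_right)
  ultimately show "\<exists>f. cinner f f = 1 \<and> (\<forall>e\<in>E. cinner e f = 0)"
    using corthonormal_insert_normalized(3,4)[OF E(2)] by blast
qed

lemma infinite_dimensional_conj_space:
  assumes "infinite_dimensional TYPE('a::complex_inner)"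
  shows "infinite_dimensional TYPE('a conj_space)"
  unfolding infinite_dimensional_def
proof (intro allI impI)
  fix E :: "'a conj_space set" assume E: "finite E" "corthonormal E"
  have "corthonormal (from_conj ` E)"
    using E(2) by (auto simp: corthonormal_def cinner_conj_space.rep_eq from_conj_inject)
  then obtain f where "cinner f f = 1" "\<forall>e\<in>from_conj ` E. cinner e f = 0"
    using assms E(1) unfolding infinite_dimensional_def by blast
  then show "\<exists>f. cinner f f = 1 \<and> (\<forall>e\<in>E. cinner e f = 0)"
    by (intro exI[of _ "to_conj f"])
      (auto simp: cinner_conj_space.rep_eq to_conj_inverse intro: trans[OF cinner_commute])
qed

text \<open>The set \<open>G\<close> is a mere index set. Images are chosen one at a time, each
  orthogonal to \<open>E\<close> and to the earlier images, so that the union of \<open>E\<close>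
  and the images stays orthonormal.\<close>

lemma orthonormal_copy_exists:
  fixes E :: "'a::complex_inner set"
  assumes inf: "infinite_dimensional TYPE('a)" and E: "finite E" "corthonormal E" and "finite G"
  shows "\<exists>f. (\<forall>g\<in>G. \<forall>g'\<in>G. cinner (f g) (f g') = (if g = g' then 1 else 0)) \<and>
    (\<forall>g\<in>G. \<forall>e\<in>E. cinner e (f g) = (0::complex))"
  using \<open>finite G\<close>
proof (induction G)
  case (insert g G)
  then obtain f where f: "\<And>g g'. g \<in> G \<Longrightarrow> g' \<in> G \<Longrightarrow> cinner (f g) (f g') = (if g = g' then 1 else 0)"
    "\<And>g e. g \<in> G \<Longrightarrow> e \<in> E \<Longrightarrow> cinner e (f g) = (0::complex)" by blast
  have f': "cinner (f g) e = 0" if "g \<in> G" "e \<in> E" for g e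
    using f(2)[OF that] cinner_commute[of "f g" e] by simp
  have inj: "f g = f g' \<longleftrightarrow> g = g'" if "g \<in> G" "g' \<in> G" for g g'
  proof
    assume eq: "f g = f g'"
    show "g = g'"
      using f(1)[OF that] f(1)[OF that(1,1)] unfolding eq by (simp split: if_splits)
  qed simp
  have disj: "f g \<noteq> e" "e \<noteq> f g" if "g \<in> G" "e \<in> E" for g e
    using f(2)[OF that] f(1)[OF that(1,1)] by auto
  have "corthonormal (E \<union> f ` G)"
    unfolding corthonormal_def
  proof (intro ballI)
    fix x y assume "x \<in> E \<union> f ` G" "y \<in> E \<union> f ` G"
    then consider "x \<in> E" "y \<in> E" | g where "x \<in> E" "y = f g" "g \<in> G"
      | g where "x = f g" "g \<in> G" "y \<in> E" | g g' where "x = f g" "y = f g'" "g \<in> G" "g' \<in> G"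
      by blast
    then show "cinner x y = (if x = y then 1 else 0)"
      by cases (simp_all add: corthonormalD[OF E(2)] f f' inj disj)
  qed
  moreover have "finite (E \<union> f ` G)" using E(1) insert.hyps(1) by simp
  ultimately have "\<exists>v. cinner v v = 1 \<and> (\<forall>e\<in>E \<union> f ` G. cinner e v = 0)"
    using inf unfolding infinite_dimensional_def by simp
  then obtain v where v: "cinner v v = 1" "\<And>e. e \<in> E \<union> f ` G \<Longrightarrow> cinner e v = 0"
    by auto
  have "cinner v (f g) = 0" if "g \<in> G" for g
    using v(2)[of "f g"] that cinner_commute[of v "f g"] by simp
  then show ?case
    using v f insert.hyps(2) by (intro exI[of _ "f(g := v)"]) auto
qed simp

text \<open>With \<open>c = 1\<close> this multiplies partial isometries that match up orthonormal
  systems; with \<open>c = 0\<close> it gives the vanishing products of those with orthogonal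
  ranges.\<close>

lemma compose_sum_rank1:
  assumes "finite E" "\<And>i j. i \<in> E \<Longrightarrow> j \<in> E \<Longrightarrow> cinner (g i) (f' j) = (if i = j then c else 0)"
  shows "(\<Sum>i\<in>E. rank1 (f i) (g i)) o\<^sub>C\<^sub>L (\<Sum>i\<in>E. rank1 (f' i) (g' i)) =
    c *\<^sub>C (\<Sum>i\<in>E. rank1 (f i) (g' i))"
proof (rule cblinfun_eqI)
  fix x
  have "cinner (g i) (\<Sum>j\<in>E. cinner (g' j) x *\<^sub>C f' j) *\<^sub>C f i = c *\<^sub>C cinner (g' i) x *\<^sub>C f i"
    if "i \<in> E" for i
  proof -
    have "cinner (g i) (\<Sum>j\<in>E. cinner (g' j) x *\<^sub>C f' j) =
      (\<Sum>j\<in>E. if i = j then cinner (g' i) x * c else 0)"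
      unfolding cinner_sum_right using assms(2) that
      by (intro sum.cong) (auto simp: cinner_scaleC_right)
    then show ?thesis using assms(1) that by (simp add: scaleC_scaleC mult.commute)
  qed
  then show "((\<Sum>i\<in>E. rank1 (f i) (g i)) o\<^sub>C\<^sub>L (\<Sum>i\<in>E. rank1 (f' i) (g' i))) *\<^sub>V x =
    (c *\<^sub>C (\<Sum>i\<in>E. rank1 (f i) (g' i))) *\<^sub>V x"
    unfolding cblinfun_compose.rep_eq scaleC_cblinfun.rep_eq cblinfun_sum_apply rank1_apply
      complex_vector.scale_sum_right by (intro sum.cong) simp_all
qed

lemma cadjoint_sum: "cadjoint (\<Sum>i\<in>I. a i) = (\<Sum>i\<in>I. cadjoint (a i))"
  by (induction I rule: infinite_finite_induct) (simp_all add: cadjoint_add)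

lemma projection_span_projection:
  fixes E :: "'a::chilbert_space set"
  assumes "finite E" "corthonormal E"
  shows "projection (span_projection E)"
  using compose_sum_rank1[of E "\<lambda>e. e" "\<lambda>e. e" 1 "\<lambda>e. e" "\<lambda>e. e"] assms
  by (simp add: projection_def span_projection_def cadjoint_sum corthonormalD scaleC_one)

text \<open>One may take \<open>S\<close> to be the projection itself; only \<open>T\<close> has to
  move, namely onto an orthonormal copy of \<open>E\<close> that is orthogonal to
  \<open>E\<close>.\<close>

lemma duplicating_isometries_exist:
  fixes E :: "'a::chilbert_space set"
  assumes inf: "infinite_dimensional TYPE('a)" and E: "finite E" "corthonormal E"
  obtains S T :: "'a \<Rightarrow>\<^sub>C\<^sub>L 'a" where "cadjoint S o\<^sub>C\<^sub>L S = span_projection E" "cadjoint T o\<^sub>C\<^sub>L T = span_projection E"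
    "cadjoint S o\<^sub>C\<^sub>L T = 0" "cadjoint T o\<^sub>C\<^sub>L S = 0"
    "S o\<^sub>C\<^sub>L cadjoint S o\<^sub>C\<^sub>L S = S" "T o\<^sub>C\<^sub>L cadjoint T o\<^sub>C\<^sub>L T = T"
proof -
  obtain f where f: "\<And>g g'. g \<in> E \<Longrightarrow> g' \<in> E \<Longrightarrow> cinner (f g) (f g') = (if g = g' then 1 else 0)"
    "\<And>g e. g \<in> E \<Longrightarrow> e \<in> E \<Longrightarrow> cinner e (f g) = (0::complex)"
    using orthonormal_copy_exists[OF inf E E(1)] by blast
  define S where "S = (\<Sum>e\<in>E. rank1 e e)"
  define T where "T = (\<Sum>e\<in>E. rank1 (f e) e)"
  have adj: "cadjoint S = S" "cadjoint T = (\<Sum>e\<in>E. rank1 e (f e))"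
    by (simp_all add: S_def T_def cadjoint_sum)
  have f': "cinner (f g) e = 0" if "g \<in> E" "e \<in> E" for g e
    using f(2)[OF that] cinner_commute[of "f g" e] by simp
  have SS: "S o\<^sub>C\<^sub>L S = S"
    unfolding S_def by (subst compose_sum_rank1[where c = 1]) (use E in \<open>simp_all add: corthonormalD[OF E(2)] scaleC_one\<close>)
  have TT: "cadjoint T o\<^sub>C\<^sub>L T = S"
    unfolding adj unfolding T_def S_def by (subst compose_sum_rank1[where c = 1]) (simp_all add: E f scaleC_one)
  have TS: "T o\<^sub>C\<^sub>L S = T"
    unfolding T_def S_def by (subst compose_sum_rank1[where c = 1]) (use E in \<open>simp_all add: corthonormalD[OF E(2)] scaleC_one\<close>)
  have ST0: "S o\<^sub>C\<^sub>L T = 0" "cadjoint T o\<^sub>C\<^sub>L S = 0"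
    unfolding adj unfolding T_def S_def
    by (subst compose_sum_rank1[where c = 0]; simp add: E f f')+
  have assoc: "T o\<^sub>C\<^sub>L cadjoint T o\<^sub>C\<^sub>L T = T o\<^sub>C\<^sub>L (cadjoint T o\<^sub>C\<^sub>L T)"
    by (rule cblinfun_eqI) simp
  show ?thesis
    by (rule that[of S T]) (simp_all add: SS TT ST0 assoc TS adj(1), simp_all add: S_def span_projection_def)
qed

text \<open>Two partial isometries with common initial projection \<open>P\<close> and orthogonal
  ranges: on the range of \<open>P\<close> they behave like Cuntz isometries and embed two copies of
  it side by side in L.\<close>

definition duplicating ::
  "('l::chilbert_space \<Rightarrow>\<^sub>C\<^sub>L 'l) \<Rightarrow> ('l \<Rightarrow>\<^sub>C\<^sub>L 'l) \<Rightarrow> ('l \<Rightarrow>\<^sub>C\<^sub>L 'l) \<Rightarrow> bool"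
  where "duplicating S T P \<longleftrightarrow> projection P \<and> cadjoint S o\<^sub>C\<^sub>L S = P \<and> cadjoint T o\<^sub>C\<^sub>L T = P \<and>
    cadjoint S o\<^sub>C\<^sub>L T = 0 \<and> cadjoint T o\<^sub>C\<^sub>L S = 0 \<and>
    S o\<^sub>C\<^sub>L cadjoint S o\<^sub>C\<^sub>L S = S \<and> T o\<^sub>C\<^sub>L cadjoint T o\<^sub>C\<^sub>L T = T"

lemma duplicatingD:
  assumes "duplicating S T P"
  shows "projection P" "cadjoint S o\<^sub>C\<^sub>L S = P" "cadjoint T o\<^sub>C\<^sub>L T = P"
    "cadjoint S o\<^sub>C\<^sub>L T = 0" "cadjoint T o\<^sub>C\<^sub>L S = 0"
    "S o\<^sub>C\<^sub>L cadjoint S o\<^sub>C\<^sub>L S = S" "T o\<^sub>C\<^sub>L cadjoint T o\<^sub>C\<^sub>L T = T" "norm S \<le> 1" "norm T \<le> 1"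
    "projection (S o\<^sub>C\<^sub>L cadjoint S)" "projection (T o\<^sub>C\<^sub>L cadjoint T)"
    "(S o\<^sub>C\<^sub>L cadjoint S) o\<^sub>C\<^sub>L (T o\<^sub>C\<^sub>L cadjoint T) = 0"
  using assms
  by (simp_all add: duplicating_def norm_le_one_of_projection projection_range orthogonal_ranges)

lemma duplicating_exists:
  fixes X :: "'l::chilbert_space set"
  assumes inf: "infinite_dimensional TYPE('l)" and X: "finite X"
  obtains S T P where "duplicating S T P" "\<And>x. x \<in> cspan X \<Longrightarrow> P *\<^sub>V x = x"
proof -
  obtain E where E: "finite E" "corthonormal E"
    "\<And>x. x \<in> cspan X \<Longrightarrow> span_projection E *\<^sub>V x = x"
    using orthonormal_basis_exists[OF X order_refl complex_vector.subspace_span] by metis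
  from duplicating_isometries_exist[OF inf E(1,2)]
  obtain S T :: "'l \<Rightarrow>\<^sub>C\<^sub>L 'l" where "duplicating S T (span_projection E)"
    using projection_span_projection[OF E(1,2)] unfolding duplicating_def by metis
  then show ?thesis using that E(3) by blast
qed

section \<open>Ampliations and slices\<close>

text \<open>Contraction of the second leg against \<open>y\<close>, in Dirac notation 1 \<otimes>
  <y|. It is conjugate-linear in \<open>y\<close>.\<close>

definition tensor_slice ::
  "('a::chilbert_space \<Rightarrow> 'b::chilbert_space \<Rightarrow> 't::chilbert_space) \<Rightarrow> 'b \<Rightarrow> 't \<Rightarrow>\<^sub>C\<^sub>L 'a"
  where "tensor_slice t y = cadjoint (cBlinfun (\<lambda>x. t x y))"

text \<open>These are the vectors of the algebraic tensor product.\<close>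

definition finite_support ::
  "('a::chilbert_space \<Rightarrow> 'b::chilbert_space \<Rightarrow> 't::chilbert_space) \<Rightarrow> 't \<Rightarrow> bool"
  where "finite_support t u \<longleftrightarrow> (\<exists>X. finite X \<and> (\<forall>y. tensor_slice t y *\<^sub>V u \<in> cspan X))"

context
  fixes t :: "'a::chilbert_space \<Rightarrow> 'b::chilbert_space \<Rightarrow> 't::chilbert_space"
  assumes t: "hilbert_tensor t"
begin

lemma tensor_simps:
  "t (x + x') y = t x y + t x' y" "t x (y + y') = t x y + t x y'"
  "t (c *\<^sub>C x) y = c *\<^sub>C t x y" "t x (c *\<^sub>C y) = c *\<^sub>C t x y"
  "cinner (t x y) (t x' y') = cinner x x' * cinner y y'"
  using t by (simp_all add: hilbert_tensor_def)

lemma norm_tensor: "norm (t x y) = norm x * norm y"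
proof -
  have "complex_of_real ((norm (t x y))\<^sup>2) = complex_of_real ((norm x * norm y)\<^sup>2)"
    unfolding cinner_self[symmetric] tensor_simps by (simp add: cinner_self power_mult_distrib)
  then have "(norm (t x y))\<^sup>2 = (norm x * norm y)\<^sup>2" using of_real_eq_iff by blast
  then show ?thesis by (simp add: power2_eq_iff_nonneg)
qed

lemma tensor_eqI:
  assumes "\<And>x y. cinner (t x y) u = cinner (t x y) v"
  shows "u = v"
proof -
  have "cspan {t x y | x y. True} \<subseteq> {w. cinner w (u - v) = 0}"
    using assms by (intro complex_vector.span_minimal)
      (auto simp: complex_vector.subspace_def cinner_diff_right cinner_add_left cinner_scaleC_left)
  then have "cspan {t x y | x y. True} \<subseteq> {w. inner w (u - v) = 0}"
    by (auto simp flip: Re_cinner)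
  moreover have "closed {w. inner w (u - v) = 0}"
    by (intro closed_Collect_eq continuous_intros)
  ultimately have "closure (cspan {t x y | x y. True}) \<subseteq> {w. inner w (u - v) = 0}"
    by (rule closure_minimal)
  then have "inner (u - v) (u - v) = 0" using t unfolding hilbert_tensor_def by blast
  then show ?thesis by simp
qed

section \<open>Ampliation as a contractive *-homomorphism\<close>

lemma ampliation_add: "ampliation t (a + b) = ampliation t a + ampliation t b"
  by (rule ampliation_unique[OF t]) (simp add: ampliation_apply[OF t] tensor_simps)

lemma ampliation_scaleC: "ampliation t (c *\<^sub>C a) = c *\<^sub>C ampliation t a"
  by (rule ampliation_unique[OF t]) (simp add: ampliation_apply[OF t] tensor_simps)

lemma ampliation_compose: "ampliation t (a o\<^sub>C\<^sub>L b) = ampliation t a o\<^sub>C\<^sub>L ampliation t b"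
  by (rule ampliation_unique[OF t]) (simp add: ampliation_apply[OF t] tensor_simps)

lemma ampliation_id: "ampliation t cblinfun_id = cblinfun_id"
  by (rule ampliation_unique[OF t]) simp

lemma ampliation_zero: "ampliation t 0 = 0"
  using ampliation_scaleC[of 0 0] by simp

lemma cadjoint_ampliation: "cadjoint (ampliation t a) = ampliation t (cadjoint a)"
proof (rule ampliation_unique[OF t, symmetric])
  fix x y
  show "cadjoint (ampliation t a) *\<^sub>V t x y = t (cadjoint a *\<^sub>V x) y"
    by (rule tensor_eqI) (simp add: cinner_cadjoint ampliation_apply[OF t] tensor_simps)
qed

lemma norm_ampliation_le: "norm (ampliation t a) \<le> norm a"
proof (rule norm_cblinfun_leI)
  fix u
  \<comment> \<open>Lists index the finite sums of elementary tensors, which is the form that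
    \<open>hilbert_tensor_sum_bound\<close> estimates; the bound then passes to the closure.\<close>
  define R where "R = range (\<lambda>ps. \<Sum>(x, y)\<leftarrow>ps. t x y)"
  have "cspan {t x y | x y. True} \<subseteq> R"
  proof (rule complex_vector.span_minimal)
    have "t x y = (\<Sum>(x, y)\<leftarrow>[(x, y)]. t x y)" for x y by simp
    then show "{t x y | x y. True} \<subseteq> R" unfolding R_def by blast
    have "0 = (\<Sum>(x, y)\<leftarrow>[]. t x y)" by simp
    then have "0 \<in> R" unfolding R_def by blast
    moreover have "v + w \<in> R" if vw: "v \<in> R" "w \<in> R" for v w
    proof -
      obtain ps qs where "v = (\<Sum>(x, y)\<leftarrow>ps. t x y)" "w = (\<Sum>(x, y)\<leftarrow>qs. t x y)"
        using vw unfolding R_def by blast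
      then have "v + w = (\<Sum>(x, y)\<leftarrow>ps @ qs. t x y)" by simp
      then show ?thesis unfolding R_def by blast
    qed
    moreover have "c *\<^sub>C v \<in> R" if v: "v \<in> R" for c v
    proof -
      obtain ps where ps: "v = (\<Sum>(x, y)\<leftarrow>ps. t x y)" using v unfolding R_def by blast
      have "c *\<^sub>C v = (\<Sum>(x, y)\<leftarrow>map (apfst (scaleC c)) ps. t x y)"
        unfolding ps by (induction ps) (auto simp: tensor_simps scaleC_add_right)
      then show ?thesis unfolding R_def by blast
    qed
    ultimately show "complex_vector.subspace R" by (rule complex_vector.subspaceI)
  qed
  also have "R \<subseteq> {u. norm (ampliation t a *\<^sub>V u) \<le> norm a * norm u}"
  proof -
    have "ampliation t a *\<^sub>V (\<Sum>(x, y)\<leftarrow>ps. t x y) = (\<Sum>(x, y)\<leftarrow>ps. t (a *\<^sub>V x) y)" for ps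
      by (induction ps) (auto simp: ampliation_apply[OF t])
    then show ?thesis unfolding R_def using hilbert_tensor_sum_bound[OF t, of a] by auto
  qed
  finally have "closure (cspan {t x y | x y. True}) \<subseteq>
    {u. norm (ampliation t a *\<^sub>V u) \<le> norm a * norm u}"
    by (rule closure_minimal)
      (intro closed_Collect_le continuous_intros linear_continuous_on bounded_linear_cblinfun_apply)
  then show "norm (ampliation t a *\<^sub>V u) \<le> norm a * norm u"
    using t unfolding hilbert_tensor_def by blast
qed simp

lemma cinner_slice: "cinner (tensor_slice t y *\<^sub>V u) x = cinner u (t x y)"
proof -
  have "bounded_clinear (\<lambda>x. t x y)"
    by (rule bounded_clinearI[of _ "norm y"]) (simp_all add: tensor_simps norm_tensor mult.commute)
  then show ?thesis by (simp add: tensor_slice_def cadjoint_cinner cBlinfun_inverse)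
qed

text \<open>Slices are morphisms of left modules. This is why coefficients built from them respect
  the balancing relation.\<close>

lemma slice_ampliation: "tensor_slice t y *\<^sub>V ampliation t a *\<^sub>V u = a *\<^sub>V tensor_slice t y *\<^sub>V u"
proof (rule cinner_right_eqI)
  fix x
  have "cinner (tensor_slice t y *\<^sub>V ampliation t a *\<^sub>V u) x = cinner u (ampliation t (cadjoint a) *\<^sub>V t x y)"
    by (simp add: cinner_slice cinner_cadjoint flip: cadjoint_ampliation)
  also have "\<dots> = cinner (a *\<^sub>V tensor_slice t y *\<^sub>V u) x"
    by (simp add: ampliation_apply[OF t] cinner_cadjoint flip: cinner_slice)
  finally show "cinner (tensor_slice t y *\<^sub>V ampliation t a *\<^sub>V u) x =
    cinner (a *\<^sub>V tensor_slice t y *\<^sub>V u) x" .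
qed

lemma slice_index_simps:
  "tensor_slice t (y + y') *\<^sub>V u = tensor_slice t y *\<^sub>V u + tensor_slice t y' *\<^sub>V u"
  "tensor_slice t (c *\<^sub>C y) *\<^sub>V u = cnj c *\<^sub>C tensor_slice t y *\<^sub>V u"
  by (rule cinner_right_eqI;
      simp add: cinner_slice cinner_add_left cinner_add_right cinner_scaleC_left
        cinner_scaleC_right tensor_simps)+

text \<open>Pairing with \<open>t x y\<close> amounts to pairing the slice at \<open>y\<close> with
  \<open>x\<close>, so the slices determine the vector.\<close>

lemma ampliation_fixes:
  assumes "\<And>y. a *\<^sub>V tensor_slice t y *\<^sub>V u = tensor_slice t y *\<^sub>V u"
  shows "ampliation t a *\<^sub>V u = u"
proof (rule tensor_eqI)
  fix x y
  have "cinner (ampliation t a *\<^sub>V u) (t x y) = cinner u (t x y)"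
    by (simp add: slice_ampliation assms flip: cinner_slice)
  then show "cinner (t x y) (ampliation t a *\<^sub>V u) = cinner (t x y) u"
    by (metis cinner_commute)
qed

section \<open>Vectors of finite support\<close>

lemma finite_support_add:
  assumes "finite_support t u" "finite_support t v"
  shows "finite_support t (u + v)"
proof -
  obtain X X' where "finite X" "\<And>y. tensor_slice t y *\<^sub>V u \<in> cspan X"
    "finite X'" "\<And>y. tensor_slice t y *\<^sub>V v \<in> cspan X'"
    using assms unfolding finite_support_def by blast
  then show ?thesis
    unfolding finite_support_def
    by (intro exI[of _ "X \<union> X'"])
      (auto intro!: complex_vector.span_add intro: subsetD[OF complex_vector.span_mono, rotated])
qed

lemma finite_support_scaleC: "finite_support t u \<Longrightarrow> finite_support t (c *\<^sub>C u)"
  unfolding finite_support_def by (auto intro: complex_vector.span_scale)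

lemma finite_support_zero: "finite_support t 0"
  unfolding finite_support_def by (auto intro: complex_vector.span_zero)

lemma finite_support_scaleR: "finite_support t u \<Longrightarrow> finite_support t (r *\<^sub>R u)"
  by (simp add: scaleR_scaleC finite_support_scaleC)

lemma finite_support_ampliation:
  assumes "finite_support t u"
  shows "finite_support t (ampliation t a *\<^sub>V u)"
proof -
  obtain X where X: "finite X" "\<And>y. tensor_slice t y *\<^sub>V u \<in> cspan X"
    using assms unfolding finite_support_def by blast
  have "cspan X \<subseteq> {v. a *\<^sub>V v \<in> cspan (cblinfun_apply a ` X)}"
    by (rule complex_vector.span_minimal)
      (auto simp: complex_vector.subspace_def intro: complex_vector.span_base
        complex_vector.span_add complex_vector.span_scale complex_vector.span_zero)
  then show ?thesis
    using X unfolding finite_support_def slice_ampliation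
    by (intro exI[of _ "cblinfun_apply a ` X"]) auto
qed

lemma finite_support_dense: "closure {u. finite_support t u} = UNIV"
proof -
  have "tensor_slice t y' *\<^sub>V t x y = cinner y' y *\<^sub>C x" for x y y'
    by (rule cinner_right_eqI)
      (use cinner_commute[of y y'] in \<open>simp add: cinner_slice tensor_simps cinner_scaleC_left mult.commute\<close>)
  then have "finite_support t (t x y)" for x y
    unfolding finite_support_def
    by (intro exI[of _ "{x}"]) (auto intro: complex_vector.span_scale complex_vector.span_base)
  then have "cspan {t x y | x y. True} \<subseteq> {u. finite_support t u}"
    by (intro complex_vector.span_minimal)
      (auto simp: complex_vector.subspace_def finite_support_add finite_support_scaleC finite_support_zero)
  then have "closure (cspan {t x y | x y. True}) \<subseteq> closure {u. finite_support t u}"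
    by (rule closure_mono)
  then show ?thesis using t unfolding hilbert_tensor_def by blast
qed

lemma finite_support_eqI:
  assumes "\<And>w. finite_support t w \<Longrightarrow> inner u w = inner v w"
  shows "u = v"
proof -
  have "closure {w. finite_support t w} \<subseteq> {w. inner u w = inner v w}"
    by (rule closure_minimal) (use assms in \<open>auto intro!: closed_Collect_eq continuous_intros\<close>)
  then have "inner u (u - v) = inner v (u - v)" unfolding finite_support_dense by blast
  then have "inner (u - v) (u - v) = 0" by (simp add: inner_diff_left)
  then show ?thesis by simp
qed

text \<open>The vectors of the basis being slices of \<open>u\<close> themselves, a submodule that contains the
  corresponding matrix coefficients contains the compressions to their span.\<close>

lemma slice_basis_exists:
  assumes "finite_support t u"
  obtains E f where "finite E" "corthonormal E" "\<And>e. e \<in> E \<Longrightarrow> tensor_slice t (f e) *\<^sub>V u = e"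
    "ampliation t (span_projection E) *\<^sub>V u = u"
proof -
  obtain X where X: "finite X" "\<And>y. tensor_slice t y *\<^sub>V u \<in> cspan X"
    using assms unfolding finite_support_def by blast
  \<comment> \<open>Slices are conjugate-linear in their index, so the slices of \<open>u\<close>
    are not just a spanning set but a subspace, and an orthonormal basis chosen inside it consists
    of slices.\<close>
  let ?M = "range (\<lambda>y. tensor_slice t y *\<^sub>V u)"
  have "complex_vector.subspace ?M"
  proof (rule complex_vector.subspaceI)
    show "0 \<in> ?M"
      using slice_index_simps(2)[of 0 0 u] by (intro range_eqI[of _ _ "0 *\<^sub>C 0"]) simp
    fix v w c assume "v \<in> ?M" "w \<in> ?M"
    then obtain y y' where y: "v = tensor_slice t y *\<^sub>V u" "w = tensor_slice t y' *\<^sub>V u" by blast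
    show "v + w \<in> ?M"
      unfolding y by (rule range_eqI[of _ _ "y + y'"]) (simp add: slice_index_simps)
    show "c *\<^sub>C v \<in> ?M"
      unfolding y by (rule range_eqI[of _ _ "cnj c *\<^sub>C y"]) (simp add: slice_index_simps)
  qed
  moreover have "?M \<subseteq> cspan X" using X(2) by blast
  ultimately obtain E where E: "finite E" "corthonormal E" "E \<subseteq> ?M"
    "\<And>m. m \<in> ?M \<Longrightarrow> span_projection E *\<^sub>V m = m"
    using orthonormal_basis_exists[OF X(1)] by metis
  have "\<exists>y. tensor_slice t y *\<^sub>V u = e" if "e \<in> E" for e using E(3) that by blast
  then obtain f where "\<And>e. e \<in> E \<Longrightarrow> tensor_slice t (f e) *\<^sub>V u = e" by metis
  moreover have "ampliation t (span_projection E) *\<^sub>V u = u"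
    by (rule ampliation_fixes) (rule E(4)[OF rangeI])
  ultimately show ?thesis using that[of E f] E(1,2) by blast
qed

lemma finite_support_basis:
  assumes "finite_support t u"
  obtains X where "finite X"
    "\<And>P. (\<And>x. x \<in> cspan X \<Longrightarrow> P *\<^sub>V x = x) \<Longrightarrow> ampliation t P *\<^sub>V u = u"
proof -
  obtain X where X: "finite X" "\<And>y. tensor_slice t y *\<^sub>V u \<in> cspan X"
    using assms unfolding finite_support_def by blast
  show ?thesis by (rule that[OF X(1)]) (rule ampliation_fixes, use X(2) in blast)
qed

text \<open>Real linearity and a one-sided bound are what the cone theorem delivers. The bound at
  \<open>-u\<close> makes it two-sided, and testing the representing vector against itself bounds
  its norm.\<close>

lemma finite_support_riesz:
  assumes add: "\<And>u v. finite_support t u \<Longrightarrow> finite_support t v \<Longrightarrow> f (u + v) = f u + f v"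
    and scale: "\<And>r u. finite_support t u \<Longrightarrow> f (r *\<^sub>R u) = r * f u"
    and bound: "\<And>u. finite_support t u \<Longrightarrow> f u \<le> K * norm u"
    and "0 \<le> K"
  obtains v where "\<And>u. finite_support t u \<Longrightarrow> inner v u = f u" "norm v \<le> K"
proof -
  have abs: "norm (f u) \<le> K * norm u" if "finite_support t u" for u
    using bound[OF that] bound[OF finite_support_scaleR[OF that, of "- 1"]] scale[OF that, of "- 1"]
    by (simp add: abs_le_iff)
  obtain F where F: "bounded_linear F" "\<And>u. finite_support t u \<Longrightarrow> F u = f u"
    "\<And>u. norm (F u) \<le> K * norm u"
  proof (rule lipschitz_additive_extension[of "{u. finite_support t u}" f K])
  qed (use finite_support_dense add scale abs in \<open>simp_all add: finite_support_add finite_support_scaleR\<close>)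
  obtain v where v: "\<And>u. F u = inner v u" using riesz_real[OF F(1)] by blast
  have "norm v * norm v \<le> K * norm v"
    using F(3)[of v] v[of v] by (simp flip: power2_norm_eq_inner power2_eq_square)
  then have "norm v \<le> K" using \<open>0 \<le> K\<close> by (cases "v = 0") auto
  then show ?thesis using that[of v] F(2) v by simp
qed

end

section \<open>Modules\<close>

lemma left_moduleD:
  assumes "left_module m"
  shows "m (a + b) u = m a u + m b u" "m a (u + v) = m a u + m a v"
    "m (c *\<^sub>C a) u = c *\<^sub>C m a u" "m a (c *\<^sub>C u) = c *\<^sub>C m a u"
    "m (a o\<^sub>C\<^sub>L b) u = m a (m b u)" "m cblinfun_id u = u"
    "m 0 u = 0" "m a 0 = 0"
proof -
  show *: "m (a + b) u = m a u + m b u" "m a (u + v) = m a u + m a v"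
    "m (c *\<^sub>C a) u = c *\<^sub>C m a u" "m a (c *\<^sub>C u) = c *\<^sub>C m a u"
    "m (a o\<^sub>C\<^sub>L b) u = m a (m b u)" "m cblinfun_id u = u" for a b c u v
    using assms unfolding left_module_def by blast+
  show "m 0 u = 0" "m a 0 = 0"
    using *(3)[of 0 0 u] *(4)[of a 0 0] by simp_all
qed

lemma left_module_sum:
  assumes "left_module m"
  shows "m (\<Sum>i\<in>I. a i) u = (\<Sum>i\<in>I. m (a i) u)" "m b (\<Sum>i\<in>I. v i) = (\<Sum>i\<in>I. m b (v i))"
  by (induction I rule: infinite_finite_induct) (simp_all add: left_moduleD[OF assms])

lemma right_moduleD:
  assumes "right_module m"
  shows "m u (a + b) = m u a + m u b" "m (u + v) a = m u a + m v a"
    "m u (c *\<^sub>C a) = c *\<^sub>C m u a" "m (c *\<^sub>C u) a = c *\<^sub>C m u a"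
    "m u (a o\<^sub>C\<^sub>L b) = m (m u a) b" "m u cblinfun_id = u"
    "m u 0 = 0" "m 0 a = 0"
proof -
  show *: "m u (a + b) = m u a + m u b" "m (u + v) a = m u a + m v a"
    "m u (c *\<^sub>C a) = c *\<^sub>C m u a" "m (c *\<^sub>C u) a = c *\<^sub>C m u a"
    "m u (a o\<^sub>C\<^sub>L b) = m (m u a) b" "m u cblinfun_id = u" for a b c u v
    using assms unfolding right_module_def by blast+
  show "m u 0 = 0" "m 0 a = 0"
    using *(3)[of u 0 0] *(4)[of 0 0 a] by simp_all
qed

lemma right_module_sum:
  assumes "right_module m"
  shows "m u (\<Sum>i\<in>I. a i) = (\<Sum>i\<in>I. m u (a i))" "m (\<Sum>i\<in>I. v i) b = (\<Sum>i\<in>I. m (v i) b)"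
  by (induction I rule: infinite_finite_induct) (simp_all add: right_moduleD[OF assms])

lemma contractive_tensor_left_action:
  assumes "hilbert_tensor t"
  shows "contractive_left_module (tensor_left_action t)"
  unfolding contractive_left_module_def left_module_def tensor_left_action_def
proof (intro conjI allI)
  fix a u
  have "norm (ampliation t a *\<^sub>V u) \<le> norm (ampliation t a) * norm u"
    by (rule norm_cblinfun_apply_le)
  also have "\<dots> \<le> norm a * norm u"
    by (intro mult_right_mono norm_ampliation_le[OF assms]) simp
  finally show "norm (ampliation t a *\<^sub>V u) \<le> norm a * norm u" .
qed (simp_all add: ampliation_add[OF assms] ampliation_scaleC[OF assms]
    ampliation_compose[OF assms] ampliation_id[OF assms])

text \<open>Composition with an isometric map cannot increase the norm, so the inequality opposite
  to the assumed one is automatic.\<close>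

lemma norm_eq_of_isometric_extension:
  assumes "isometric \<alpha>" "\<Psi> o\<^sub>C\<^sub>L \<alpha> = \<Phi>" "norm \<Psi> \<le> norm \<Phi>"
  shows "norm \<Psi> = norm \<Phi>"
proof -
  have "norm \<alpha> \<le> 1"
    by (rule norm_cblinfun_leI) (use assms(1) in \<open>simp_all add: isometric_def\<close>)
  then have "norm \<Phi> \<le> norm \<Psi>"
    using norm_compose_le[of \<Psi> \<alpha>] assms(2) mult_left_mono[of "norm \<alpha>" 1 "norm \<Psi>"] by simp
  then show ?thesis using assms(3) by simp
qed

section \<open>Injectivity of one-sided modules\<close>

text \<open>The maps that factor through the tensor product over B(L) of the dual of L \<otimes> H
  with the module. An operator crosses to \<eta> as its adjoint because \<eta> stands for a
  functional. The values lie in any real vector space, so that coefficient matrices and real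
  functionals are both instances.\<close>

definition left_balanced ::
  "('l::chilbert_space \<Rightarrow> 'h::chilbert_space \<Rightarrow> 't::chilbert_space) \<Rightarrow>
    (('l \<Rightarrow>\<^sub>C\<^sub>L 'l) \<Rightarrow> 'z::complex_vector \<Rightarrow> 'z) \<Rightarrow> ('t \<Rightarrow> 'z \<Rightarrow> 'n::real_vector) \<Rightarrow> bool"
  where "left_balanced t m F \<longleftrightarrow>
    (\<forall>\<eta> \<eta>' z. F (\<eta> + \<eta>') z = F \<eta> z + F \<eta>' z) \<and> (\<forall>\<eta> z z'. F \<eta> (z + z') = F \<eta> z + F \<eta> z') \<and>
    (\<forall>r \<eta> z. F (r *\<^sub>R \<eta>) z = r *\<^sub>R F \<eta> z) \<and> (\<forall>r \<eta> z. F \<eta> (r *\<^sub>R z) = r *\<^sub>R F \<eta> z) \<and>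
    (\<forall>a \<eta> z. F \<eta> (m a z) = F (ampliation t (cadjoint a) *\<^sub>V \<eta>) z)"

lemma left_balancedD:
  assumes "left_balanced t m F"
  shows "F (\<eta> + \<eta>') z = F \<eta> z + F \<eta>' z" "F \<eta> (z + z') = F \<eta> z + F \<eta> z'"
    "F (r *\<^sub>R \<eta>) z = r *\<^sub>R F \<eta> z" "F \<eta> (r *\<^sub>R z) = r *\<^sub>R F \<eta> z"
    "F \<eta> (m a z) = F (ampliation t (cadjoint a) *\<^sub>V \<eta>) z" "F 0 z = 0" "F \<eta> 0 = 0"
proof -
  show *: "F (\<eta> + \<eta>') z = F \<eta> z + F \<eta>' z" "F \<eta> (z + z') = F \<eta> z + F \<eta> z'"
    "F (r *\<^sub>R \<eta>) z = r *\<^sub>R F \<eta> z" "F \<eta> (r *\<^sub>R z) = r *\<^sub>R F \<eta> z"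
    "F \<eta> (m a z) = F (ampliation t (cadjoint a) *\<^sub>V \<eta>) z" for a r \<eta> \<eta>' z z'
    using assms unfolding left_balanced_def by blast+
  show "F 0 z = 0" "F \<eta> 0 = 0" using *(3)[of 0 0 z] *(4)[of \<eta> 0 0] by simp_all
qed

text \<open>With a unit vector \<open>e\<close>, this is the matrix \<open>(e \<otimes> \<eta>\<^sub>h\<^sup>*) \<cdot> z\<close> indexed by \<open>h\<close>, where \<open>\<eta>\<^sub>h\<close> is
  the slice of \<open>\<eta>\<close>; it represents \<open>\<eta>\<^sup>* \<otimes> z\<close> in the tensor product over \<open>\<B>(L)\<close> of the dual of
  \<open>L \<otimes> H\<close> with the module.\<close>

definition left_coeff ::
  "'l \<Rightarrow> ('l::chilbert_space \<Rightarrow> 'h::chilbert_space \<Rightarrow> 't::chilbert_space) \<Rightarrow>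
    (('l \<Rightarrow>\<^sub>C\<^sub>L 'l) \<Rightarrow> 'z \<Rightarrow> 'z) \<Rightarrow> 't \<Rightarrow> 'z \<Rightarrow> 'h \<Rightarrow> 'z"
  where "left_coeff e t m \<eta> z = (\<lambda>h. m (rank1 e (tensor_slice t h *\<^sub>V \<eta>)) z)"

lemma left_balanced_coeff:
  fixes m :: "('l::chilbert_space \<Rightarrow>\<^sub>C\<^sub>L 'l) \<Rightarrow> 'z::complex_vector \<Rightarrow> 'z"
  assumes "hilbert_tensor t" "left_module m"
  shows "left_balanced t m (left_coeff e t m)"
  unfolding left_balanced_def left_coeff_def fun_eq_iff plus_fun_apply scaleR_fun_apply
  by (simp add: rank1_add_right left_moduleD[OF assms(2)] scaleR_scaleC rank1_scaleC_right
      slice_ampliation[OF assms(1)] flip: left_moduleD(5)[OF assms(2)] rank1_compose)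

text \<open>Complex scalars can be moved from \<open>z\<close> to \<eta>. This recovers complex
  homogeneity at the end, although the cone theorem only yields a real-linear functional.\<close>

lemma left_coeff_scaleC:
  assumes "left_module m"
  shows "left_coeff e t m \<eta> (c *\<^sub>C z) = left_coeff e t m (cnj c *\<^sub>C \<eta>) z"
  unfolding left_coeff_def fun_eq_iff
  by (simp add: left_moduleD[OF assms] rank1_scaleC_right)

lemma left_balanced_morphism:
  assumes "hilbert_tensor t" "left_morphism m (tensor_left_action t) \<Phi>"
  shows "left_balanced t m (\<lambda>\<eta> y. inner \<eta> (\<Phi> *\<^sub>V y))"
  using assms(2)
  by (simp add: left_balanced_def left_morphism_def tensor_left_action_def inner_add_left
      inner_add_right inner_cadjoint flip: cadjoint_ampliation[OF assms(1)])

lemma left_coeff_morphism: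
  assumes "left_morphism mY mZ \<alpha>"
  shows "left_coeff e t mZ \<eta> (\<alpha> *\<^sub>V y) h = \<alpha> *\<^sub>V left_coeff e t mY \<eta> y h"
  using assms by (simp add: left_coeff_def left_morphism_def)

text \<open>The product of \<open>rank1 x e\<close> and \<open>rank1 e x\<close> is
  \<open>rank1 x x\<close>, so the coefficients at the indices whose slices are the basis vectors
  rebuild the compression. If they come from a submodule, so does the compression.\<close>

lemma compression_eq_sum_coeff:
  fixes m :: "('l::chilbert_space \<Rightarrow>\<^sub>C\<^sub>L 'l) \<Rightarrow> 'z::complex_vector \<Rightarrow> 'z"
  assumes m: "left_module m" and e: "cinner e e = 1"
    and f: "\<And>x. x \<in> E \<Longrightarrow> tensor_slice t (f x) *\<^sub>V \<eta> = x"
  shows "m (span_projection E) z = (\<Sum>x\<in>E. m (rank1 x e) (left_coeff e t m \<eta> z (f x)))"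
proof -
  have "rank1 x e o\<^sub>C\<^sub>L rank1 e x = rank1 x x" for x :: 'l
    by (simp add: compose_rank1 e scaleC_one)
  then show ?thesis
    unfolding span_projection_def left_module_sum[OF m] left_coeff_def
    by (intro sum.cong) (simp_all add: f flip: left_moduleD(5)[OF m])
qed

text \<open>The projection is self-adjoint, crosses to \<eta> and is absorbed there.\<close>

lemma left_balanced_compression:
  assumes F: "left_balanced t m F" and E: "finite E" "corthonormal E"
    and fixed: "ampliation t (span_projection E) *\<^sub>V \<eta> = \<eta>"
  shows "F \<eta> (m (span_projection E) z) = F \<eta> z"
  using projection_span_projection[OF E] fixed by (simp add: left_balancedD(5)[OF F] projection_def)

text \<open>A vanishing coefficient matrix makes the compression of \<open>y\<close> vanish, and a
  balanced map sees nothing but the compression. Hence the matrix represents the tensor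
  faithfully.\<close>

lemma left_balanced_zero:
  assumes t: "hilbert_tensor t" and m: "left_module m" and F: "left_balanced t m F"
    and e: "cinner e e = 1" and \<eta>: "finite_support t \<eta>" and 0: "left_coeff e t m \<eta> y = 0"
  shows "F \<eta> y = 0"
proof -
  obtain E f where E: "finite E" "corthonormal E" "\<And>x. x \<in> E \<Longrightarrow> tensor_slice t (f x) *\<^sub>V \<eta> = x"
    "ampliation t (span_projection E) *\<^sub>V \<eta> = \<eta>"
    using slice_basis_exists[OF t \<eta>] by metis
  have "F \<eta> y = F \<eta> (m (span_projection E) y)"
    by (rule left_balanced_compression[OF F E(1,2,4), symmetric])
  also have "m (span_projection E) y = (\<Sum>x\<in>E. m (rank1 x e) (left_coeff e t m \<eta> y (f x)))"
    by (rule compression_eq_sum_coeff[OF m e E(3)])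
  also have "\<dots> = 0" by (simp add: 0 left_moduleD[OF m])
  finally show ?thesis by (simp add: left_balancedD[OF F])
qed

section \<open>Adding tensors by moving them to orthogonal supports\<close>

lemma duplicating_two:
  fixes t :: "'l::chilbert_space \<Rightarrow> 'h::chilbert_space \<Rightarrow> 't::chilbert_space"
  assumes inf: "infinite_dimensional TYPE('l)" and t: "hilbert_tensor t"
    and "finite_support t \<eta>" "finite_support t \<eta>'"
  obtains S T P where "duplicating S T P" "ampliation t P *\<^sub>V \<eta> = \<eta>" "ampliation t P *\<^sub>V \<eta>' = \<eta>'"
proof -
  obtain X where X: "finite X"
    "\<And>P. (\<And>x. x \<in> cspan X \<Longrightarrow> P *\<^sub>V x = x) \<Longrightarrow> ampliation t P *\<^sub>V \<eta> = \<eta>"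
    using finite_support_basis[OF t assms(3)] by metis
  obtain X' where X': "finite X'"
    "\<And>P. (\<And>x. x \<in> cspan X' \<Longrightarrow> P *\<^sub>V x = x) \<Longrightarrow> ampliation t P *\<^sub>V \<eta>' = \<eta>'"
    using finite_support_basis[OF t assms(4)] by metis
  have sub: "cspan X \<subseteq> cspan (X \<union> X')" "cspan X' \<subseteq> cspan (X \<union> X')"
    by (intro complex_vector.span_mono; blast)+
  obtain S T P where "duplicating S T P" "\<And>x. x \<in> cspan (X \<union> X') \<Longrightarrow> P *\<^sub>V x = x"
    using duplicating_exists[OF inf, of "X \<union> X'"] X(1) X'(1) by auto
  then show ?thesis using that X(2) X'(2) sub by (meson subsetD)
qed

text \<open>After S and T have crossed to the other factor, the mixed products vanish and the pure
  ones are \<open>P\<close>, which fixes both vectors. Thus a sum of two elementary tensors is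
  elementary.\<close>

lemma left_balanced_direct_sum:
  assumes t: "hilbert_tensor t" and F: "left_balanced t m F" and ST: "duplicating S T P"
    and fixed: "ampliation t P *\<^sub>V \<eta> = \<eta>" "ampliation t P *\<^sub>V \<eta>' = \<eta>'"
  shows "F (ampliation t S *\<^sub>V \<eta> + ampliation t T *\<^sub>V \<eta>') (m S z + m T z') = F \<eta> z + F \<eta>' z'"
proof -
  have amp: "ampliation t a *\<^sub>V ampliation t b *\<^sub>V u = ampliation t (a o\<^sub>C\<^sub>L b) *\<^sub>V u" for a b u
    by (simp add: ampliation_compose[OF t])
  show ?thesis
    by (simp add: left_balancedD(2,5)[OF F] amp duplicatingD[OF ST] fixed ampliation_zero[OF t])
qed

lemma norm_ampliation_direct_sum:
  assumes t: "hilbert_tensor t" and ST: "duplicating S T P"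
    and fixed: "ampliation t P *\<^sub>V \<eta> = \<eta>" "ampliation t P *\<^sub>V \<eta>' = \<eta>'"
  shows "(norm (ampliation t S *\<^sub>V \<eta> + ampliation t T *\<^sub>V \<eta>'))\<^sup>2 = (norm \<eta>)\<^sup>2 + (norm \<eta>')\<^sup>2"
proof -
  have amp: "inner (ampliation t a *\<^sub>V u) (ampliation t b *\<^sub>V v) =
    inner u (ampliation t (cadjoint a o\<^sub>C\<^sub>L b) *\<^sub>V v)" for a b u v
    using inner_cadjoint[of "ampliation t (cadjoint a)" u "ampliation t b *\<^sub>V v"]
    by (simp add: ampliation_compose[OF t] cadjoint_ampliation[OF t])
  show ?thesis
    by (simp add: power2_norm_eq_inner inner_add_left inner_add_right amp duplicatingD[OF ST] fixed
        ampliation_zero[OF t])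
qed

lemma contraction_left_module:
  assumes "contractive_left_module m" "norm a \<le> 1"
  shows "norm (m a z) \<le> norm z"
proof -
  have "norm (m a z) \<le> norm a * norm z"
    using assms(1) by (simp add: contractive_left_module_def)
  also have "\<dots> \<le> 1 * norm z" by (intro mult_right_mono assms(2)) simp
  finally show ?thesis by simp
qed

text \<open>The range projections of S and T are orthogonal left supports of the two summands, and
  the operators themselves are contractions.\<close>

lemma left_semi_ruan_direct_sum:
  assumes m: "left_semi_ruan m" and ST: "duplicating S T P"
  shows "(norm (m S z + m T z'))\<^sup>2 \<le> (norm z)\<^sup>2 + (norm z')\<^sup>2"
proof -
  have c: "contractive_left_module m" and m': "left_module m"
    using m by (simp_all add: left_semi_ruan_def contractive_left_module_def)
  have "left_support m (S o\<^sub>C\<^sub>L cadjoint S) (m S z)" "left_support m (T o\<^sub>C\<^sub>L cadjoint T) (m T z')"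
    by (simp_all add: left_support_def duplicatingD[OF ST] flip: left_moduleD(5)[OF m'])
  then have "norm (m S z + m T z') \<le> sqrt ((norm (m S z))\<^sup>2 + (norm (m T z'))\<^sup>2)"
    using m duplicatingD(12)[OF ST] unfolding left_semi_ruan_def by blast
  then have "(norm (m S z + m T z'))\<^sup>2 \<le> (sqrt ((norm (m S z))\<^sup>2 + (norm (m T z'))\<^sup>2))\<^sup>2"
    by (intro power_mono) simp_all
  also have "\<dots> = (norm (m S z))\<^sup>2 + (norm (m T z'))\<^sup>2" by simp
  also have "\<dots> \<le> (norm z)\<^sup>2 + (norm z')\<^sup>2"
    by (intro add_mono power_mono contraction_left_module[OF c] duplicatingD(8,9)[OF ST]) simp_all
  finally show ?thesis .
qed

text \<open>Passage from a bound by half a sum of squares to a bound by a product. The weights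
  \<open>s\<close> and \<open>inverse s\<close> leave the quantity unchanged, and
  \<open>s = sqrt (b / a)\<close> makes both squares equal to \<open>a * b\<close>; if a factor is
  zero, no such weight exists and the bound is assumed.\<close>

lemma le_of_scaled_le:
  fixes G :: "real \<Rightarrow> real \<Rightarrow> real"
  assumes hom: "\<And>s. s > 0 \<Longrightarrow> G s (inverse s) = g" and zero: "a = 0 \<or> b = 0 \<Longrightarrow> g \<le> 0"
    and le: "\<And>s r. s > 0 \<Longrightarrow> r > 0 \<Longrightarrow> G s r \<le> c / 2 * ((s * a)\<^sup>2 + (r * b)\<^sup>2)"
    and "0 \<le> a" "0 \<le> b"
  shows "g \<le> c * (a * b)"
proof (cases "a = 0 \<or> b = 0")
  case False
  then have "0 < a" "0 < b" using assms(4,5) by auto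
  define s where "s = sqrt (b / a)"
  have s: "0 < s" "s\<^sup>2 = b / a" using \<open>0 < a\<close> \<open>0 < b\<close> by (simp_all add: s_def)
  have "g \<le> c / 2 * ((s * a)\<^sup>2 + (inverse s * b)\<^sup>2)"
    using le[of s "inverse s"] hom[of s] s(1) by simp
  moreover have "(s * a)\<^sup>2 = a * b" "(inverse s * b)\<^sup>2 = a * b"
    using \<open>0 < a\<close> \<open>0 < b\<close> by (simp_all add: power_mult_distrib power_inverse s(2) power2_eq_square[of a]
      power2_eq_square[of b])
  ultimately show ?thesis by simp
qed (use zero in auto)

theorem esr_injective_tensor_left_action:
  fixes t :: "'l::chilbert_space \<Rightarrow> 'h::chilbert_space \<Rightarrow> 't::chilbert_space"
  assumes inf: "infinite_dimensional TYPE('l)" and t: "hilbert_tensor t"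
  shows "esr_injective_left TYPE('y::complex_normed_vector) TYPE('z::complex_normed_vector)
    (tensor_left_action t)"
  unfolding esr_injective_left_def
proof (intro conjI allI impI)
  show "contractive_left_module (tensor_left_action t)"
    by (rule contractive_tensor_left_action[OF t])
next
  fix mY :: "('l \<Rightarrow>\<^sub>C\<^sub>L 'l) \<Rightarrow> 'y \<Rightarrow> 'y" and mZ :: "('l \<Rightarrow>\<^sub>C\<^sub>L 'l) \<Rightarrow> 'z \<Rightarrow> 'z"
    and \<alpha> :: "'y \<Rightarrow>\<^sub>C\<^sub>L 'z" and \<Phi> :: "'y \<Rightarrow>\<^sub>C\<^sub>L 't"
  assume "left_semi_ruan mY \<and> left_semi_ruan mZ \<and> left_morphism mY mZ \<alpha> \<and> isometric \<alpha> \<and>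
    left_morphism mY (tensor_left_action t) \<Phi>"
  then have Y: "left_semi_ruan mY" and Z: "left_semi_ruan mZ" and \<alpha>: "left_morphism mY mZ \<alpha>"
    "isometric \<alpha>" and \<Phi>: "left_morphism mY (tensor_left_action t) \<Phi>" by blast+
  have mY: "left_module mY" and mZ: "left_module mZ" and cZ: "contractive_left_module mZ"
    using Y Z by (simp_all add: left_semi_ruan_def contractive_left_module_def)
  \<comment> \<open>The empty orthonormal set already yields a unit vector.\<close>
  obtain e :: 'l where e: "cinner e e = 1"
    using inf unfolding infinite_dimensional_def corthonormal_def by blast
  define \<gamma> where "\<gamma> = left_coeff e t mZ"
  define \<beta> where "\<beta> \<eta> y = inner \<eta> (\<Phi> *\<^sub>V y)" for \<eta> y
  define c where "c = norm \<Phi>"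
  have "0 \<le> c" by (simp add: c_def)
  have \<gamma>: "left_balanced t mZ \<gamma>" unfolding \<gamma>_def by (rule left_balanced_coeff[OF t mZ])
  have \<beta>: "left_balanced t mY \<beta>"
    using left_balanced_morphism[OF t \<Phi>] by (simp add: \<beta>_def[abs_def])
  have \<gamma>\<alpha>: "left_balanced t mY (\<lambda>\<eta> y. \<gamma> \<eta> (\<alpha> *\<^sub>V y))"
    using \<gamma> \<alpha>(1) by (simp add: left_balanced_def left_morphism_def)
  note \<gamma>_simps = left_balancedD[OF \<gamma>] and \<beta>_simps = left_balancedD[OF \<beta>]
  \<comment> \<open>As \<alpha> is isometric, a coefficient over Y vanishes as soon as its image
    over Z does.\<close>
  have \<beta>_zero: "\<beta> \<eta> y = 0" if "finite_support t \<eta>" "\<gamma> \<eta> (\<alpha> *\<^sub>V y) = 0" for \<eta> y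
  proof (rule left_balanced_zero[OF t mY \<beta> e that(1)])
    have "left_coeff e t mY \<eta> y h = 0" for h
    proof -
      have "norm (left_coeff e t mY \<eta> y h) = norm (\<alpha> *\<^sub>V left_coeff e t mY \<eta> y h)"
        using \<alpha>(2) by (simp add: isometric_def)
      also have "\<dots> = 0"
        using that(2) left_coeff_morphism[OF \<alpha>(1), of e t \<eta> y h] by (simp add: \<gamma>_def)
      finally show ?thesis by simp
    qed
    then show "left_coeff e t mY \<eta> y = 0" by (simp add: fun_eq_iff)
  qed
  \<comment> \<open>A member records a tensor over Z charged with at least its cost, plus a tensor
    over Y charged with the exact value of \<beta>. The latter tensors can be negated together with
    their charge, so a functional below all charges must agree with \<beta> on them.\<close>
  define C where "C = {(\<gamma> \<eta> z + \<gamma> \<eta>' (\<alpha> *\<^sub>V y), r + \<beta> \<eta>' y) | \<eta> z \<eta>' y r.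
    finite_support t \<eta> \<and> finite_support t \<eta>' \<and> c / 2 * ((norm \<eta>)\<^sup>2 + (norm z)\<^sup>2) \<le> r}"
  have C_I: "(u, q) \<in> C"
    if "finite_support t \<eta>" "finite_support t \<eta>'" "c / 2 * ((norm \<eta>)\<^sup>2 + (norm z)\<^sup>2) \<le> r"
      "u = \<gamma> \<eta> z + \<gamma> \<eta>' (\<alpha> *\<^sub>V y)" "q = r + \<beta> \<eta>' y" for \<eta> \<eta>' z y r u q
    unfolding C_def using that by blast
  have C_E: thesis if "p \<in> C" "\<And>\<eta> \<eta>' z y r. finite_support t \<eta> \<Longrightarrow> finite_support t \<eta>' \<Longrightarrow>
      c / 2 * ((norm \<eta>)\<^sup>2 + (norm z)\<^sup>2) \<le> r \<Longrightarrow>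
      p = (\<gamma> \<eta> z + \<gamma> \<eta>' (\<alpha> *\<^sub>V y), r + \<beta> \<eta>' y) \<Longrightarrow> thesis" for p thesis
    using that unfolding C_def by blast
  note fs = finite_support_add[OF t] finite_support_scaleR[OF t] finite_support_zero[OF t]
    finite_support_ampliation[OF t]
  \<comment> \<open>The crux is that the charges are consistent: if the two tensors cancel, then the
    tensor over Z comes from Y, with a representative \<open>w\<close> no longer than
    \<open>z\<close>.\<close>
  have nonneg: "- \<beta> \<eta>' y \<le> c / 2 * ((norm \<eta>)\<^sup>2 + (norm z)\<^sup>2)"
    if fs: "finite_support t \<eta>" "finite_support t \<eta>'" and 0: "\<gamma> \<eta> z + \<gamma> \<eta>' (\<alpha> *\<^sub>V y) = 0" for \<eta> \<eta>' z y
  proof -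
    obtain E f where E: "finite E" "corthonormal E"
      "\<And>x. x \<in> E \<Longrightarrow> tensor_slice t (f x) *\<^sub>V \<eta> = x" "ampliation t (span_projection E) *\<^sub>V \<eta> = \<eta>"
      using slice_basis_exists[OF t fs(1)] by metis
    \<comment> \<open>The coefficients of \<open>z\<close> are the images of minus those of
      \<open>y\<close>, so the formula that rebuilds the compression of \<open>z\<close> can be
      evaluated inside Y.\<close>
    define w where "w = (\<Sum>x\<in>E. mY (rank1 x e) (- left_coeff e t mY \<eta>' y (f x)))"
    have "\<gamma> \<eta> z h = \<alpha> *\<^sub>V (- left_coeff e t mY \<eta>' y h)" for h
      using fun_cong[OF 0, of h] left_coeff_morphism[OF \<alpha>(1), of e t \<eta>' y h]
      by (simp add: \<gamma>_def eq_neg_iff_add_eq_0)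
    then have "\<alpha> *\<^sub>V w = (\<Sum>x\<in>E. mZ (rank1 x e) (\<gamma> \<eta> z (f x)))"
      using \<alpha>(1) by (simp add: w_def left_morphism_def del: cblinfun_apply_linear(3))
    also have "\<dots> = mZ (span_projection E) z"
      unfolding \<gamma>_def by (rule compression_eq_sum_coeff[OF mZ e E(3), symmetric])
    finally have w: "\<alpha> *\<^sub>V w = mZ (span_projection E) z" .
    have "norm w = norm (mZ (span_projection E) z)"
      using \<alpha>(2) by (simp add: isometric_def flip: w)
    also have "\<dots> \<le> norm z"
      using projection_span_projection[OF E(1,2)]
      by (intro contraction_left_module[OF cZ] norm_le_one_of_projection) (simp add: projection_def)
    finally have norm_w: "norm w \<le> norm z" .
    have "\<gamma> \<eta> (\<alpha> *\<^sub>V w) = \<gamma> \<eta> z"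
      unfolding w by (rule left_balanced_compression[OF \<gamma> E(1,2,4)])
    \<comment> \<open>\<open>\<beta>_zero\<close> speaks of a single elementary tensor, so those of
      \<open>w\<close> and \<open>y\<close> are merged into one.\<close>
    obtain S T P where ST: "duplicating S T P"
      "ampliation t P *\<^sub>V \<eta> = \<eta>" "ampliation t P *\<^sub>V \<eta>' = \<eta>'"
      using duplicating_two[OF inf t fs] by blast
    define \<eta>3 where "\<eta>3 = ampliation t S *\<^sub>V \<eta> + ampliation t T *\<^sub>V \<eta>'"
    define y3 where "y3 = mY S w + mY T y"
    have "\<gamma> \<eta>3 (\<alpha> *\<^sub>V y3) = \<gamma> \<eta> (\<alpha> *\<^sub>V w) + \<gamma> \<eta>' (\<alpha> *\<^sub>V y)"
      unfolding \<eta>3_def y3_def by (rule left_balanced_direct_sum[OF t \<gamma>\<alpha> ST])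
    also have "\<dots> = 0" using 0 \<open>\<gamma> \<eta> (\<alpha> *\<^sub>V w) = \<gamma> \<eta> z\<close> by simp
    finally have "\<beta> \<eta>3 y3 = 0" by (intro \<beta>_zero) (simp_all add: \<eta>3_def finite_support_add[OF t]
        finite_support_ampliation[OF t] fs)
    moreover have "\<beta> \<eta>3 y3 = \<beta> \<eta> w + \<beta> \<eta>' y"
      unfolding \<eta>3_def y3_def by (rule left_balanced_direct_sum[OF t \<beta> ST])
    ultimately have "- \<beta> \<eta>' y = \<beta> \<eta> w" by simp
    also have "\<dots> \<le> norm \<eta> * norm (\<Phi> *\<^sub>V w)"
      unfolding \<beta>_def by (rule norm_cauchy_schwarz)
    also have "\<dots> \<le> norm \<eta> * (c * norm z)"
      unfolding c_def using norm_w
      by (intro mult_left_mono order_trans[OF norm_cblinfun_apply_le]) simp_all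
    also have "\<dots> = c / 2 * (2 * norm \<eta> * norm z)" by simp
    also have "\<dots> \<le> c / 2 * ((norm \<eta>)\<^sup>2 + (norm z)\<^sup>2)"
      using \<open>0 \<le> c\<close> by (intro mult_left_mono sum_squares_bound) simp
    finally show ?thesis .
  qed
  have C: "nonneg_cone C"
    unfolding nonneg_cone_def
  proof (intro conjI ballI allI impI)
    show "0 \<in> C"
      unfolding zero_prod_def
      by (rule C_I[of 0 0 0 0 _ 0]) (simp_all add: fs \<gamma>_simps \<beta>_simps)
  next
    fix p q assume "p \<in> C" "q \<in> C"
    then obtain \<eta>1 \<eta>1' z1 y1 r1 \<eta>2 \<eta>2' z2 y2 r2 where fs1: "finite_support t \<eta>1" "finite_support t \<eta>1'"
      and fs2: "finite_support t \<eta>2" "finite_support t \<eta>2'"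
      and r: "c / 2 * ((norm \<eta>1)\<^sup>2 + (norm z1)\<^sup>2) \<le> r1" "c / 2 * ((norm \<eta>2)\<^sup>2 + (norm z2)\<^sup>2) \<le> r2"
      and p: "p = (\<gamma> \<eta>1 z1 + \<gamma> \<eta>1' (\<alpha> *\<^sub>V y1), r1 + \<beta> \<eta>1' y1)"
      and q: "q = (\<gamma> \<eta>2 z2 + \<gamma> \<eta>2' (\<alpha> *\<^sub>V y2), r2 + \<beta> \<eta>2' y2)"
      unfolding C_def by blast
    \<comment> \<open>Two unrelated pairs are used: the first merges the tensors over Z and controls
      the cost, the second merges those over Y.\<close>
    obtain S T P where ST: "duplicating S T P"
      "ampliation t P *\<^sub>V \<eta>1 = \<eta>1" "ampliation t P *\<^sub>V \<eta>2 = \<eta>2"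
      using duplicating_two[OF inf t fs1(1) fs2(1)] by blast
    obtain S' T' P' where ST': "duplicating S' T' P'"
      "ampliation t P' *\<^sub>V \<eta>1' = \<eta>1'" "ampliation t P' *\<^sub>V \<eta>2' = \<eta>2'"
      using duplicating_two[OF inf t fs1(2) fs2(2)] by blast
    have "c / 2 * ((norm (ampliation t S *\<^sub>V \<eta>1 + ampliation t T *\<^sub>V \<eta>2))\<^sup>2 +
      (norm (mZ S z1 + mZ T z2))\<^sup>2) \<le>
      c / 2 * ((norm \<eta>1)\<^sup>2 + (norm \<eta>2)\<^sup>2 + ((norm z1)\<^sup>2 + (norm z2)\<^sup>2))"
      unfolding norm_ampliation_direct_sum[OF t ST]
      using \<open>0 \<le> c\<close> by (intro mult_left_mono add_mono left_semi_ruan_direct_sum[OF Z ST(1)]) simp_all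
    also have "\<dots> \<le> r1 + r2" using r by (simp add: algebra_simps)
    finally have "c / 2 * ((norm (ampliation t S *\<^sub>V \<eta>1 + ampliation t T *\<^sub>V \<eta>2))\<^sup>2 +
      (norm (mZ S z1 + mZ T z2))\<^sup>2) \<le> r1 + r2" .
    then show "p + q \<in> C"
      unfolding p q add_Pair
      by (rule C_I[rotated 2, where \<eta>' = "ampliation t S' *\<^sub>V \<eta>1' + ampliation t T' *\<^sub>V \<eta>2'"
            and y = "mY S' y1 + mY T' y2"])
        (simp_all only: fs fs1 fs2 left_balanced_direct_sum[OF t \<gamma> ST]
          left_balanced_direct_sum[OF t \<beta> ST'] left_balanced_direct_sum[OF t \<gamma>\<alpha> ST'] add_ac)
  next
    fix p and s :: real assume "p \<in> C" "0 < s"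
    from this(1) show "s *\<^sub>R p \<in> C"
    proof (rule C_E)
      fix \<eta> \<eta>' z y r assume fs': "finite_support t \<eta>" "finite_support t \<eta>'"
        and r: "c / 2 * ((norm \<eta>)\<^sup>2 + (norm z)\<^sup>2) \<le> r"
        and p: "p = (\<gamma> \<eta> z + \<gamma> \<eta>' (\<alpha> *\<^sub>V y), r + \<beta> \<eta>' y)"
      \<comment> \<open>The cost is quadratic, so the factor \<open>s\<close> is shared as
        \<open>sqrt s\<close> by \<eta> and \<open>z\<close>; over Y it goes to \<eta>'
        alone.\<close>
      have "c / 2 * ((norm (sqrt s *\<^sub>R \<eta>))\<^sup>2 + (norm (sqrt s *\<^sub>R z))\<^sup>2) =
        s * (c / 2 * ((norm \<eta>)\<^sup>2 + (norm z)\<^sup>2))"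
        using \<open>0 < s\<close> by (simp add: power_mult_distrib algebra_simps)
      also have "\<dots> \<le> s * r" using r \<open>0 < s\<close> by simp
      finally show "s *\<^sub>R p \<in> C"
        unfolding p scaleR_Pair using \<open>0 < s\<close>
        by (intro C_I[of "sqrt s *\<^sub>R \<eta>" "s *\<^sub>R \<eta>'" "sqrt s *\<^sub>R z" "s * r" _ y])
          (simp_all add: fs fs' \<gamma>_simps \<beta>_simps algebra_simps)
    qed
  next
    fix r assume "(0, r) \<in> C"
    then show "0 \<le> r"
      by (rule C_E) (use nonneg in fastforce)
  qed
  have "- u \<in> fst ` C" if u: "u \<in> fst ` C" for u
  proof -
    from u obtain p where "p \<in> C" "u = fst p" by blast
    from this(1) show ?thesis
    proof (rule C_E)
      fix \<eta> \<eta>' z y r assume fs': "finite_support t \<eta>" "finite_support t \<eta>'"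
        and p: "p = (\<gamma> \<eta> z + \<gamma> \<eta>' (\<alpha> *\<^sub>V y), r + \<beta> \<eta>' y)"
      \<comment> \<open>The cost depends on norms only, so the sign can be put into \<eta> and
        \<eta>'.\<close>
      have "(\<gamma> (- 1 *\<^sub>R \<eta>) z + \<gamma> (- 1 *\<^sub>R \<eta>') (\<alpha> *\<^sub>V y),
        c / 2 * ((norm (- 1 *\<^sub>R \<eta>))\<^sup>2 + (norm z)\<^sup>2) + \<beta> (- 1 *\<^sub>R \<eta>') y) \<in> C"
        by (rule C_I[OF _ _ order_refl refl refl]) (intro fs fs')+
      then have "\<gamma> (- 1 *\<^sub>R \<eta>) z + \<gamma> (- 1 *\<^sub>R \<eta>') (\<alpha> *\<^sub>V y) \<in> fst ` C" by force
      then have "(- 1) *\<^sub>R u \<in> fst ` C"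
        unfolding \<open>u = fst p\<close> p fst_conv by (simp only: \<gamma>_simps scaleR_add_right)
      then show ?thesis by simp
    qed
  qed
  from nonneg_cone_support[OF C this] obtain g where g: "\<And>u r. (u, r) \<in> C \<Longrightarrow> g u \<le> r"
    "\<And>u v. u \<in> fst ` C \<Longrightarrow> v \<in> fst ` C \<Longrightarrow> g (u + v) = g u + g v"
    "\<And>t u. u \<in> fst ` C \<Longrightarrow> g (t *\<^sub>R u) = t * g u"
    by blast
  have \<gamma>_C: "(\<gamma> \<eta> z, c / 2 * ((norm \<eta>)\<^sup>2 + (norm z)\<^sup>2)) \<in> C" if "finite_support t \<eta>" for \<eta> z
    by (rule C_I[of \<eta> 0 z "c / 2 * ((norm \<eta>)\<^sup>2 + (norm z)\<^sup>2)" _ 0]) (simp_all add: that fs \<gamma>_simps \<beta>_simps)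
  then have dom: "\<gamma> \<eta> z \<in> fst ` C" if "finite_support t \<eta>" for \<eta> z
    using that by force
  have g0: "g 0 = 0" using g(3)[OF dom[OF fs(3)], of 0] by simp
  \<comment> \<open>Membership in \<open>C\<close> bounds every rescaled pair by its cost; the best
    rescaling gives the product of the norms.\<close>
  have g_le: "g (\<gamma> \<eta> z) \<le> c * (norm \<eta> * norm z)" if \<eta>: "finite_support t \<eta>" for \<eta> z
  proof (rule le_of_scaled_le[where G = "\<lambda>s r. g (\<gamma> (s *\<^sub>R \<eta>) (r *\<^sub>R z))"])
    fix s r :: real assume "0 < s" "0 < r"
    then show "g (\<gamma> (s *\<^sub>R \<eta>) (r *\<^sub>R z)) \<le> c / 2 * ((s * norm \<eta>)\<^sup>2 + (r * norm z)\<^sup>2)"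
      using g(1)[OF \<gamma>_C[OF fs(2)[OF \<eta>, of s], of "r *\<^sub>R z"]] by simp
  qed (auto simp: \<gamma>_simps g0)
  have g_\<alpha>: "g (\<gamma> \<eta> (\<alpha> *\<^sub>V y)) = \<beta> \<eta> y" if \<eta>: "finite_support t \<eta>" for \<eta> y
  proof -
    \<comment> \<open>The zero tensor over Z costs nothing, so \<beta> itself is a bound; used also
      at minus \<eta>, it becomes an equality.\<close>
    have le: "g (\<gamma> \<eta> (\<alpha> *\<^sub>V y)) \<le> \<beta> \<eta> y" if "finite_support t \<eta>" for \<eta>
      by (rule g(1)) (rule C_I[of 0 \<eta> 0 0], simp_all add: fs that \<gamma>_simps)
    show ?thesis
      using le[OF \<eta>] le[OF fs(2)[OF \<eta>, of "- 1"]] g(3)[OF dom[OF \<eta>], of "- 1"]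
      by (simp only: \<gamma>_simps \<beta>_simps) simp
  qed
  \<comment> \<open>For fixed \<open>z\<close> the functional is real-linear in \<eta> and bounded
    on a dense subspace; its Riesz vector is the value of the extension at \<open>z\<close>.\<close>
  have "\<exists>v. (\<forall>\<eta>. finite_support t \<eta> \<longrightarrow> inner v \<eta> = g (\<gamma> \<eta> z)) \<and> norm v \<le> c * norm z" for z
  proof (rule finite_support_riesz[OF t, of "\<lambda>\<eta>. g (\<gamma> \<eta> z)" "c * norm z"])
    show "g (\<gamma> \<eta> z) \<le> c * norm z * norm \<eta>" if "finite_support t \<eta>" for \<eta>
      using g_le[OF that, of z] by (simp add: mult_ac)
    show "0 \<le> c * norm z" using \<open>0 \<le> c\<close> by simp
  qed (simp_all only: \<gamma>_simps g(2,3) dom real_scaleR_def, blast)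
  then have "\<forall>z. \<exists>v. (\<forall>\<eta>. finite_support t \<eta> \<longrightarrow> inner v \<eta> = g (\<gamma> \<eta> z)) \<and> norm v \<le> c * norm z"
    by blast
  then obtain \<psi> where "\<forall>z. (\<forall>\<eta>. finite_support t \<eta> \<longrightarrow> inner (\<psi> z) \<eta> = g (\<gamma> \<eta> z)) \<and>
    norm (\<psi> z) \<le> c * norm z"
    by (rule choice[THEN exE])
  then have \<psi>: "\<And>z \<eta>. finite_support t \<eta> \<Longrightarrow> inner (\<psi> z) \<eta> = g (\<gamma> \<eta> z)"
    "\<And>z. norm (\<psi> z) \<le> c * norm z" by simp_all
  have "bounded_clinear \<psi>"
  proof (rule bounded_clinearI)
    show "\<psi> (z + z') = \<psi> z + \<psi> z'" for z z'
      by (rule finite_support_eqI[OF t]) (simp add: \<psi> inner_add_left \<gamma>_simps g dom)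
    show "\<psi> (a *\<^sub>C z) = a *\<^sub>C \<psi> z" for a z
    proof (rule finite_support_eqI[OF t])
      fix \<eta> assume \<eta>: "finite_support t \<eta>"
      \<comment> \<open>The functional \<open>g\<close> is only real-linear, but the scalar can move
        to \<eta> inside the tensor, and the inner product then returns it to the other
        side.\<close>
      have "inner (\<psi> (a *\<^sub>C z)) \<eta> = g (\<gamma> (cnj a *\<^sub>C \<eta>) z)"
        using \<eta> by (simp add: \<psi> \<gamma>_def left_coeff_scaleC[OF mZ])
      also have "\<dots> = inner (\<psi> z) (cnj a *\<^sub>C \<eta>)"
        by (rule \<psi>(1)[symmetric]) (rule finite_support_scaleC[OF t \<eta>])
      also have "\<dots> = inner (a *\<^sub>C \<psi> z) \<eta>"
        by (simp add: cinner_scaleC_left cinner_scaleC_right flip: Re_cinner)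
      finally show "inner (\<psi> (a *\<^sub>C z)) \<eta> = inner (a *\<^sub>C \<psi> z) \<eta>" .
    qed
  qed (rule \<psi>(2))
  then have \<Psi>: "cBlinfun \<psi> *\<^sub>V z = \<psi> z" for z by (simp add: cBlinfun_inverse)
  have "left_morphism mZ (tensor_left_action t) (cBlinfun \<psi>)"
    unfolding left_morphism_def tensor_left_action_def \<Psi>
  proof (intro allI finite_support_eqI[OF t])
    fix a z \<eta> assume \<eta>: "finite_support t \<eta>"
    have "inner (\<psi> (mZ a z)) \<eta> = inner (\<psi> z) (cadjoint (ampliation t a) *\<^sub>V \<eta>)"
      using \<eta> by (simp add: \<psi> \<gamma>_simps fs cadjoint_ampliation[OF t])
    then show "inner (\<psi> (mZ a z)) \<eta> = inner (ampliation t a *\<^sub>V \<psi> z) \<eta>"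
      by (metis inner_cadjoint inner_commute)
  qed
  moreover have ext: "cBlinfun \<psi> o\<^sub>C\<^sub>L \<alpha> = \<Phi>"
  proof (rule cblinfun_eqI)
    fix y
    show "(cBlinfun \<psi> o\<^sub>C\<^sub>L \<alpha>) *\<^sub>V y = \<Phi> *\<^sub>V y"
      by (rule finite_support_eqI[OF t]) (simp add: \<Psi> \<psi> g_\<alpha> \<beta>_def inner_commute[of "\<Phi> *\<^sub>V y"])
  qed
  moreover have "norm (cBlinfun \<psi>) = norm \<Phi>"
    by (intro norm_eq_of_isometric_extension[OF \<alpha>(2) ext], rule norm_cblinfun_leI)
      (simp_all add: \<Psi> \<psi>(2)[unfolded c_def])
  ultimately show "\<exists>\<Psi>. left_morphism mZ (tensor_left_action t) \<Psi> \<and> \<Psi> o\<^sub>C\<^sub>L \<alpha> = \<Phi> \<and> norm \<Psi> = norm \<Phi>"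
    by blast
qed

section \<open>Right modules as left modules over the conjugate space\<close>

lift_definition unconj_op :: "('a::complex_inner conj_space \<Rightarrow>\<^sub>C\<^sub>L 'a conj_space) \<Rightarrow> 'a \<Rightarrow>\<^sub>C\<^sub>L 'a"
  is "\<lambda>a x. from_conj (a (to_conj x))"
proof -
  fix a :: "'a conj_space \<Rightarrow> 'a conj_space" assume a: "bounded_clinear a"
  then interpret bounded_linear a by (simp add: bounded_clinear_def)
  obtain K where K: "\<And>x. norm (a x) \<le> norm x * K" using bounded by blast
  have scale: "a (c *\<^sub>C x) = c *\<^sub>C a x" for c x using a by (simp add: bounded_clinear_def)
  show "bounded_clinear (\<lambda>x. from_conj (a (to_conj x)))"
  proof (rule bounded_clinearI)
    fix x y :: 'a and c
    have "to_conj (x + y) = to_conj x + to_conj y" by (simp add: plus_conj_space.abs_eq)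
    then show "from_conj (a (to_conj (x + y))) = from_conj (a (to_conj x)) + from_conj (a (to_conj y))"
      by (simp add: add plus_conj_space.rep_eq)
    have "to_conj (c *\<^sub>C x) = cnj c *\<^sub>C to_conj x" by (simp add: scaleC_conj_space.abs_eq)
    then show "from_conj (a (to_conj (c *\<^sub>C x))) = c *\<^sub>C from_conj (a (to_conj x))"
      by (simp add: scale scaleC_conj_space.rep_eq)
    show "norm (from_conj (a (to_conj x))) \<le> K * norm x"
      using K[of "to_conj x"]
      by (simp add: norm_conj_space.rep_eq to_conj_inverse mult.commute)
  qed
qed

lemma unconj_op_conj_op [simp]: "unconj_op (conj_op a) = a"
  by (rule cblinfun_eqI) (simp add: unconj_op.rep_eq conj_op.rep_eq to_conj_inverse)

lemma conj_op_unconj_op [simp]: "conj_op (unconj_op a) = a"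
  by (rule cblinfun_eqI) (simp add: unconj_op.rep_eq conj_op.rep_eq from_conj_inverse)

text \<open>An algebra isomorphism of \<open>\<B>(L\<^sup>c)\<close> onto the opposite algebra of \<open>\<B>(L)\<close>, linear because the
  adjoint and the change of scalars are both conjugate-linear.\<close>

definition conj_transpose :: "('a::chilbert_space conj_space \<Rightarrow>\<^sub>C\<^sub>L 'a conj_space) \<Rightarrow> 'a \<Rightarrow>\<^sub>C\<^sub>L 'a"
  where "conj_transpose a = cadjoint (unconj_op a)"

lemma conj_transpose_simps:
  fixes a b :: "'a::chilbert_space conj_space \<Rightarrow>\<^sub>C\<^sub>L 'a conj_space"
  shows "conj_transpose (a + b) = conj_transpose a + conj_transpose b"
  "conj_transpose (c *\<^sub>C a) = c *\<^sub>C conj_transpose a"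
  "conj_transpose (a o\<^sub>C\<^sub>L b) = conj_transpose b o\<^sub>C\<^sub>L conj_transpose a"
  "conj_transpose cblinfun_id = (cblinfun_id :: 'a \<Rightarrow>\<^sub>C\<^sub>L 'a)"
  "conj_transpose (conj_op (cadjoint (d :: 'a \<Rightarrow>\<^sub>C\<^sub>L 'a))) = d"
  "conj_op (cadjoint (conj_transpose a)) = a"
proof -
  have "unconj_op (a + b) = unconj_op a + unconj_op b" for a b :: "'a conj_space \<Rightarrow>\<^sub>C\<^sub>L 'a conj_space"
    by (rule cblinfun_eqI) (simp add: unconj_op.rep_eq plus_conj_space.rep_eq)
  then show "conj_transpose (a + b) = conj_transpose a + conj_transpose b"
    by (simp add: conj_transpose_def cadjoint_add)
  have "unconj_op (c *\<^sub>C a) = cnj c *\<^sub>C unconj_op a" for a :: "'a conj_space \<Rightarrow>\<^sub>C\<^sub>L 'a conj_space"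
    by (rule cblinfun_eqI) (simp add: unconj_op.rep_eq scaleC_conj_space.rep_eq)
  then show "conj_transpose (c *\<^sub>C a) = c *\<^sub>C conj_transpose a"
    by (simp add: conj_transpose_def cadjoint_scaleC)
  have "unconj_op (a o\<^sub>C\<^sub>L b) = unconj_op a o\<^sub>C\<^sub>L unconj_op b" for a b :: "'a conj_space \<Rightarrow>\<^sub>C\<^sub>L 'a conj_space"
    by (rule cblinfun_eqI) (simp add: unconj_op.rep_eq from_conj_inverse)
  then show "conj_transpose (a o\<^sub>C\<^sub>L b) = conj_transpose b o\<^sub>C\<^sub>L conj_transpose a"
    by (simp add: conj_transpose_def cadjoint_compose)
  have "unconj_op cblinfun_id = (cblinfun_id :: 'a \<Rightarrow>\<^sub>C\<^sub>L 'a)"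
    by (rule cblinfun_eqI) (simp add: unconj_op.rep_eq to_conj_inverse)
  then show "conj_transpose cblinfun_id = (cblinfun_id :: 'a \<Rightarrow>\<^sub>C\<^sub>L 'a)"
    by (simp add: conj_transpose_def)
qed (simp_all add: conj_transpose_def)

lemma norm_conj_transpose_le: "norm (conj_transpose a) \<le> norm a"
proof -
  have "norm (unconj_op a) \<le> norm a"
  proof (rule norm_cblinfun_leI)
    show "norm (unconj_op a *\<^sub>V x) \<le> norm a * norm x" for x
      using norm_cblinfun_apply_le[of a "to_conj x"]
      by (simp add: unconj_op.rep_eq norm_conj_space.rep_eq to_conj_inverse)
  qed simp
  then show ?thesis
    unfolding conj_transpose_def using norm_cadjoint_le order_trans by blast
qed

lemma cadjoint_unconj_op: "cadjoint (unconj_op a) = unconj_op (cadjoint a)"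
proof (rule cadjoint_unique)
  fix x y
  have "cinner (to_conj x) (cadjoint a *\<^sub>V to_conj y) = cinner (a *\<^sub>V to_conj x) (to_conj y)"
    by (rule cinner_cadjoint)
  then show "cinner (unconj_op (cadjoint a) *\<^sub>V y) x = cinner y (unconj_op a *\<^sub>V x)"
    by (simp add: unconj_op.rep_eq cinner_conj_space.rep_eq to_conj_inverse)
qed

lemma projection_conj_transpose:
  assumes "projection P"
  shows "projection (conj_transpose P)"
  using assms conj_transpose_simps(3)[of P P]
  by (simp add: projection_def) (simp add: conj_transpose_def cadjoint_unconj_op)

lemma left_semi_ruan_conj:
  fixes m :: "'z::complex_normed_vector \<Rightarrow> ('l::chilbert_space \<Rightarrow>\<^sub>C\<^sub>L 'l) \<Rightarrow> 'z"
  assumes "right_semi_ruan m"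
  shows "left_semi_ruan (\<lambda>a u. m u (conj_transpose a))"
proof -
  have m: "right_module m" and contr: "norm (m u a) \<le> norm u * norm a" for u a
    using assms by (auto simp: right_semi_ruan_def contractive_right_module_def)
  have "norm (m u (conj_transpose a)) \<le> norm a * norm u" for a u
  proof -
    have "norm (m u (conj_transpose a)) \<le> norm u * norm (conj_transpose a)" by (rule contr)
    also have "\<dots> \<le> norm u * norm a" by (intro mult_left_mono norm_conj_transpose_le) simp
    finally show ?thesis by (simp add: mult.commute)
  qed
  then have "contractive_left_module (\<lambda>a u. m u (conj_transpose a))"
    by (simp add: contractive_left_module_def left_module_def conj_transpose_simps right_moduleD[OF m])
  moreover have "norm (u + v) \<le> sqrt ((norm u)\<^sup>2 + (norm v)\<^sup>2)"
    if "left_support (\<lambda>a u. m u (conj_transpose a)) P u" "left_support (\<lambda>a u. m u (conj_transpose a)) Q v"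
      "P o\<^sub>C\<^sub>L Q = 0" for u v P Q
  proof -
    have P: "projection P" "projection Q" using that by (simp_all add: left_support_def)
    \<comment> \<open>\<open>conj_transpose\<close> reverses products, so orthogonality is needed in
      the opposite order; taking adjoints supplies it.\<close>
    have "Q o\<^sub>C\<^sub>L P = cadjoint (P o\<^sub>C\<^sub>L Q)" using P by (simp add: cadjoint_compose projection_def)
    then have "Q o\<^sub>C\<^sub>L P = 0" using that(3) by simp
    then have "conj_transpose P o\<^sub>C\<^sub>L conj_transpose Q = conj_transpose 0"
      by (simp flip: conj_transpose_simps(3))
    also have "\<dots> = 0" using conj_transpose_simps(2)[of 0 0] by simp
    finally have "conj_transpose P o\<^sub>C\<^sub>L conj_transpose Q = 0" .
    moreover have "right_support m (conj_transpose P) u" "right_support m (conj_transpose Q) v"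
      using that P by (simp_all add: left_support_def right_support_def projection_conj_transpose)
    ultimately show ?thesis using assms unfolding right_semi_ruan_def by blast
  qed
  ultimately show ?thesis unfolding left_semi_ruan_def by blast
qed

theorem esr_injective_tensor_right_action:
  fixes t :: "'l::chilbert_space conj_space \<Rightarrow> 'h::chilbert_space \<Rightarrow> 't::chilbert_space"
  assumes inf: "infinite_dimensional TYPE('l)" and t: "hilbert_tensor t"
  shows "esr_injective_right TYPE('y::complex_normed_vector) TYPE('z::complex_normed_vector)
    (tensor_right_action t)"
  unfolding esr_injective_right_def
proof (intro conjI allI impI)
  \<comment> \<open>The right action is the left action on \<open>L\<^sup>c \<otimes> H\<close>
    pulled back along the inverse of \<open>conj_transpose\<close>.\<close>
  have action: "tensor_right_action t u a = tensor_left_action t (conj_op (cadjoint a)) u" for u a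
    by (simp add: tensor_right_action_def tensor_left_action_def)
  have inj: "a = b" if "conj_transpose a = conj_transpose b"
    for a b :: "'l conj_space \<Rightarrow>\<^sub>C\<^sub>L 'l conj_space"
    using arg_cong[OF that, of "\<lambda>d. conj_op (cadjoint d)"] by (simp only: conj_transpose_simps)
  \<comment> \<open>The rules for the inverse follow from those of \<open>conj_transpose\<close> by
    injectivity.\<close>
  have conj_op_simps: "conj_op (cadjoint (a + b)) = conj_op (cadjoint a) + conj_op (cadjoint b)"
    "conj_op (cadjoint (c *\<^sub>C a)) = c *\<^sub>C conj_op (cadjoint a)"
    "conj_op (cadjoint (a o\<^sub>C\<^sub>L b)) = conj_op (cadjoint b) o\<^sub>C\<^sub>L conj_op (cadjoint a)"
    "conj_op (cadjoint cblinfun_id) = (cblinfun_id :: 'l conj_space \<Rightarrow>\<^sub>C\<^sub>L 'l conj_space)" for a b :: "'l \<Rightarrow>\<^sub>C\<^sub>L 'l" and c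
    by (rule inj; simp only: conj_transpose_simps)+
  have norm_conj: "norm (conj_op (cadjoint a)) \<le> norm a" for a :: "'l \<Rightarrow>\<^sub>C\<^sub>L 'l"
  proof (rule norm_cblinfun_leI)
    fix x
    have "norm (cadjoint a *\<^sub>V from_conj x) \<le> norm (cadjoint a) * norm (from_conj x)"
      by (rule norm_cblinfun_apply_le)
    also have "\<dots> \<le> norm a * norm (from_conj x)" by (intro mult_right_mono norm_cadjoint_le) simp
    finally show "norm (conj_op (cadjoint a) *\<^sub>V x) \<le> norm a * norm x"
      by (simp add: conj_op.rep_eq norm_conj_space.rep_eq to_conj_inverse)
  qed simp
  note left = contractive_tensor_left_action[OF t, unfolded contractive_left_module_def]
  note left' = left_moduleD[OF conjunct1[OF left]]
  have "norm (tensor_right_action t u a) \<le> norm u * norm a" for u a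
  proof -
    have "norm (tensor_right_action t u a) \<le> norm (conj_op (cadjoint a)) * norm u"
      unfolding action using left by blast
    also have "\<dots> \<le> norm a * norm u" by (intro mult_right_mono norm_conj) simp
    finally show ?thesis by (simp add: mult.commute)
  qed
  then show "contractive_right_module (tensor_right_action t)"
    unfolding contractive_right_module_def right_module_def
    by (simp add: action conj_op_simps left' del: cadjoint_id)
  fix mY :: "'y \<Rightarrow> ('l \<Rightarrow>\<^sub>C\<^sub>L 'l) \<Rightarrow> 'y" and mZ :: "'z \<Rightarrow> ('l \<Rightarrow>\<^sub>C\<^sub>L 'l) \<Rightarrow> 'z"
    and \<alpha> :: "'y \<Rightarrow>\<^sub>C\<^sub>L 'z" and \<Phi> :: "'y \<Rightarrow>\<^sub>C\<^sub>L 't"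
  assume *: "right_semi_ruan mY \<and> right_semi_ruan mZ \<and> right_morphism mY mZ \<alpha> \<and> isometric \<alpha> \<and>
    right_morphism mY (tensor_right_action t) \<Phi>"
  let ?l = "\<lambda>m a u. m u (conj_transpose a)"
  have "left_morphism (?l mY) (?l mZ) \<alpha>" "left_morphism (?l mY) (tensor_left_action t) \<Phi>"
    using * by (simp_all add: left_morphism_def right_morphism_def action conj_transpose_simps)
  moreover have "left_semi_ruan (?l mY)" "left_semi_ruan (?l mZ)"
    using * left_semi_ruan_conj by blast+
  moreover have "esr_injective_left TYPE('y) TYPE('z) (tensor_left_action t)"
    by (rule esr_injective_tensor_left_action[OF infinite_dimensional_conj_space[OF inf] t])
  ultimately have "\<exists>\<Psi>. left_morphism (?l mZ) (tensor_left_action t) \<Psi> \<and> \<Psi> o\<^sub>C\<^sub>L \<alpha> = \<Phi> \<and>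
    norm \<Psi> = norm \<Phi>"
    using * unfolding esr_injective_left_def by simp
  then obtain \<Psi> where \<Psi>: "left_morphism (?l mZ) (tensor_left_action t) \<Psi>" "\<Psi> o\<^sub>C\<^sub>L \<alpha> = \<Phi>"
    "norm \<Psi> = norm \<Phi>" by auto
  have "right_morphism mZ (tensor_right_action t) \<Psi>"
    unfolding right_morphism_def action
  proof (intro allI)
    fix u a
    show "\<Psi> *\<^sub>V mZ u a = tensor_left_action t (conj_op (cadjoint a)) (\<Psi> *\<^sub>V u)"
      using \<Psi>(1)[unfolded left_morphism_def, rule_format, of u "conj_op (cadjoint a)"]
      by (simp add: conj_transpose_simps)
  qed
  with \<Psi>(2,3) show "\<exists>\<Psi>. right_morphism mZ (tensor_right_action t) \<Psi> \<and> \<Psi> o\<^sub>C\<^sub>L \<alpha> = \<Phi> \<and>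
    norm \<Psi> = norm \<Phi>" by blast
qed

section \<open>Injectivity of bimodules of operators\<close>

text \<open>The two-sided analogue of \<open>left_balanced\<close> for tensors formed from \<eta> as
  a functional, \<open>z\<close> and \<xi>. Operators cross to \<eta> as adjoints but to \<xi>
  unchanged, since \<xi> stands for a vector.\<close>

definition balanced ::
  "('l::chilbert_space \<Rightarrow> 'k::chilbert_space \<Rightarrow> 'u::chilbert_space) \<Rightarrow>
    ('l \<Rightarrow> 'h::chilbert_space \<Rightarrow> 't::chilbert_space) \<Rightarrow>
    (('l \<Rightarrow>\<^sub>C\<^sub>L 'l) \<Rightarrow> 'z::complex_vector \<Rightarrow> 'z) \<Rightarrow> ('z \<Rightarrow> ('l \<Rightarrow>\<^sub>C\<^sub>L 'l) \<Rightarrow> 'z) \<Rightarrow>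
    ('u \<Rightarrow> 'z \<Rightarrow> 't \<Rightarrow> 'n::real_vector) \<Rightarrow> bool"
  where "balanced tK tH l r F \<longleftrightarrow>
    (\<forall>\<eta> \<eta>' z \<xi>. F (\<eta> + \<eta>') z \<xi> = F \<eta> z \<xi> + F \<eta>' z \<xi>) \<and>
    (\<forall>\<eta> z z' \<xi>. F \<eta> (z + z') \<xi> = F \<eta> z \<xi> + F \<eta> z' \<xi>) \<and>
    (\<forall>\<eta> z \<xi> \<xi>'. F \<eta> z (\<xi> + \<xi>') = F \<eta> z \<xi> + F \<eta> z \<xi>') \<and>
    (\<forall>s \<eta> z \<xi>. F (s *\<^sub>R \<eta>) z \<xi> = s *\<^sub>R F \<eta> z \<xi>) \<and> (\<forall>s \<eta> z \<xi>. F \<eta> (s *\<^sub>R z) \<xi> = s *\<^sub>R F \<eta> z \<xi>) \<and>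
    (\<forall>s \<eta> z \<xi>. F \<eta> z (s *\<^sub>R \<xi>) = s *\<^sub>R F \<eta> z \<xi>) \<and>
    (\<forall>a \<eta> z \<xi>. F \<eta> (l a z) \<xi> = F (ampliation tK (cadjoint a) *\<^sub>V \<eta>) z \<xi>) \<and>
    (\<forall>a \<eta> z \<xi>. F \<eta> (r z a) \<xi> = F \<eta> z (ampliation tH a *\<^sub>V \<xi>))"

lemma balancedD:
  assumes "balanced tK tH l r F"
  shows "F (\<eta> + \<eta>') z \<xi> = F \<eta> z \<xi> + F \<eta>' z \<xi>" "F \<eta> (z + z') \<xi> = F \<eta> z \<xi> + F \<eta> z' \<xi>"
    "F \<eta> z (\<xi> + \<xi>') = F \<eta> z \<xi> + F \<eta> z \<xi>'"
    "F (s *\<^sub>R \<eta>) z \<xi> = s *\<^sub>R F \<eta> z \<xi>" "F \<eta> (s *\<^sub>R z) \<xi> = s *\<^sub>R F \<eta> z \<xi>"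
    "F \<eta> z (s *\<^sub>R \<xi>) = s *\<^sub>R F \<eta> z \<xi>"
    "F \<eta> (l a z) \<xi> = F (ampliation tK (cadjoint a) *\<^sub>V \<eta>) z \<xi>"
    "F \<eta> (r z a) \<xi> = F \<eta> z (ampliation tH a *\<^sub>V \<xi>)"
    "F 0 z \<xi> = 0" "F \<eta> 0 \<xi> = 0" "F \<eta> z 0 = 0"
proof -
  show *: "F (\<eta> + \<eta>') z \<xi> = F \<eta> z \<xi> + F \<eta>' z \<xi>" "F \<eta> (z + z') \<xi> = F \<eta> z \<xi> + F \<eta> z' \<xi>"
    "F \<eta> z (\<xi> + \<xi>') = F \<eta> z \<xi> + F \<eta> z \<xi>'"
    "F (s *\<^sub>R \<eta>) z \<xi> = s *\<^sub>R F \<eta> z \<xi>" "F \<eta> (s *\<^sub>R z) \<xi> = s *\<^sub>R F \<eta> z \<xi>"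
    "F \<eta> z (s *\<^sub>R \<xi>) = s *\<^sub>R F \<eta> z \<xi>"
    "F \<eta> (l a z) \<xi> = F (ampliation tK (cadjoint a) *\<^sub>V \<eta>) z \<xi>"
    "F \<eta> (r z a) \<xi> = F \<eta> z (ampliation tH a *\<^sub>V \<xi>)" for a s \<eta> \<eta>' z z' \<xi> \<xi>'
    using assms unfolding balanced_def by simp_all
  show "F 0 z \<xi> = 0" "F \<eta> 0 \<xi> = 0" "F \<eta> z 0 = 0"
    using *(4)[of 0 0 z \<xi>] *(5)[of \<eta> 0 0 \<xi>] *(6)[of \<eta> z 0 0] by simp_all
qed

text \<open>In Dirac notation the entry is |e><\<eta>_k| z |\<xi>_h><e|, where \<eta>_k and \<xi>_h
  are slices.\<close>

definition matrix_coeff ::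
  "'l \<Rightarrow> ('l::chilbert_space \<Rightarrow> 'k::chilbert_space \<Rightarrow> 'u::chilbert_space) \<Rightarrow>
    ('l \<Rightarrow> 'h::chilbert_space \<Rightarrow> 't::chilbert_space) \<Rightarrow>
    (('l \<Rightarrow>\<^sub>C\<^sub>L 'l) \<Rightarrow> 'z \<Rightarrow> 'z) \<Rightarrow> ('z \<Rightarrow> ('l \<Rightarrow>\<^sub>C\<^sub>L 'l) \<Rightarrow> 'z) \<Rightarrow>
    'u \<Rightarrow> 'z \<Rightarrow> 't \<Rightarrow> 'k \<Rightarrow> 'h \<Rightarrow> 'z"
  where "matrix_coeff e tK tH l r \<eta> z \<xi> =
    (\<lambda>k h. l (rank1 e (tensor_slice tK k *\<^sub>V \<eta>)) (r z (rank1 (tensor_slice tH h *\<^sub>V \<xi>) e)))"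

lemma matrix_coeff_morphism:
  assumes "left_morphism lY lZ \<alpha>" "right_morphism rY rZ \<alpha>"
  shows "matrix_coeff e tK tH lZ rZ \<eta> (\<alpha> *\<^sub>V y) \<xi> k h = \<alpha> *\<^sub>V matrix_coeff e tK tH lY rY \<eta> y \<xi> k h"
  using assms by (simp add: matrix_coeff_def left_morphism_def right_morphism_def)

context
  fixes l :: "('l::chilbert_space \<Rightarrow>\<^sub>C\<^sub>L 'l) \<Rightarrow> 'z::complex_normed_vector \<Rightarrow> 'z"
    and r :: "'z \<Rightarrow> ('l \<Rightarrow>\<^sub>C\<^sub>L 'l) \<Rightarrow> 'z"
    and tK :: "'l \<Rightarrow> 'k::chilbert_space \<Rightarrow> 'u::chilbert_space"
    and tH :: "'l \<Rightarrow> 'h::chilbert_space \<Rightarrow> 't::chilbert_space"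
  assumes bimodule: "contractive_bimodule l r" and tK: "hilbert_tensor tK" and tH: "hilbert_tensor tH"
begin

lemma bimodule_left: "left_module l" and bimodule_right: "right_module r"
  and bimodule_assoc: "r (l a u) b = l a (r u b)"
  and bimodule_left_contractive: "norm (l a u) \<le> norm a * norm u"
  and bimodule_right_contractive: "norm (r u a) \<le> norm u * norm a"
  using bimodule
  by (simp_all add: contractive_bimodule_def contractive_left_module_def contractive_right_module_def)

lemma contraction_bimodule:
  assumes "norm a \<le> 1" "norm b \<le> 1"
  shows "norm (l a (r z b)) \<le> norm z"
proof -
  have "norm (l a (r z b)) \<le> norm a * norm (r z b)" by (rule bimodule_left_contractive)
  also have "\<dots> \<le> 1 * (norm z * norm b)" using assms(1) by (intro mult_mono bimodule_right_contractive) simp_all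
  also have "\<dots> \<le> norm z" using mult_left_mono[OF assms(2), of "norm z"] by simp
  finally show ?thesis .
qed

lemma balanced_matrix_coeff: "balanced tK tH l r (matrix_coeff e tK tH l r)"
  unfolding balanced_def matrix_coeff_def fun_eq_iff plus_fun_apply scaleR_fun_apply bimodule_assoc
  by (simp add: rank1_add_right rank1_add_left left_moduleD[OF bimodule_left] right_moduleD[OF bimodule_right] scaleR_scaleC
      rank1_scaleC_right rank1_scaleC_left slice_ampliation[OF tK] slice_ampliation[OF tH]
      flip: left_moduleD(5)[OF bimodule_left] right_moduleD(5)[OF bimodule_right] rank1_compose compose_rank1)

text \<open>All complex scalars can be collected, conjugated, in \<eta>. The rule for
  \<open>z\<close> makes the extension complex-linear, the rule for \<xi> makes its values
  complex-linear operators.\<close>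

lemma matrix_coeff_scaleC:
  "matrix_coeff e tK tH l r \<eta> (c *\<^sub>C z) \<xi> = matrix_coeff e tK tH l r (cnj c *\<^sub>C \<eta>) z \<xi>"
  "matrix_coeff e tK tH l r \<eta> z (c *\<^sub>C \<xi>) = matrix_coeff e tK tH l r (cnj c *\<^sub>C \<eta>) z \<xi>"
  unfolding matrix_coeff_def fun_eq_iff
  by (simp_all add: left_moduleD[OF bimodule_left] right_moduleD[OF bimodule_right] rank1_scaleC_right rank1_scaleC_left)

text \<open>The outer factors \<open>rank1 x e\<close> and \<open>rank1 e x'\<close> cancel the
  vector \<open>e\<close> from both sides of a coefficient, which leaves one matrix block of
  \<open>z\<close> with respect to the two orthonormal systems.\<close>

lemma bimodule_compression_eq_sum_coeff:
  assumes e: "cinner e e = 1"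
    and f: "\<And>x. x \<in> E \<Longrightarrow> tensor_slice tK (f x) *\<^sub>V \<eta> = x"
    and f': "\<And>x. x \<in> E' \<Longrightarrow> tensor_slice tH (f' x) *\<^sub>V \<xi> = x"
  shows "l (span_projection E) (r z (span_projection E')) =
    (\<Sum>x\<in>E. \<Sum>x'\<in>E'. l (rank1 x e) (r (matrix_coeff e tK tH l r \<eta> z \<xi> (f x) (f' x')) (rank1 e x')))"
proof -
  have rank: "rank1 x e o\<^sub>C\<^sub>L rank1 e x = rank1 x x" for x :: 'l
    by (simp add: compose_rank1 e scaleC_one)
  have "l (rank1 x e) (r (matrix_coeff e tK tH l r \<eta> z \<xi> (f x) (f' x')) (rank1 e x')) =
    l (rank1 x x) (r z (rank1 x' x'))" if "x \<in> E" "x' \<in> E'" for x x'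
    using that
    by (simp add: matrix_coeff_def f f' bimodule_assoc rank flip: left_moduleD(5)[OF bimodule_left] right_moduleD(5)[OF bimodule_right])
  then show ?thesis
    by (simp add: span_projection_def left_module_sum[OF bimodule_left] right_module_sum[OF bimodule_right])
      (rule sum.swap)
qed

lemma balanced_compression:
  assumes F: "balanced tK tH l r F"
    and E: "finite E" "corthonormal E" "ampliation tK (span_projection E) *\<^sub>V \<eta> = \<eta>"
    and E': "ampliation tH (span_projection E') *\<^sub>V \<xi> = \<xi>"
  shows "F \<eta> (l (span_projection E) (r z (span_projection E'))) \<xi> = F \<eta> z \<xi>"
  using projection_span_projection[OF E(1,2)] E E' by (simp add: balancedD(7,8)[OF F] projection_def)

text \<open>As in the one-sided case, a balanced map sees only the compression of \<open>z\<close>,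
  and the coefficients rebuild it.\<close>

lemma balanced_zero:
  assumes F: "balanced tK tH l r F" and e: "cinner e e = 1"
    and \<eta>: "finite_support tK \<eta>" and \<xi>: "finite_support tH \<xi>"
    and 0: "matrix_coeff e tK tH l r \<eta> z \<xi> = 0"
  shows "F \<eta> z \<xi> = 0"
proof -
  obtain E f where E: "finite E" "corthonormal E" "\<And>x. x \<in> E \<Longrightarrow> tensor_slice tK (f x) *\<^sub>V \<eta> = x"
    "ampliation tK (span_projection E) *\<^sub>V \<eta> = \<eta>"
    using slice_basis_exists[OF tK \<eta>] by metis
  obtain E' f' where E': "finite E'" "corthonormal E'"
    "\<And>x. x \<in> E' \<Longrightarrow> tensor_slice tH (f' x) *\<^sub>V \<xi> = x" "ampliation tH (span_projection E') *\<^sub>V \<xi> = \<xi>"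
    using slice_basis_exists[OF tH \<xi>] by metis
  have "F \<eta> z \<xi> = F \<eta> (l (span_projection E) (r z (span_projection E'))) \<xi>"
    by (rule balanced_compression[OF F E(1,2,4) E'(4), symmetric])
  also have "l (span_projection E) (r z (span_projection E')) =
    (\<Sum>x\<in>E. \<Sum>x'\<in>E'. l (rank1 x e) (r (matrix_coeff e tK tH l r \<eta> z \<xi> (f x) (f' x')) (rank1 e x')))"
    by (rule bimodule_compression_eq_sum_coeff[OF e E(3) E'(3)])
  also have "\<dots> = 0" by (simp add: 0 left_moduleD[OF bimodule_left] right_moduleD[OF bimodule_right])
  finally show ?thesis by (simp add: balancedD[OF F])
qed

text \<open>The same S and T act on both legs, because a support in a bimodule is a left and a right
  support at once; hence one \<open>P\<close> has to fix all four vectors.\<close>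

lemma balanced_direct_sum:
  assumes F: "balanced tK tH l r F" and ST: "duplicating S T P"
    and fixed: "ampliation tK P *\<^sub>V \<eta> = \<eta>" "ampliation tK P *\<^sub>V \<eta>' = \<eta>'"
      "ampliation tH P *\<^sub>V \<xi> = \<xi>" "ampliation tH P *\<^sub>V \<xi>' = \<xi>'"
  shows "F (ampliation tK S *\<^sub>V \<eta> + ampliation tK T *\<^sub>V \<eta>')
      (l S (r z (cadjoint S)) + l T (r z' (cadjoint T)))
      (ampliation tH S *\<^sub>V \<xi> + ampliation tH T *\<^sub>V \<xi>') = F \<eta> z \<xi> + F \<eta>' z' \<xi>'"
proof -
  have ampK: "ampliation tK a *\<^sub>V ampliation tK b *\<^sub>V u = ampliation tK (a o\<^sub>C\<^sub>L b) *\<^sub>V u" for a b u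
    by (simp add: ampliation_compose[OF tK])
  have ampH: "ampliation tH a *\<^sub>V ampliation tH b *\<^sub>V u = ampliation tH (a o\<^sub>C\<^sub>L b) *\<^sub>V u" for a b u
    by (simp add: ampliation_compose[OF tH])
  show ?thesis
    by (simp add: balancedD(2,7,8)[OF F] ampK ampH duplicatingD[OF ST] fixed ampliation_zero[OF tK]
        ampliation_zero[OF tH])
qed

text \<open>The maximum in the Ruan axiom keeps block sums inside the unit ball. For this reason the
  norm of \<open>z\<close> enters the two-sided cost as a constraint and not as a summand.\<close>

lemma ruan_direct_sum:
  assumes ruan: "ruan_bimodule l r" and ST: "duplicating S T P" and z: "norm z \<le> 1" "norm z' \<le> 1"
  shows "norm (l S (r z (cadjoint S)) + l T (r z' (cadjoint T))) \<le> 1"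
proof -
  let ?u = "l S (r z (cadjoint S))" and ?v = "l T (r z' (cadjoint T))"
  \<comment> \<open>The adjoint of a partial isometry is one too; this makes the range projection a
    right support.\<close>
  have adj: "cadjoint R o\<^sub>C\<^sub>L (R o\<^sub>C\<^sub>L cadjoint R) = cadjoint R"
    if "R o\<^sub>C\<^sub>L cadjoint R o\<^sub>C\<^sub>L R = R" for R :: "'l \<Rightarrow>\<^sub>C\<^sub>L 'l"
    using arg_cong[OF that, of cadjoint] by (simp add: cadjoint_compose)
  have "left_support l (S o\<^sub>C\<^sub>L cadjoint S) ?u" "left_support l (T o\<^sub>C\<^sub>L cadjoint T) ?v"
    by (simp_all add: left_support_def duplicatingD[OF ST] flip: left_moduleD(5)[OF bimodule_left])
  moreover have "right_support r (S o\<^sub>C\<^sub>L cadjoint S) ?u" "right_support r (T o\<^sub>C\<^sub>L cadjoint T) ?v"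
    by (simp_all add: right_support_def duplicatingD[OF ST] bimodule_assoc adj flip: right_moduleD(5)[OF bimodule_right])
  ultimately have "norm (?u + ?v) = max (norm ?u) (norm ?v)"
    using ruan duplicatingD(12)[OF ST] unfolding ruan_bimodule_def by blast
  moreover have "norm ?u \<le> norm z" "norm ?v \<le> norm z'"
    by (intro contraction_bimodule duplicatingD[OF ST] order_trans[OF norm_cadjoint_le])+
  ultimately show ?thesis using z by simp
qed

end

section \<open>Operators between Hilbert tensor products and their forms\<close>

lemma contractive_operator_actions:
  fixes tK :: "'l::chilbert_space \<Rightarrow> 'k::chilbert_space \<Rightarrow> 'u::chilbert_space"
    and tH :: "'l \<Rightarrow> 'h::chilbert_space \<Rightarrow> 't::chilbert_space"
  assumes tK: "hilbert_tensor tK" and tH: "hilbert_tensor tH"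
  shows "contractive_bimodule (operator_left_action tK :: _ \<Rightarrow> ('t \<Rightarrow>\<^sub>C\<^sub>L 'u) \<Rightarrow> _)
    (operator_right_action tH)"
proof -
  have norm_left: "norm (ampliation tK a o\<^sub>C\<^sub>L b) \<le> norm a * norm b" for a and b :: "'t \<Rightarrow>\<^sub>C\<^sub>L 'u"
    using norm_compose_le[of "ampliation tK a" b]
      mult_right_mono[OF norm_ampliation_le[OF tK, of a], of "norm b"] by simp
  have norm_right: "norm (b o\<^sub>C\<^sub>L ampliation tH a) \<le> norm b * norm a" for a and b :: "'t \<Rightarrow>\<^sub>C\<^sub>L 'u"
    using norm_compose_le[of b "ampliation tH a"]
      mult_left_mono[OF norm_ampliation_le[OF tH, of a], of "norm b"] by simp
  show ?thesis
    unfolding contractive_bimodule_def contractive_left_module_def contractive_right_module_def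
      left_module_def right_module_def operator_left_action_def operator_right_action_def
    by (intro conjI allI norm_left norm_right; rule cblinfun_eqI;
        simp add: ampliation_add[OF tK] ampliation_add[OF tH] ampliation_scaleC[OF tK]
          ampliation_scaleC[OF tH] ampliation_compose[OF tK] ampliation_compose[OF tH]
          ampliation_id[OF tK] ampliation_id[OF tH])
qed

lemma balanced_morphism:
  assumes tK: "hilbert_tensor tK"
    and "left_morphism l (operator_left_action tK) \<Phi>" "right_morphism r (operator_right_action tH) \<Phi>"
  shows "balanced tK tH l r (\<lambda>\<eta> y \<xi>. inner \<eta> ((\<Phi> *\<^sub>V y) *\<^sub>V \<xi>))"
  using assms(2,3)
  by (simp add: balanced_def left_morphism_def right_morphism_def operator_left_action_def
      operator_right_action_def inner_add_left inner_add_right inner_cadjoint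
      flip: cadjoint_ampliation[OF tK])

lemma duplicating_four:
  fixes tK :: "'l::chilbert_space \<Rightarrow> 'k::chilbert_space \<Rightarrow> 'u::chilbert_space"
    and tH :: "'l \<Rightarrow> 'h::chilbert_space \<Rightarrow> 't::chilbert_space"
  assumes inf: "infinite_dimensional TYPE('l)" and tK: "hilbert_tensor tK" and tH: "hilbert_tensor tH"
    and fs: "finite_support tK \<eta>" "finite_support tK \<eta>'" "finite_support tH \<xi>" "finite_support tH \<xi>'"
  obtains S T P where "duplicating S T P" "ampliation tK P *\<^sub>V \<eta> = \<eta>" "ampliation tK P *\<^sub>V \<eta>' = \<eta>'"
    "ampliation tH P *\<^sub>V \<xi> = \<xi>" "ampliation tH P *\<^sub>V \<xi>' = \<xi>'"
proof -
  obtain X1 where X1: "finite X1"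
    "\<And>P. (\<And>x. x \<in> cspan X1 \<Longrightarrow> P *\<^sub>V x = x) \<Longrightarrow> ampliation tK P *\<^sub>V \<eta> = \<eta>"
    using finite_support_basis[OF tK fs(1)] by metis
  obtain X2 where X2: "finite X2"
    "\<And>P. (\<And>x. x \<in> cspan X2 \<Longrightarrow> P *\<^sub>V x = x) \<Longrightarrow> ampliation tK P *\<^sub>V \<eta>' = \<eta>'"
    using finite_support_basis[OF tK fs(2)] by metis
  obtain X3 where X3: "finite X3"
    "\<And>P. (\<And>x. x \<in> cspan X3 \<Longrightarrow> P *\<^sub>V x = x) \<Longrightarrow> ampliation tH P *\<^sub>V \<xi> = \<xi>"
    using finite_support_basis[OF tH fs(3)] by metis
  obtain X4 where X4: "finite X4"
    "\<And>P. (\<And>x. x \<in> cspan X4 \<Longrightarrow> P *\<^sub>V x = x) \<Longrightarrow> ampliation tH P *\<^sub>V \<xi>' = \<xi>'"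
    using finite_support_basis[OF tH fs(4)] by metis
  define X where "X = X1 \<union> X2 \<union> X3 \<union> X4"
  have "finite X" by (simp add: X_def X1 X2 X3 X4)
  then obtain S T P where ST: "duplicating S T P" and P: "\<And>x. x \<in> cspan X \<Longrightarrow> P *\<^sub>V x = x"
    using duplicating_exists[OF inf] by metis
  have P': "P *\<^sub>V x = x" if "X' \<subseteq> X" "x \<in> cspan X'" for x X'
    using complex_vector.span_mono[OF that(1)] that(2) P by blast
  have "X1 \<subseteq> X" "X2 \<subseteq> X" "X3 \<subseteq> X" "X4 \<subseteq> X" by (auto simp: X_def)
  note this[THEN P']
  then show ?thesis using that[OF ST X1(2) X2(2) X3(2) X4(2)] by blast
qed

lemma operator_eqI:
  assumes tK: "hilbert_tensor tK" and tH: "hilbert_tensor tH"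
    and "\<And>\<eta> \<xi>. finite_support tK \<eta> \<Longrightarrow> finite_support tH \<xi> \<Longrightarrow> inner (S *\<^sub>V \<xi>) \<eta> = inner (T *\<^sub>V \<xi>) \<eta>"
  shows "S = T"
proof (rule cblinfun_eqI)
  fix \<xi>
  have "closure {\<xi>. finite_support tH \<xi>} \<subseteq> {\<xi>. S *\<^sub>V \<xi> = T *\<^sub>V \<xi>}"
    by (rule closure_minimal)
      (auto intro!: finite_support_eqI[OF tK] assms closed_Collect_eq linear_continuous_on
        bounded_linear_cblinfun_apply)
  then show "S *\<^sub>V \<xi> = T *\<^sub>V \<xi>" unfolding finite_support_dense[OF tH] by blast
qed

text \<open>Read \<open>B\<close> as the real part of a sesquilinear form; the rule that moves
  complex scalars from \<xi> to \<eta> encodes its complex homogeneity. Riesz representation in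
  \<eta> gives a vector for each \<xi> of finite support, and density in \<xi> does the
  rest.\<close>

lemma finite_support_form_operator:
  fixes tK :: "'l::chilbert_space \<Rightarrow> 'k::chilbert_space \<Rightarrow> 'u::chilbert_space"
    and tH :: "'m::chilbert_space \<Rightarrow> 'h::chilbert_space \<Rightarrow> 't::chilbert_space"
  assumes tK: "hilbert_tensor tK" and tH: "hilbert_tensor tH"
    and add: "\<And>\<eta> \<eta>' \<xi>. finite_support tK \<eta> \<Longrightarrow> finite_support tK \<eta>' \<Longrightarrow> finite_support tH \<xi> \<Longrightarrow>
      B (\<eta> + \<eta>') \<xi> = B \<eta> \<xi> + B \<eta>' \<xi>"
      "\<And>\<eta> \<xi> \<xi>'. finite_support tK \<eta> \<Longrightarrow> finite_support tH \<xi> \<Longrightarrow> finite_support tH \<xi>' \<Longrightarrow>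
      B \<eta> (\<xi> + \<xi>') = B \<eta> \<xi> + B \<eta> \<xi>'"
    and scale: "\<And>s \<eta> \<xi>. finite_support tK \<eta> \<Longrightarrow> finite_support tH \<xi> \<Longrightarrow> B (s *\<^sub>R \<eta>) \<xi> = s * B \<eta> \<xi>"
      "\<And>c \<eta> \<xi>. finite_support tK \<eta> \<Longrightarrow> finite_support tH \<xi> \<Longrightarrow> B \<eta> (c *\<^sub>C \<xi>) = B (cnj c *\<^sub>C \<eta>) \<xi>"
    and bound: "\<And>\<eta> \<xi>. finite_support tK \<eta> \<Longrightarrow> finite_support tH \<xi> \<Longrightarrow> B \<eta> \<xi> \<le> K * norm \<eta> * norm \<xi>"
    and "0 \<le> K"
  obtains T where "\<And>\<eta> \<xi>. finite_support tK \<eta> \<Longrightarrow> finite_support tH \<xi> \<Longrightarrow> inner (T *\<^sub>V \<xi>) \<eta> = B \<eta> \<xi>"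
    "norm T \<le> K"
proof -
  have "\<exists>v. finite_support tH \<xi> \<longrightarrow> (\<forall>\<eta>. finite_support tK \<eta> \<longrightarrow> inner v \<eta> = B \<eta> \<xi>) \<and> norm v \<le> K * norm \<xi>" for \<xi>
  proof (cases "finite_support tH \<xi>")
    case True
    show ?thesis
      by (rule finite_support_riesz[OF tK, of "\<lambda>\<eta>. B \<eta> \<xi>" "K * norm \<xi>"])
        (use True add(1) scale(1) bound[OF _ True] \<open>0 \<le> K\<close> in \<open>auto simp: mult_ac\<close>)
  qed simp
  then obtain f where f: "\<And>\<xi> \<eta>. finite_support tH \<xi> \<Longrightarrow> finite_support tK \<eta> \<Longrightarrow> inner (f \<xi>) \<eta> = B \<eta> \<xi>"
    "\<And>\<xi>. finite_support tH \<xi> \<Longrightarrow> norm (f \<xi>) \<le> K * norm \<xi>" by metis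
  have f_add: "f (\<xi> + \<xi>') = f \<xi> + f \<xi>'" if "finite_support tH \<xi>" "finite_support tH \<xi>'" for \<xi> \<xi>'
    by (rule finite_support_eqI[OF tK])
      (simp add: f that finite_support_add[OF tH] add(2) inner_add_left)
  have f_scaleC: "f (c *\<^sub>C \<xi>) = c *\<^sub>C f \<xi>" if \<xi>: "finite_support tH \<xi>" for c \<xi>
  proof (rule finite_support_eqI[OF tK])
    fix \<eta> assume \<eta>: "finite_support tK \<eta>"
    have "inner (f (c *\<^sub>C \<xi>)) \<eta> = inner (f \<xi>) (cnj c *\<^sub>C \<eta>)"
      by (simp add: f \<xi> \<eta> finite_support_scaleC[OF tH] finite_support_scaleC[OF tK] scale(2))
    then show "inner (f (c *\<^sub>C \<xi>)) \<eta> = inner (c *\<^sub>C f \<xi>) \<eta>"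
      by (simp add: cinner_scaleC_left cinner_scaleC_right flip: Re_cinner)
  qed
  obtain F where F: "bounded_linear F" "\<And>\<xi>. finite_support tH \<xi> \<Longrightarrow> F \<xi> = f \<xi>"
    "\<And>\<xi>. norm (F \<xi>) \<le> K * norm \<xi>"
  proof (rule lipschitz_additive_extension[of "{\<xi>. finite_support tH \<xi>}" f K])
  qed (use finite_support_dense[OF tH] f_add f_scaleC f(2) in
      \<open>simp_all add: finite_support_add[OF tH] finite_support_scaleC[OF tH] scaleR_scaleC\<close>)
  have scaleC_cont: "continuous_on UNIV (\<lambda>x. c *\<^sub>C h x)"
    if "continuous_on UNIV h" for c and h :: "'t \<Rightarrow> 'v::complex_normed_vector"
  proof -
    have "continuous_on UNIV (cblinfun_apply (c *\<^sub>C cblinfun_id :: 'v \<Rightarrow>\<^sub>C\<^sub>L 'v))"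
      by (intro linear_continuous_on bounded_linear_cblinfun_apply)
    from continuous_on_compose2[OF this that] show ?thesis by simp
  qed
  have F_cont: "continuous_on UNIV (\<lambda>x. F (h x))" if "continuous_on UNIV h" for h :: "'t \<Rightarrow> _"
    by (rule continuous_on_compose2[OF linear_continuous_on[OF F(1), of UNIV] that]) simp
  \<comment> \<open>The extension is so far only real-linear; complex homogeneity is a closed
    condition and holds on a dense set.\<close>
  have F_scaleC: "F (c *\<^sub>C \<xi>) = c *\<^sub>C F \<xi>" for c \<xi>
  proof -
    have "closure {\<xi>. finite_support tH \<xi>} \<subseteq> {\<xi>. F (c *\<^sub>C \<xi>) = c *\<^sub>C F \<xi>}"
      by (rule closure_minimal)
        (auto intro!: closed_Collect_eq scaleC_cont F_cont continuous_on_id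
          simp: F(2) finite_support_scaleC[OF tH] f_scaleC)
    then show ?thesis unfolding finite_support_dense[OF tH] by blast
  qed
  have "bounded_clinear F"
    by (rule bounded_clinearI[of _ K])
      (simp_all add: F_scaleC F(3) linear_simps[OF F(1)])
  then have T: "cBlinfun F *\<^sub>V \<xi> = F \<xi>" for \<xi> by (simp add: cBlinfun_inverse)
  show ?thesis
    by (rule that[of "cBlinfun F"])
      (use \<open>0 \<le> K\<close> in \<open>auto intro!: norm_cblinfun_leI simp: T F f\<close>)
qed

theorem er_injective_operator_actions:
  fixes tK :: "'l::chilbert_space \<Rightarrow> 'k::chilbert_space \<Rightarrow> 'u::chilbert_space"
    and tH :: "'l \<Rightarrow> 'h::chilbert_space \<Rightarrow> 't::chilbert_space"
  assumes inf: "infinite_dimensional TYPE('l)" and tK: "hilbert_tensor tK" and tH: "hilbert_tensor tH"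
  shows "er_injective TYPE('y::complex_normed_vector) TYPE('z::complex_normed_vector)
    (operator_left_action tK :: _ \<Rightarrow> ('t \<Rightarrow>\<^sub>C\<^sub>L 'u) \<Rightarrow> _) (operator_right_action tH)"
  unfolding er_injective_def
proof (intro conjI allI impI)
  show "contractive_bimodule (operator_left_action tK :: _ \<Rightarrow> ('t \<Rightarrow>\<^sub>C\<^sub>L 'u) \<Rightarrow> _)
    (operator_right_action tH)"
    by (rule contractive_operator_actions[OF tK tH])
next
  fix lY :: "('l \<Rightarrow>\<^sub>C\<^sub>L 'l) \<Rightarrow> 'y \<Rightarrow> 'y" and rY :: "'y \<Rightarrow> ('l \<Rightarrow>\<^sub>C\<^sub>L 'l) \<Rightarrow> 'y"
    and lZ :: "('l \<Rightarrow>\<^sub>C\<^sub>L 'l) \<Rightarrow> 'z \<Rightarrow> 'z" and rZ :: "'z \<Rightarrow> ('l \<Rightarrow>\<^sub>C\<^sub>L 'l) \<Rightarrow> 'z"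
    and \<alpha> :: "'y \<Rightarrow>\<^sub>C\<^sub>L 'z" and \<Phi> :: "'y \<Rightarrow>\<^sub>C\<^sub>L ('t \<Rightarrow>\<^sub>C\<^sub>L 'u)"
  assume "ruan_bimodule lY rY \<and> ruan_bimodule lZ rZ \<and> left_morphism lY lZ \<alpha> \<and>
    right_morphism rY rZ \<alpha> \<and> isometric \<alpha> \<and> left_morphism lY (operator_left_action tK) \<Phi> \<and>
    right_morphism rY (operator_right_action tH) \<Phi>"
  then have Y: "ruan_bimodule lY rY" and Z: "ruan_bimodule lZ rZ"
    and \<alpha>: "left_morphism lY lZ \<alpha>" "right_morphism rY rZ \<alpha>" "isometric \<alpha>"
    and \<Phi>: "left_morphism lY (operator_left_action tK) \<Phi>" "right_morphism rY (operator_right_action tH) \<Phi>"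
    by blast+
  have bY: "contractive_bimodule lY rY" and bZ: "contractive_bimodule lZ rZ"
    using Y Z by (simp_all add: ruan_bimodule_def)
  obtain e :: 'l where e: "cinner e e = 1"
    using inf unfolding infinite_dimensional_def corthonormal_def by blast
  define \<gamma> where "\<gamma> = matrix_coeff e tK tH lZ rZ"
  define \<beta> where "\<beta> \<eta> y \<xi> = inner \<eta> ((\<Phi> *\<^sub>V y) *\<^sub>V \<xi>)" for \<eta> y \<xi>
  define c where "c = norm \<Phi>"
  have "0 \<le> c" by (simp add: c_def)
  have \<gamma>: "balanced tK tH lZ rZ \<gamma>" unfolding \<gamma>_def by (rule balanced_matrix_coeff[OF bZ tK tH])
  have \<beta>: "balanced tK tH lY rY \<beta>"
    using balanced_morphism[OF tK \<Phi>] by (simp add: \<beta>_def[abs_def])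
  have \<gamma>\<alpha>: "balanced tK tH lY rY (\<lambda>\<eta> y. \<gamma> \<eta> (\<alpha> *\<^sub>V y))"
    using \<gamma> \<alpha>(1,2) by (simp add: balanced_def left_morphism_def right_morphism_def)
  note \<gamma>_simps = balancedD[OF \<gamma>] and \<beta>_simps = balancedD[OF \<beta>]
  note fsK = finite_support_add[OF tK] finite_support_scaleR[OF tK] finite_support_zero[OF tK]
    finite_support_ampliation[OF tK] finite_support_scaleC[OF tK]
  note fsH = finite_support_add[OF tH] finite_support_scaleR[OF tH] finite_support_zero[OF tH]
    finite_support_ampliation[OF tH] finite_support_scaleC[OF tH]
  have \<beta>_zero: "\<beta> \<eta> y \<xi> = 0"
    if "finite_support tK \<eta>" "finite_support tH \<xi>" "\<gamma> \<eta> (\<alpha> *\<^sub>V y) \<xi> = 0" for \<eta> y \<xi>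
  proof (rule balanced_zero[OF bY tK tH \<beta> e that(1,2)])
    have "matrix_coeff e tK tH lY rY \<eta> y \<xi> k h = 0" for k h
    proof -
      have "norm (matrix_coeff e tK tH lY rY \<eta> y \<xi> k h) = norm (\<alpha> *\<^sub>V matrix_coeff e tK tH lY rY \<eta> y \<xi> k h)"
        using \<alpha>(3) by (simp add: isometric_def)
      also have "\<dots> = 0"
        using that(3) matrix_coeff_morphism[OF \<alpha>(1,2), of e tK tH \<eta> y \<xi> k h] by (simp add: \<gamma>_def)
      finally show ?thesis by simp
    qed
    then show "matrix_coeff e tK tH lY rY \<eta> y \<xi> = 0" by (simp add: fun_eq_iff)
  qed
  \<comment> \<open>The charges are those of the one-sided proof, except that \<open>z\<close> is
    confined to the unit ball and the cost is carried by \<eta> and \<xi>.\<close>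
  define C where "C = {(\<gamma> \<eta> z \<xi> + \<gamma> \<eta>' (\<alpha> *\<^sub>V y) \<xi>', s + \<beta> \<eta>' y \<xi>') | \<eta> z \<xi> \<eta>' y \<xi>' s.
    finite_support tK \<eta> \<and> finite_support tH \<xi> \<and> finite_support tK \<eta>' \<and> finite_support tH \<xi>' \<and>
    norm z \<le> 1 \<and> c / 2 * ((norm \<eta>)\<^sup>2 + (norm \<xi>)\<^sup>2) \<le> s}"
  have C_I: "(u, q) \<in> C"
    if "finite_support tK \<eta>" "finite_support tH \<xi>" "finite_support tK \<eta>'" "finite_support tH \<xi>'"
      "norm z \<le> 1" "c / 2 * ((norm \<eta>)\<^sup>2 + (norm \<xi>)\<^sup>2) \<le> s"
      "u = \<gamma> \<eta> z \<xi> + \<gamma> \<eta>' (\<alpha> *\<^sub>V y) \<xi>'" "q = s + \<beta> \<eta>' y \<xi>'" for \<eta> \<xi> \<eta>' \<xi>' z s u y q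
    unfolding C_def using that by blast
  have C_E: thesis if "p \<in> C" "\<And>\<eta> \<xi> \<eta>' \<xi>' z s y. finite_support tK \<eta> \<Longrightarrow> finite_support tH \<xi> \<Longrightarrow>
      finite_support tK \<eta>' \<Longrightarrow> finite_support tH \<xi>' \<Longrightarrow> norm z \<le> 1 \<Longrightarrow>
      c / 2 * ((norm \<eta>)\<^sup>2 + (norm \<xi>)\<^sup>2) \<le> s \<Longrightarrow>
      p = (\<gamma> \<eta> z \<xi> + \<gamma> \<eta>' (\<alpha> *\<^sub>V y) \<xi>', s + \<beta> \<eta>' y \<xi>') \<Longrightarrow> thesis" for p thesis
    using that(1) unfolding C_def by (elim CollectE exE conjE) (rule that(2))
  have nonneg: "- \<beta> \<eta>' y \<xi>' \<le> c / 2 * ((norm \<eta>)\<^sup>2 + (norm \<xi>)\<^sup>2)"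
    if fs: "finite_support tK \<eta>" "finite_support tH \<xi>" "finite_support tK \<eta>'" "finite_support tH \<xi>'"
      and z: "norm z \<le> 1" and 0: "\<gamma> \<eta> z \<xi> + \<gamma> \<eta>' (\<alpha> *\<^sub>V y) \<xi>' = 0" for \<eta> \<xi> \<eta>' \<xi>' z y
  proof -
    obtain E f where E: "finite E" "corthonormal E"
      "\<And>x. x \<in> E \<Longrightarrow> tensor_slice tK (f x) *\<^sub>V \<eta> = x" "ampliation tK (span_projection E) *\<^sub>V \<eta> = \<eta>"
      using slice_basis_exists[OF tK fs(1)] by metis
    obtain E' f' where E': "finite E'" "corthonormal E'"
      "\<And>x. x \<in> E' \<Longrightarrow> tensor_slice tH (f' x) *\<^sub>V \<xi> = x" "ampliation tH (span_projection E') *\<^sub>V \<xi> = \<xi>"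
      using slice_basis_exists[OF tH fs(2)] by metis
    \<comment> \<open>The coefficients of \<open>z\<close> come from Y, hence so does its two-sided
      compression, which remains in the unit ball.\<close>
    define w where "w = (\<Sum>x\<in>E. \<Sum>x'\<in>E'. lY (rank1 x e)
      (rY (- matrix_coeff e tK tH lY rY \<eta>' y \<xi>' (f x) (f' x')) (rank1 e x')))"
    have "\<gamma> \<eta> z \<xi> k h = \<alpha> *\<^sub>V (- matrix_coeff e tK tH lY rY \<eta>' y \<xi>' k h)" for k h
      using fun_cong[OF fun_cong[OF 0, of k], of h] matrix_coeff_morphism[OF \<alpha>(1,2), of e tK tH \<eta>' y \<xi>' k h]
      by (simp add: \<gamma>_def eq_neg_iff_add_eq_0)
    then have "\<alpha> *\<^sub>V w = (\<Sum>x\<in>E. \<Sum>x'\<in>E'. lZ (rank1 x e) (rZ (\<gamma> \<eta> z \<xi> (f x) (f' x')) (rank1 e x')))"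
      using \<alpha>(1,2) by (simp add: w_def left_morphism_def right_morphism_def del: cblinfun_apply_linear(3))
    also have "\<dots> = lZ (span_projection E) (rZ z (span_projection E'))"
      unfolding \<gamma>_def
      by (rule bimodule_compression_eq_sum_coeff[OF bZ tK tH e E(3) E'(3), symmetric])
    finally have w: "\<alpha> *\<^sub>V w = lZ (span_projection E) (rZ z (span_projection E'))" .
    have "norm w = norm (lZ (span_projection E) (rZ z (span_projection E')))"
      using \<alpha>(3) by (simp add: isometric_def flip: w)
    also have "\<dots> \<le> norm z"
      using projection_span_projection[OF E(1,2)] projection_span_projection[OF E'(1,2)]
      by (intro contraction_bimodule[OF bZ tK tH] norm_le_one_of_projection) (simp_all add: projection_def)
    finally have norm_w: "norm w \<le> 1" using z by simp
    have \<gamma>w: "\<gamma> \<eta> (\<alpha> *\<^sub>V w) \<xi> = \<gamma> \<eta> z \<xi>"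
      unfolding w by (rule balanced_compression[OF bZ tK tH \<gamma> E(1,2,4) E'(4)])
    \<comment> \<open>One pair for all four vectors turns \<open>w\<close> and \<open>y\<close> into
      orthogonal diagonal blocks of a single element, to which \<open>\<beta>_zero\<close>
      applies.\<close>
    obtain S T P where ST: "duplicating S T P" "ampliation tK P *\<^sub>V \<eta> = \<eta>" "ampliation tK P *\<^sub>V \<eta>' = \<eta>'"
      "ampliation tH P *\<^sub>V \<xi> = \<xi>" "ampliation tH P *\<^sub>V \<xi>' = \<xi>'"
      using duplicating_four[OF inf tK tH fs(1,3,2,4)] by metis
    define \<eta>3 where "\<eta>3 = ampliation tK S *\<^sub>V \<eta> + ampliation tK T *\<^sub>V \<eta>'"
    define \<xi>3 where "\<xi>3 = ampliation tH S *\<^sub>V \<xi> + ampliation tH T *\<^sub>V \<xi>'"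
    define y3 where "y3 = lY S (rY w (cadjoint S)) + lY T (rY y (cadjoint T))"
    have "\<gamma> \<eta>3 (\<alpha> *\<^sub>V y3) \<xi>3 = \<gamma> \<eta> (\<alpha> *\<^sub>V w) \<xi> + \<gamma> \<eta>' (\<alpha> *\<^sub>V y) \<xi>'"
      unfolding \<eta>3_def \<xi>3_def y3_def by (rule balanced_direct_sum[OF bY tK tH \<gamma>\<alpha> ST])
    also have "\<dots> = 0" using 0 \<gamma>w by simp
    finally have "\<beta> \<eta>3 y3 \<xi>3 = 0"
      by (intro \<beta>_zero) (simp_all add: \<eta>3_def \<xi>3_def fsK fsH fs)
    moreover have "\<beta> \<eta>3 y3 \<xi>3 = \<beta> \<eta> w \<xi> + \<beta> \<eta>' y \<xi>'"
      unfolding \<eta>3_def \<xi>3_def y3_def by (rule balanced_direct_sum[OF bY tK tH \<beta> ST])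
    ultimately have "- \<beta> \<eta>' y \<xi>' = \<beta> \<eta> w \<xi>" by simp
    also have "\<dots> \<le> norm \<eta> * norm ((\<Phi> *\<^sub>V w) *\<^sub>V \<xi>)"
      unfolding \<beta>_def by (rule norm_cauchy_schwarz)
    also have "norm ((\<Phi> *\<^sub>V w) *\<^sub>V \<xi>) \<le> norm (\<Phi> *\<^sub>V w) * norm \<xi>"
      by (rule norm_cblinfun_apply_le)
    also have "norm (\<Phi> *\<^sub>V w) \<le> c"
      using norm_cblinfun_apply_le[of \<Phi> w] mult_left_mono[OF norm_w \<open>0 \<le> c\<close>] by (simp add: c_def)
    also have "norm \<eta> * (c * norm \<xi>) = c / 2 * (2 * norm \<eta> * norm \<xi>)" by simp
    also have "\<dots> \<le> c / 2 * ((norm \<eta>)\<^sup>2 + (norm \<xi>)\<^sup>2)"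
      using \<open>0 \<le> c\<close> by (intro mult_left_mono sum_squares_bound) simp
    finally show ?thesis by (simp add: mult_left_mono mult_right_mono)
  qed
  have C: "nonneg_cone C"
    unfolding nonneg_cone_def
  proof (intro conjI ballI allI impI)
    show "0 \<in> C"
      unfolding zero_prod_def
      by (rule C_I[of 0 0 0 0 0 0 _ 0]) (simp_all add: fsK fsH \<gamma>_simps \<beta>_simps)
  next
    fix p q assume "p \<in> C" "q \<in> C"
    from this(1) show "p + q \<in> C"
    proof (rule C_E)
      fix \<eta>1 \<xi>1 \<eta>1' \<xi>1' z1 s1 y1
      assume fs1: "finite_support tK \<eta>1" "finite_support tH \<xi>1" "finite_support tK \<eta>1'" "finite_support tH \<xi>1'"
        and z1: "norm z1 \<le> 1" and s1: "c / 2 * ((norm \<eta>1)\<^sup>2 + (norm \<xi>1)\<^sup>2) \<le> s1"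
        and p: "p = (\<gamma> \<eta>1 z1 \<xi>1 + \<gamma> \<eta>1' (\<alpha> *\<^sub>V y1) \<xi>1', s1 + \<beta> \<eta>1' y1 \<xi>1')"
      from \<open>q \<in> C\<close> show ?thesis
      proof (rule C_E)
        fix \<eta>2 \<xi>2 \<eta>2' \<xi>2' z2 s2 y2
        assume fs2: "finite_support tK \<eta>2" "finite_support tH \<xi>2" "finite_support tK \<eta>2'" "finite_support tH \<xi>2'"
          and z2: "norm z2 \<le> 1" and s2: "c / 2 * ((norm \<eta>2)\<^sup>2 + (norm \<xi>2)\<^sup>2) \<le> s2"
          and q: "q = (\<gamma> \<eta>2 z2 \<xi>2 + \<gamma> \<eta>2' (\<alpha> *\<^sub>V y2) \<xi>2', s2 + \<beta> \<eta>2' y2 \<xi>2')"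
        obtain S T P where ST: "duplicating S T P" "ampliation tK P *\<^sub>V \<eta>1 = \<eta>1"
          "ampliation tK P *\<^sub>V \<eta>2 = \<eta>2" "ampliation tH P *\<^sub>V \<xi>1 = \<xi>1" "ampliation tH P *\<^sub>V \<xi>2 = \<xi>2"
          using duplicating_four[OF inf tK tH fs1(1) fs2(1) fs1(2) fs2(2)] by metis
        obtain S' T' P' where ST': "duplicating S' T' P'" "ampliation tK P' *\<^sub>V \<eta>1' = \<eta>1'"
          "ampliation tK P' *\<^sub>V \<eta>2' = \<eta>2'" "ampliation tH P' *\<^sub>V \<xi>1' = \<xi>1'" "ampliation tH P' *\<^sub>V \<xi>2' = \<xi>2'"
          using duplicating_four[OF inf tK tH fs1(3) fs2(3) fs1(4) fs2(4)] by metis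
        define \<eta> where "\<eta> = ampliation tK S *\<^sub>V \<eta>1 + ampliation tK T *\<^sub>V \<eta>2"
        define \<xi> where "\<xi> = ampliation tH S *\<^sub>V \<xi>1 + ampliation tH T *\<^sub>V \<xi>2"
        define z where "z = lZ S (rZ z1 (cadjoint S)) + lZ T (rZ z2 (cadjoint T))"
        define \<eta>' where "\<eta>' = ampliation tK S' *\<^sub>V \<eta>1' + ampliation tK T' *\<^sub>V \<eta>2'"
        define \<xi>' where "\<xi>' = ampliation tH S' *\<^sub>V \<xi>1' + ampliation tH T' *\<^sub>V \<xi>2'"
        define y where "y = lY S' (rY y1 (cadjoint S')) + lY T' (rY y2 (cadjoint T'))"
        have \<gamma>_sum: "\<gamma> \<eta> z \<xi> = \<gamma> \<eta>1 z1 \<xi>1 + \<gamma> \<eta>2 z2 \<xi>2"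
          unfolding \<eta>_def z_def \<xi>_def by (rule balanced_direct_sum[OF bZ tK tH \<gamma> ST])
        have \<gamma>\<alpha>_sum: "\<gamma> \<eta>' (\<alpha> *\<^sub>V y) \<xi>' = \<gamma> \<eta>1' (\<alpha> *\<^sub>V y1) \<xi>1' + \<gamma> \<eta>2' (\<alpha> *\<^sub>V y2) \<xi>2'"
          unfolding \<eta>'_def y_def \<xi>'_def by (rule balanced_direct_sum[OF bY tK tH \<gamma>\<alpha> ST'])
        have \<beta>_sum: "\<beta> \<eta>' y \<xi>' = \<beta> \<eta>1' y1 \<xi>1' + \<beta> \<eta>2' y2 \<xi>2'"
          unfolding \<eta>'_def y_def \<xi>'_def by (rule balanced_direct_sum[OF bY tK tH \<beta> ST'])
        show "p + q \<in> C"
          unfolding p q add_Pair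
        proof (rule C_I[of \<eta> \<xi> \<eta>' \<xi>' z "s1 + s2" _ y])
          show "finite_support tK \<eta>" "finite_support tH \<xi>" "finite_support tK \<eta>'" "finite_support tH \<xi>'"
            by (simp_all add: \<eta>_def \<xi>_def \<eta>'_def \<xi>'_def fsK fsH fs1 fs2)
          show "norm z \<le> 1"
            unfolding z_def by (rule ruan_direct_sum[OF bZ tK tH Z ST(1) z1 z2])
          have "c / 2 * ((norm \<eta>)\<^sup>2 + (norm \<xi>)\<^sup>2) =
            c / 2 * ((norm \<eta>1)\<^sup>2 + (norm \<xi>1)\<^sup>2) + c / 2 * ((norm \<eta>2)\<^sup>2 + (norm \<xi>2)\<^sup>2)"
            unfolding \<eta>_def \<xi>_def norm_ampliation_direct_sum[OF tK ST(1-3)]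
              norm_ampliation_direct_sum[OF tH ST(1,4,5)] by (simp add: algebra_simps)
          then show "c / 2 * ((norm \<eta>)\<^sup>2 + (norm \<xi>)\<^sup>2) \<le> s1 + s2" using s1 s2 by linarith
        qed (simp_all only: \<gamma>_sum \<gamma>\<alpha>_sum \<beta>_sum add_ac)
      qed
    qed
  next
    fix p and s :: real assume "p \<in> C" "0 < s"
    from this(1) show "s *\<^sub>R p \<in> C"
    proof (rule C_E)
      fix \<eta> \<xi> \<eta>' \<xi>' z r y
      assume fs: "finite_support tK \<eta>" "finite_support tH \<xi>" "finite_support tK \<eta>'" "finite_support tH \<xi>'"
        and z: "norm z \<le> 1" and r: "c / 2 * ((norm \<eta>)\<^sup>2 + (norm \<xi>)\<^sup>2) \<le> r"
        and p: "p = (\<gamma> \<eta> z \<xi> + \<gamma> \<eta>' (\<alpha> *\<^sub>V y) \<xi>', r + \<beta> \<eta>' y \<xi>')"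
      \<comment> \<open>Here \<open>sqrt s\<close> goes to \<eta> and \<xi>, as \<open>z\<close> has
        to stay in the unit ball.\<close>
      have "c / 2 * ((norm (sqrt s *\<^sub>R \<eta>))\<^sup>2 + (norm (sqrt s *\<^sub>R \<xi>))\<^sup>2) =
        s * (c / 2 * ((norm \<eta>)\<^sup>2 + (norm \<xi>)\<^sup>2))"
        using \<open>0 < s\<close> by (simp add: power_mult_distrib algebra_simps)
      also have "\<dots> \<le> s * r" using r \<open>0 < s\<close> by simp
      finally show "s *\<^sub>R p \<in> C"
        unfolding p scaleR_Pair using \<open>0 < s\<close> z
        by (intro C_I[of "sqrt s *\<^sub>R \<eta>" "sqrt s *\<^sub>R \<xi>" "s *\<^sub>R \<eta>'" \<xi>' z "s * r" _ y])
          (simp_all add: fsK fsH fs \<gamma>_simps \<beta>_simps algebra_simps)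
    qed
  next
    fix s assume "(0, s) \<in> C"
    then show "0 \<le> s"
    proof (rule C_E)
      fix \<eta> \<xi> \<eta>' \<xi>' z r y
      assume "finite_support tK \<eta>" "finite_support tH \<xi>" "finite_support tK \<eta>'" "finite_support tH \<xi>'"
        "norm z \<le> 1" "c / 2 * ((norm \<eta>)\<^sup>2 + (norm \<xi>)\<^sup>2) \<le> r"
        "(0, s) = (\<gamma> \<eta> z \<xi> + \<gamma> \<eta>' (\<alpha> *\<^sub>V y) \<xi>', r + \<beta> \<eta>' y \<xi>')"
      then show "0 \<le> s" using nonneg[of \<eta> \<xi> \<eta>' \<xi>' z y] by simp
    qed
  qed
  have "- u \<in> fst ` C" if u: "u \<in> fst ` C" for u
  proof -
    from u obtain p where "p \<in> C" "u = fst p" by blast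
    from this(1) show ?thesis
    proof (rule C_E)
      fix \<eta> \<xi> \<eta>' \<xi>' z r y
      assume fs: "finite_support tK \<eta>" "finite_support tH \<xi>" "finite_support tK \<eta>'" "finite_support tH \<xi>'"
        and z: "norm z \<le> 1" and p: "p = (\<gamma> \<eta> z \<xi> + \<gamma> \<eta>' (\<alpha> *\<^sub>V y) \<xi>', r + \<beta> \<eta>' y \<xi>')"
      have "(\<gamma> (- 1 *\<^sub>R \<eta>) z \<xi> + \<gamma> (- 1 *\<^sub>R \<eta>') (\<alpha> *\<^sub>V y) \<xi>',
        c / 2 * ((norm (- 1 *\<^sub>R \<eta>))\<^sup>2 + (norm \<xi>)\<^sup>2) + \<beta> (- 1 *\<^sub>R \<eta>') y \<xi>') \<in> C"
        by (rule C_I[OF _ _ _ _ _ order_refl refl refl]) (intro fsK fs z)+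
      then have "\<gamma> (- 1 *\<^sub>R \<eta>) z \<xi> + \<gamma> (- 1 *\<^sub>R \<eta>') (\<alpha> *\<^sub>V y) \<xi>' \<in> fst ` C" by force
      then have "(- 1) *\<^sub>R u \<in> fst ` C"
        unfolding \<open>u = fst p\<close> p fst_conv by (simp only: \<gamma>_simps scaleR_add_right)
      then show ?thesis by simp
    qed
  qed
  from nonneg_cone_support[OF C this] obtain g where g: "\<And>u r. (u, r) \<in> C \<Longrightarrow> g u \<le> r"
    "\<And>u v. u \<in> fst ` C \<Longrightarrow> v \<in> fst ` C \<Longrightarrow> g (u + v) = g u + g v"
    "\<And>t u. u \<in> fst ` C \<Longrightarrow> g (t *\<^sub>R u) = t * g u"
    by blast
  have \<gamma>_C: "(\<gamma> \<eta> z \<xi>, c / 2 * ((norm \<eta>)\<^sup>2 + (norm \<xi>)\<^sup>2)) \<in> C"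
    if "finite_support tK \<eta>" "finite_support tH \<xi>" "norm z \<le> 1" for \<eta> z \<xi>
    by (rule C_I[of \<eta> \<xi> 0 0 z "c / 2 * ((norm \<eta>)\<^sup>2 + (norm \<xi>)\<^sup>2)" _ 0])
      (simp_all add: that fsK fsH \<gamma>_simps \<beta>_simps)
  have dom: "\<gamma> \<eta> z \<xi> \<in> fst ` C" if "finite_support tK \<eta>" "finite_support tH \<xi>" for \<eta> z \<xi>
  proof (cases "z = 0")
    case True
    then show ?thesis using \<gamma>_C[OF that, of 0] by force
  next
    case False
    \<comment> \<open>The norm of \<open>z\<close> is shifted to \<eta>, so that the middle factor
      lies in the unit ball while the tensor is unchanged.\<close>
    have "(\<gamma> (norm z *\<^sub>R \<eta>) (inverse (norm z) *\<^sub>R z) \<xi>,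
      c / 2 * ((norm (norm z *\<^sub>R \<eta>))\<^sup>2 + (norm \<xi>)\<^sup>2)) \<in> C"
      using False by (intro \<gamma>_C fsK that) simp
    then have "\<gamma> (norm z *\<^sub>R \<eta>) (inverse (norm z) *\<^sub>R z) \<xi> \<in> fst ` C" by force
    then show ?thesis using False by (simp add: \<gamma>_simps)
  qed
  have g0: "g 0 = 0" using g(3)[OF dom[OF fsK(3) fsH(3)], of 0] by simp
  have g_le: "g (\<gamma> \<eta> z \<xi>) \<le> c * norm z * norm \<eta> * norm \<xi>"
    if fs: "finite_support tK \<eta>" "finite_support tH \<xi>" for \<eta> z \<xi>
  proof (cases "z = 0")
    case False
    \<comment> \<open>The cost bounds \<open>g\<close> for middle factors in the unit ball; the norm
      of \<open>z\<close> is put back by homogeneity.\<close>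
    define z1 where "z1 = inverse (norm z) *\<^sub>R z"
    have z: "z = norm z *\<^sub>R z1" "norm z1 \<le> 1" using False by (simp_all add: z1_def)
    have "g (\<gamma> \<eta> z1 \<xi>) \<le> c * (norm \<eta> * norm \<xi>)"
    proof (rule le_of_scaled_le[where G = "\<lambda>s r. g (\<gamma> (s *\<^sub>R \<eta>) z1 (r *\<^sub>R \<xi>))"])
      fix s r :: real assume "0 < s" "0 < r"
      then show "g (\<gamma> (s *\<^sub>R \<eta>) z1 (r *\<^sub>R \<xi>)) \<le> c / 2 * ((s * norm \<eta>)\<^sup>2 + (r * norm \<xi>)\<^sup>2)"
        using g(1)[OF \<gamma>_C[OF fsK(2)[OF fs(1), of s] fsH(2)[OF fs(2), of r] z(2)]] by simp
    qed (auto simp: \<gamma>_simps g0)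
    then have "norm z * g (\<gamma> \<eta> z1 \<xi>) \<le> norm z * (c * (norm \<eta> * norm \<xi>))"
      by (intro mult_left_mono) simp_all
    also have "norm z * g (\<gamma> \<eta> z1 \<xi>) = g (\<gamma> \<eta> (norm z *\<^sub>R z1) \<xi>)"
      by (simp only: \<gamma>_simps g(3)[OF dom[OF fs]])
    finally show ?thesis using z(1) by (simp add: mult_ac)
  qed (simp add: \<gamma>_simps g0)
  have g_\<alpha>: "g (\<gamma> \<eta> (\<alpha> *\<^sub>V y) \<xi>) = \<beta> \<eta> y \<xi>"
    if \<eta>: "finite_support tK \<eta>" and \<xi>: "finite_support tH \<xi>" for \<eta> y \<xi>
  proof -
    have le: "g (\<gamma> \<eta> (\<alpha> *\<^sub>V y) \<xi>) \<le> \<beta> \<eta> y \<xi>" if "finite_support tK \<eta>" for \<eta>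
      by (rule g(1)) (rule C_I[of 0 0 \<eta> \<xi> 0 0], simp_all add: fsK fsH that \<xi> \<gamma>_simps)
    show ?thesis
      using le[OF \<eta>] le[OF fsK(2)[OF \<eta>, of "- 1"]] g(3)[OF dom[OF \<eta> \<xi>], of "- 1"]
      by (simp only: \<gamma>_simps \<beta>_simps) simp
  qed
  \<comment> \<open>For fixed \<open>z\<close> the functional is a bounded form on dense subspaces,
    and the operator it defines is the value of the extension at \<open>z\<close>.\<close>
  have "\<exists>R. (\<forall>\<eta> \<xi>. finite_support tK \<eta> \<longrightarrow> finite_support tH \<xi> \<longrightarrow> inner (R *\<^sub>V \<xi>) \<eta> = g (\<gamma> \<eta> z \<xi>)) \<and>
    norm R \<le> c * norm z" for z
  proof (rule finite_support_form_operator[OF tK tH, of "\<lambda>\<eta> \<xi>. g (\<gamma> \<eta> z \<xi>)" "c * norm z"])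
    show "g (\<gamma> \<eta> z (a *\<^sub>C \<xi>)) = g (\<gamma> (cnj a *\<^sub>C \<eta>) z \<xi>)" for a \<eta> \<xi>
      by (simp add: \<gamma>_def matrix_coeff_scaleC[OF bZ tK tH])
    show "0 \<le> c * norm z" using \<open>0 \<le> c\<close> by simp
  qed (simp_all only: \<gamma>_simps g(2,3) dom g_le real_scaleR_def, blast)
  then have "\<forall>z. \<exists>R. (\<forall>\<eta> \<xi>. finite_support tK \<eta> \<longrightarrow> finite_support tH \<xi> \<longrightarrow>
    inner (R *\<^sub>V \<xi>) \<eta> = g (\<gamma> \<eta> z \<xi>)) \<and> norm R \<le> c * norm z" by blast
  then obtain \<psi> where "\<forall>z. (\<forall>\<eta> \<xi>. finite_support tK \<eta> \<longrightarrow> finite_support tH \<xi> \<longrightarrow>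
    inner (\<psi> z *\<^sub>V \<xi>) \<eta> = g (\<gamma> \<eta> z \<xi>)) \<and> norm (\<psi> z) \<le> c * norm z"
    by (rule choice[THEN exE])
  then have \<psi>: "\<And>z \<eta> \<xi>. finite_support tK \<eta> \<Longrightarrow> finite_support tH \<xi> \<Longrightarrow>
      inner (\<psi> z *\<^sub>V \<xi>) \<eta> = g (\<gamma> \<eta> z \<xi>)" "\<And>z. norm (\<psi> z) \<le> c * norm z" by simp_all
  have "bounded_clinear \<psi>"
  proof (rule bounded_clinearI)
    show "\<psi> (z + z') = \<psi> z + \<psi> z'" for z z'
      by (rule operator_eqI[OF tK tH]) (simp add: \<psi> inner_add_left \<gamma>_simps g dom)
    show "\<psi> (a *\<^sub>C z) = a *\<^sub>C \<psi> z" for a z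
    proof (rule operator_eqI[OF tK tH])
      fix \<eta> \<xi> assume fs: "finite_support tK \<eta>" "finite_support tH \<xi>"
      have "inner (\<psi> (a *\<^sub>C z) *\<^sub>V \<xi>) \<eta> = g (\<gamma> (cnj a *\<^sub>C \<eta>) z \<xi>)"
        using fs by (simp add: \<psi> \<gamma>_def matrix_coeff_scaleC[OF bZ tK tH])
      also have "\<dots> = inner (\<psi> z *\<^sub>V \<xi>) (cnj a *\<^sub>C \<eta>)"
        by (rule \<psi>(1)[symmetric]) (intro fsK fs)+
      also have "\<dots> = inner ((a *\<^sub>C \<psi> z) *\<^sub>V \<xi>) \<eta>"
        by (simp add: cinner_scaleC_left cinner_scaleC_right flip: Re_cinner)
      finally show "inner (\<psi> (a *\<^sub>C z) *\<^sub>V \<xi>) \<eta> = inner ((a *\<^sub>C \<psi> z) *\<^sub>V \<xi>) \<eta>" .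
    qed
  qed (rule \<psi>(2))
  then have \<Psi>: "cBlinfun \<psi> *\<^sub>V z = \<psi> z" for z by (simp add: cBlinfun_inverse)
  have "left_morphism lZ (operator_left_action tK) (cBlinfun \<psi>)"
    unfolding left_morphism_def operator_left_action_def \<Psi>
  proof (intro allI operator_eqI[OF tK tH])
    fix a z \<eta> \<xi> assume fs: "finite_support tK \<eta>" "finite_support tH \<xi>"
    have "inner (\<psi> (lZ a z) *\<^sub>V \<xi>) \<eta> = inner (\<psi> z *\<^sub>V \<xi>) (cadjoint (ampliation tK a) *\<^sub>V \<eta>)"
      using fs by (simp add: \<psi> \<gamma>_simps fsK cadjoint_ampliation[OF tK])
    then show "inner (\<psi> (lZ a z) *\<^sub>V \<xi>) \<eta> = inner ((ampliation tK a o\<^sub>C\<^sub>L \<psi> z) *\<^sub>V \<xi>) \<eta>"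
      using inner_cadjoint[of "ampliation tK a" \<eta> "\<psi> z *\<^sub>V \<xi>"]
      by (simp only: cblinfun_compose.rep_eq inner_commute[of _ \<eta>] inner_commute[of "cadjoint _ *\<^sub>V \<eta>"])
  qed
  moreover have "right_morphism rZ (operator_right_action tH) (cBlinfun \<psi>)"
    unfolding right_morphism_def operator_right_action_def \<Psi>
    by (intro allI operator_eqI[OF tK tH]) (simp add: \<psi> \<gamma>_simps fsH)
  moreover have ext: "cBlinfun \<psi> o\<^sub>C\<^sub>L \<alpha> = \<Phi>"
  proof (rule cblinfun_eqI)
    fix y
    show "(cBlinfun \<psi> o\<^sub>C\<^sub>L \<alpha>) *\<^sub>V y = \<Phi> *\<^sub>V y"
      by (rule operator_eqI[OF tK tH])
        (simp add: \<Psi> \<psi> g_\<alpha> \<beta>_def inner_commute[of "(\<Phi> *\<^sub>V y) *\<^sub>V _"])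
  qed
  moreover have "norm (cBlinfun \<psi>) = norm \<Phi>"
    by (intro norm_eq_of_isometric_extension[OF \<alpha>(3) ext], rule norm_cblinfun_leI)
      (simp_all add: \<Psi> \<psi>(2)[unfolded c_def])
  ultimately have "left_morphism lZ (operator_left_action tK) (cBlinfun \<psi>) \<and>
    right_morphism rZ (operator_right_action tH) (cBlinfun \<psi>) \<and> cBlinfun \<psi> o\<^sub>C\<^sub>L \<alpha> = \<Phi> \<and>
    norm (cBlinfun \<psi>) = norm \<Phi>" by simp
  then show "\<exists>\<Psi>. left_morphism lZ (operator_left_action tK) \<Psi> \<and>
    right_morphism rZ (operator_right_action tH) \<Psi> \<and> \<Psi> o\<^sub>C\<^sub>L \<alpha> = \<Phi> \<and> norm \<Psi> = norm \<Phi>" ..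
qed

theorem theorem3:
  fixes tLH :: "'l::chilbert_space \<Rightarrow> 'h::chilbert_space \<Rightarrow> 'lh::chilbert_space"
    and tLcH :: "'l conj_space \<Rightarrow> 'h \<Rightarrow> 'lch::chilbert_space"
    and tLK :: "'l \<Rightarrow> 'k::chilbert_space \<Rightarrow> 'lk::chilbert_space"
  assumes separable: "separable_space (euclidean :: 'l topology)"
    and infinite_dim: "\<not> (\<exists>B :: 'l set. finite B \<and> cspan B = UNIV)"
    and "hilbert_tensor tLH" and "hilbert_tensor tLcH" and "hilbert_tensor tLK"
  shows "esr_injective_left TYPE('y1::complex_normed_vector) TYPE('z1::complex_normed_vector)
      (tensor_left_action tLH) \<and>
    esr_injective_right TYPE('y2::complex_normed_vector) TYPE('z2::complex_normed_vector)
      (tensor_right_action tLcH) \<and>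
    er_injective TYPE('y3::complex_normed_vector) TYPE('z3::complex_normed_vector)
      (operator_left_action tLK :: _ \<Rightarrow> ('lh \<Rightarrow>\<^sub>C\<^sub>L 'lk) \<Rightarrow> _) (operator_right_action tLH)"
proof -
  note inf = infinite_dimensionalI[OF infinite_dim]
  show ?thesis
    by (intro conjI esr_injective_tensor_left_action esr_injective_tensor_right_action
        er_injective_operator_actions inf assms)
qed

end
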